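(* Let $\alpha,\beta,m$ be positive real numbers and let $E\subset\bar{\mathbb{R}}^2_{--}$ be a Riesz set for the hyperbola $\Gamma_m$. Then $\Lambda_{\alpha,\beta}^{E}:=\Lambda_{\alpha,\beta}\cup E$ is a Fourier uniqueness set for $\mathrm{M}(\Gamma_m)$ if and only if $\alpha\beta m^2\le 4\pi^2$.
   Context: For a finite complex-valued Borel measure $\mu$ on $\mathbb{R}^2$, the Fourier transform is $\widehat\mu(\xi)=\int_{\mathbb{R}^2}e^{\pi i\langle x,\xi\rangle}\,d\mu(x)$ for $\xi\in\mathbb{R}^2$, where $\langle x,\xi\rangle=x_1\xi_1+x_2\xi_2$. For $m>0$, $\Gamma_m=\{x\in\mathbb{R}^2: x_1x_2=-m^2/(4\pi^2)\}$, and $\mathrm{M}(\Gamma_m)$ is the space of finite complex-valued Borel measures on $\mathbb{R}^2$ supported on $\Gamma_m$. For $\alpha,\beta>0$, the lattice-cross is $\Lambda_{\alpha,\beta}=(\alpha\mathbb{Z}\times\{0\})\cup(\{0\}\times\beta\mathbb{Z})\subset\mathbb{R}^2$. $\bar{\mathbb{R}}^2_{--}=\{(\xi_1,\xi_2)\in\mathbb{R}^2:\xi_1\le0,\ \xi_2\le0\}$. A set $E\subset\mathbb{R}^2$ is a Riesz set for the hyperbola $\Gamma_m$ if every $\mu\in\mathrm{M}(\Gamma_m)$ with $\widehat\mu=0$ on $E$ is absolutely continuous with respect to arc length measure on $\Gamma_m$. A set $\Lambda\subset\mathbb{R}^2$ is a Fourier uniqueness set for a linear space $X$ of finite complex Borel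 measures on $\mathbb{R}^2$ if every $\mu\in X$ with $\widehat\mu|_\Lambda=0$ satisfies $\mu=0$. *)

theory Defs
  imports "HOL-Analysis.Analysis"
begin

section \<open>Complex Borel measures\<close>

text \<open>
  A complex measure is a countably additive complex-valued set function on the Borel sets; such a
  function is automatically of finite total variation. Values on non-Borel sets are normalised
  to 0, so that equality of set functions is equality of measures and the zero measure is
  \<^term>\<open>\<lambda>_. 0\<close>.
\<close>

definition complex_borel_measure :: "('a::topological_space set \<Rightarrow> complex) \<Rightarrow> bool" where
  "complex_borel_measure \<mu> \<longleftrightarrow>
     (\<forall>A. A \<notin> sets borel \<longrightarrow> \<mu> A = 0) \<and>
     \<mu> {} = 0 \<and>
     (\<forall>A. range A \<subseteq> sets borel \<longrightarrow> disjoint_family A \<longrightarrow>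
        (\<lambda>i::nat. \<mu> (A i)) sums \<mu> (\<Union>i. A i))"

text \<open>
  Positive variation \<open>\<nu>\<^sup>+(A) = sup {\<nu>(B) | B \<subseteq> A Borel}\<close> of a signed measure. The function
  \<^const>\<open>ennreal\<close> sends negative numbers to 0, which does not affect the supremum because
  \<open>B = {}\<close> contributes 0.
\<close>

definition pos_variation :: "('a::topological_space set \<Rightarrow> real) \<Rightarrow> 'a measure" where
  "pos_variation \<nu> =
     measure_of UNIV (sets borel) (\<lambda>A. SUP B\<in>{B \<in> sets borel. B \<subseteq> A}. ennreal (\<nu> B))"

text \<open>The positive variation is a measure, so \<^const>\<open>measure_of\<close> keeps the given values.\<close>

lemma emeasure_pos_variation:
  fixes \<nu> :: "'a::topological_space set \<Rightarrow> real"
  assumes empty: "\<nu> {} = 0"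
    and cadd: "\<And>A. range A \<subseteq> sets borel \<Longrightarrow> disjoint_family A \<Longrightarrow>
                 (\<lambda>i::nat. \<nu> (A i)) sums \<nu> (\<Union>i. A i)"
    and A: "A \<in> sets borel"
  shows "emeasure (pos_variation \<nu>) A = (SUP B\<in>{B \<in> sets borel. B \<subseteq> A}. ennreal (\<nu> B))"
proof -
  define P where "P A = (SUP B\<in>{B \<in> sets borel. B \<subseteq> A}. ennreal (\<nu> B))" for A
  have P_upper: "ennreal (\<nu> B) \<le> P A" if "B \<in> sets borel" "B \<subseteq> A" for A B
    unfolding P_def using that by (intro SUP_upper) auto
  have P_mono: "P A \<le> P B" if "A \<subseteq> B" for A B
    unfolding P_def using that by (intro SUP_subset_mono) auto
  have add: "\<nu> (B \<union> C) = \<nu> B + \<nu> C"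
    if "B \<in> sets borel" "C \<in> sets borel" "B \<inter> C = {}" for B C
  proof -
    have "(\<lambda>i. \<nu> (binaryset B C i)) sums \<nu> (\<Union>i. binaryset B C i)"
      using that by (intro cadd) (auto simp: binaryset_def disjoint_family_on_def)
    then have "(\<lambda>i. \<nu> (binaryset B C i)) sums \<nu> (B \<union> C)" by (simp add: UN_binaryset_eq)
    moreover have "(\<lambda>i. \<nu> (binaryset B C i)) sums (\<nu> B + \<nu> C)"
      by (rule binaryset_sums) (rule empty)
    ultimately show ?thesis using sums_unique2 by blast
  qed
  have sup2: "P A + P B \<le> P (A \<union> B)" if AB: "A \<inter> B = {}" for A B
  proof -
    have nonneg_wit: "ennreal (\<nu> C) + ennreal (\<nu> D) \<le> P (A \<union> B)"
      if "C \<in> sets borel" "C \<subseteq> A" "D \<in> sets borel" "D \<subseteq> B" for C D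
    proof -
      define C' where "C' = (if \<nu> C \<ge> 0 then C else {})"
      define D' where "D' = (if \<nu> D \<ge> 0 then D else {})"
      have 1: "ennreal (\<nu> C) = ennreal (\<nu> C')" "ennreal (\<nu> D) = ennreal (\<nu> D')" "\<nu> C' \<ge> 0" "\<nu> D' \<ge> 0"
        by (auto simp: C'_def D'_def empty ennreal_neg)
      have sub: "C' \<in> sets borel" "D' \<in> sets borel" "C' \<inter> D' = {}" "C' \<union> D' \<subseteq> A \<union> B"
        using that AB by (auto simp: C'_def D'_def)
      have "ennreal (\<nu> C) + ennreal (\<nu> D) = ennreal (\<nu> (C' \<union> D'))"
        using 1 add[OF sub(1-3)] by (simp add: ennreal_plus)
      also have "\<dots> \<le> P (A \<union> B)" using sub by (intro P_upper) auto
      finally show ?thesis .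
    qed
    have ne: "{B \<in> sets borel. B \<subseteq> X} \<noteq> {}" for X :: "'a set" by auto
    have "P A + P B = (SUP C\<in>{C \<in> sets borel. C \<subseteq> A}. SUP D\<in>{D \<in> sets borel. D \<subseteq> B}. ennreal (\<nu> C) + ennreal (\<nu> D))"
      unfolding P_def using ne
      by (subst ennreal_SUP_add_left[symmetric], simp, intro SUP_cong refl, subst ennreal_SUP_add_right) auto
    also have "\<dots> \<le> P (A \<union> B)" by (intro SUP_least) (auto intro: nonneg_wit)
    finally show ?thesis .
  qed
  have "countably_additive (sets borel) P"
  proof (rule countably_additiveI)
    fix F :: "nat \<Rightarrow> 'a set"
    assume F: "range F \<subseteq> sets borel" "disjoint_family F"
    show "(\<Sum>i. P (F i)) = P (\<Union>i. F i)"
    proof (rule antisym)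
      have "(\<Sum>i<n. P (F i)) \<le> P (\<Union>i<n. F i)" for n
      proof (induction n)
        case (Suc n)
        have "F i \<inter> F n = {}" if "i < n" for i using disjoint_family_onD[OF F(2), of i n] that by simp
        then have "(\<Union>i<n. F i) \<inter> F n = {}" by blast
        have "(\<Sum>i<Suc n. P (F i)) \<le> P (\<Union>i<n. F i) + P (F n)"
          using Suc by (simp add: add_right_mono)
        also have "\<dots> \<le> P ((\<Union>i<n. F i) \<union> F n)" by (rule sup2) fact
        also have "(\<Union>i<n. F i) \<union> F n = (\<Union>i<Suc n. F i)" by (auto simp: less_Suc_eq)
        finally show ?case .
      qed simp
      then have "(\<Sum>i<n. P (F i)) \<le> P (\<Union>i. F i)" for n
        by (rule order_trans) (intro P_mono, auto)
      then show "(\<Sum>i. P (F i)) \<le> P (\<Union>i. F i)"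
        by (intro suminf_le_const) auto
    next
      show "P (\<Union>i. F i) \<le> (\<Sum>i. P (F i))"
      proof (subst P_def, intro SUP_least, clarify)
        fix B :: "'a set" assume B: "B \<in> sets borel" "B \<subseteq> (\<Union>i. F i)"
        have s: "(\<lambda>i. \<nu> (B \<inter> F i)) sums \<nu> (\<Union>i. B \<inter> F i)"
          using F B by (intro cadd) (auto simp: disjoint_family_on_def)
        have "(\<Union>i. B \<inter> F i) = B" using B by auto
        with s have s: "(\<lambda>i. \<nu> (B \<inter> F i)) sums \<nu> B" by simp
        have part: "ennreal (\<Sum>i<n. \<nu> (B \<inter> F i)) \<le> (\<Sum>i. P (F i))" for n
        proof -
          have "ennreal (\<Sum>i<n. \<nu> (B \<inter> F i)) \<le> ennreal (\<Sum>i<n. max 0 (\<nu> (B \<inter> F i)))"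
            by (intro ennreal_leI sum_mono) auto
          also have "\<dots> = (\<Sum>i<n. ennreal (\<nu> (B \<inter> F i)))"
            by (simp add: sum_ennreal[symmetric] ennreal_max_0 del: sum_ennreal)
          also have "\<dots> \<le> (\<Sum>i<n. P (F i))"
            using F B by (intro sum_mono P_upper) auto
          also have "\<dots> \<le> (\<Sum>i. P (F i))" by (intro sum_le_suminf) auto
          finally show ?thesis .
        qed
        have "(\<lambda>n. ennreal (\<Sum>i<n. \<nu> (B \<inter> F i))) \<longlonglongrightarrow> ennreal (\<nu> B)"
          using s by (intro tendsto_ennrealI) (simp add: sums_def)
        then show "ennreal (\<nu> B) \<le> (\<Sum>i. P (F i))"
          using part by (intro LIMSEQ_le_const2) auto
      qed
    qed
  qed
  moreover have "positive (sets borel) P"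
    by (auto simp: positive_def P_def empty bot_ennreal intro!: antisym SUP_least)
  moreover have "sigma_algebra UNIV (sets (borel :: 'a measure))"
    using sets.sigma_algebra_axioms[of "borel :: 'a measure"] by simp
  ultimately show ?thesis
    using A unfolding pos_variation_def P_def[symmetric]
    by (subst emeasure_measure_of_sigma) auto
qed

text \<open>
  Integration against a complex measure through the Jordan decompositions
  \<open>\<mu> = (Re \<mu>)\<^sup>+ - (Re \<mu>)\<^sup>- + i ((Im \<mu>)\<^sup>+ - (Im \<mu>)\<^sup>-)\<close>, where \<open>\<nu>\<^sup>- = (-\<nu>)\<^sup>+\<close>.
\<close>

definition complex_measure_integral ::
  "('a::topological_space set \<Rightarrow> complex) \<Rightarrow> ('a \<Rightarrow> complex) \<Rightarrow> complex" where
  "complex_measure_integral \<mu> f =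
     (\<integral>x. f x \<partial>pos_variation (\<lambda>A. Re (\<mu> A))) - (\<integral>x. f x \<partial>pos_variation (\<lambda>A. - Re (\<mu> A))) +
     \<i> * ((\<integral>x. f x \<partial>pos_variation (\<lambda>A. Im (\<mu> A))) - (\<integral>x. f x \<partial>pos_variation (\<lambda>A. - Im (\<mu> A))))"

definition fourier_transform :: "((real \<times> real) set \<Rightarrow> complex) \<Rightarrow> real \<times> real \<Rightarrow> complex" where
  "fourier_transform \<mu> \<xi> =
     complex_measure_integral \<mu> (\<lambda>x. exp (\<i> * complex_of_real (pi * (x \<bullet> \<xi>))))"

text \<open>
  \<open>\<mu>\<close> is supported on \<open>\<Gamma>\<close> when the complement of \<open>\<Gamma>\<close> is a null set for the total variation of \<open>\<mu>\<close>.
  For closed \<open>\<Gamma>\<close> this says that the topological support of \<open>\<mu>\<close> is contained in \<open>\<Gamma>\<close>.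
\<close>

definition measures_on :: "'a::topological_space set \<Rightarrow> ('a set \<Rightarrow> complex) set" where
  "measures_on \<Gamma> =
     {\<mu>. complex_borel_measure \<mu> \<and> (\<forall>A\<in>sets borel. A \<inter> \<Gamma> = {} \<longrightarrow> \<mu> A = 0)}"

definition absolutely_continuous_wrt :: "('a set \<Rightarrow> complex) \<Rightarrow> 'a measure \<Rightarrow> bool" where
  "absolutely_continuous_wrt \<mu> N \<longleftrightarrow> (\<forall>A\<in>null_sets N. \<mu> A = 0)"

definition fourier_uniqueness_set ::
  "(real \<times> real) set \<Rightarrow> ((real \<times> real) set \<Rightarrow> complex) set \<Rightarrow> bool" where
  "fourier_uniqueness_set \<Lambda> X \<longleftrightarrow>
     (\<forall>\<mu>\<in>X. (\<forall>\<xi>\<in>\<Lambda>. fourier_transform \<mu> \<xi> = 0) \<longrightarrow> \<mu> = (\<lambda>_. 0))"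


section \<open>The hyperbola and the lattice-cross\<close>

definition hyperbola :: "real \<Rightarrow> (real \<times> real) set" where
  "hyperbola m = {(x1, x2). x1 * x2 = - (m\<^sup>2 / (4 * pi\<^sup>2))}"

definition hyperbola_param :: "real \<Rightarrow> real \<Rightarrow> real \<times> real" where
  "hyperbola_param m t = (t, - (m\<^sup>2 / (4 * pi\<^sup>2)) / t)"

text \<open>
  Arc length on \<open>hyperbola m\<close>, as a Borel measure on the plane: the image of
  \<open>|\<gamma>'(t)| dt\<close> on \<open>t \<noteq> 0\<close> under the injective parametrisation \<open>\<gamma> = hyperbola_param m\<close>.
\<close>

definition arc_length_measure :: "real \<Rightarrow> (real \<times> real) measure" where
  "arc_length_measure m =
     distr (density (restrict_space lborel (- {0}))
              (\<lambda>t. ennreal (norm (vector_derivative (hyperbola_param m) (at t)))))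
           borel (hyperbola_param m)"

lemma norm_vector_derivative_hyperbola_param:
  assumes "t \<noteq> 0"
  shows "norm (vector_derivative (hyperbola_param m) (at t)) = sqrt (1 + (m\<^sup>2 / (4 * pi\<^sup>2) / t\<^sup>2)\<^sup>2)"
proof -
  have "(hyperbola_param m has_vector_derivative (1, m\<^sup>2 / (4 * pi\<^sup>2) / t\<^sup>2)) (at t)"
    unfolding hyperbola_param_def[abs_def]
    apply (rule has_vector_derivative_Pair)
     apply (simp add: has_real_derivative_iff_has_vector_derivative[symmetric])
    unfolding has_real_derivative_iff_has_vector_derivative[symmetric]
    by (rule derivative_eq_intros refl | use assms in \<open>simp add: field_simps power2_eq_square\<close>)+
  from vector_derivative_at[OF this] show ?thesis by (simp add: norm_Pair)
qed

lemma measurable_hyperbola_param: "hyperbola_param m \<in> restrict_space lborel (-{0}) \<rightarrow>\<^sub>M borel"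
  unfolding hyperbola_param_def[abs_def]
  by (intro measurable_restrict_space1) measurable

lemma measurable_hyperbola_speed: "(\<lambda>t. ennreal (norm (vector_derivative (hyperbola_param m) (at t)))) \<in> borel_measurable (restrict_space lborel (-{0}))"
proof -
  have "(\<lambda>t. ennreal (sqrt (1 + (m\<^sup>2 / (4 * pi\<^sup>2) / t\<^sup>2)\<^sup>2))) \<in> borel_measurable (restrict_space lborel (-{0}))"
    by (intro measurable_restrict_space1) measurable
  then show ?thesis
    by (subst measurable_cong[where g="(\<lambda>t. ennreal (sqrt (1 + (m\<^sup>2 / (4 * pi\<^sup>2) / t\<^sup>2)\<^sup>2)))"])
       (auto simp: space_restrict_space norm_vector_derivative_hyperbola_param)
qed

definition riesz_set :: "real \<Rightarrow> (real \<times> real) set \<Rightarrow> bool" where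
  "riesz_set m E \<longleftrightarrow>
     (\<forall>\<mu>\<in>measures_on (hyperbola m).
        (\<forall>\<xi>\<in>E. fourier_transform \<mu> \<xi> = 0) \<longrightarrow>
        absolutely_continuous_wrt \<mu> (arc_length_measure m))"

definition lattice_cross :: "real \<Rightarrow> real \<Rightarrow> (real \<times> real) set" where
  "lattice_cross \<alpha> \<beta> =
     (range (\<lambda>j::int. \<alpha> * of_int j) \<times> {0}) \<union> ({0} \<times> range (\<lambda>k::int. \<beta> * of_int k))"

definition closed_quadrant_neg :: "(real \<times> real) set" where
  "closed_quadrant_neg = {(\<xi>1, \<xi>2). \<xi>1 \<le> 0 \<and> \<xi>2 \<le> 0}"

end

theory Submission
  imports Defs "HOL-Complex_Analysis.Complex_Analysis" "HOL-Probability.Sinc_Integral"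
begin

text \<open>
  On the hyperbola, put \<open>u = \<alpha> x\<^sub>1\<close>, so that \<open>\<beta> x\<^sub>2 = -\<gamma>/u\<close> with \<open>\<gamma> = \<alpha>\<beta>m\<^sup>2/(4\<pi>\<^sup>2)\<close>.
  Vanishing of the transform on the lattice-cross says that the push-forwards of \<open>\<mu>\<close> under \<open>u\<close> and
  under \<open>-\<gamma>/u\<close> both have vanishing 2-periodization.

  If \<open>\<gamma> \<le> 1\<close>, this forces the total variation of a set \<open>A\<close> in \<open>(-1,1)\<close> to be at most that of its
  preimage under the Gauss-type map \<open>y \<mapsto> -\<gamma>/y mod 2\<close> restricted to \<open>|y| < \<gamma>\<close>, hence at most that of
  all iterated preimages. The Lebesgue measure of these tends to 0, and \<open>\<mu>\<close> is absolutely continuous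
  by the Riesz property, so \<open>\<mu> = 0\<close>. For the decay, the transfer operator for \<open>\<gamma> = 1\<close> maps power series
  in \<open>x\<^sup>2\<close> with nonnegative nonincreasing coefficients to such series; on coefficients it is a Markov
  operator that is symmetric with respect to the infinite measure \<open>n \<mapsto> 1/(2n+1)\<close>, so the
  coefficients of the iterates of 1 tend to 0.

  If \<open>\<gamma> > 1\<close>, there are \<open>p, q\<close> in the upper half-plane with \<open>\<alpha>q = \<alpha>p + 2\<close> and \<open>\<alpha>p \<cdot> \<alpha>q = -\<gamma>\<close>.
  The exponentials of the lattice-cross that are bounded in the upper half-plane take equal values at \<open>p\<close>
  and \<open>q\<close>, and those of the quadrant are bounded in the lower half-plane; so the density
  \<open>1/((t - p)(t - q))\<close> annihilates all of them.
\<close>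

section \<open>Negative binomial series and the coefficient kernel\<close>

text \<open>The critical value \<gamma> = 1 shapes the argument. The Gauss-type map then has an
  indifferent fixed point at 1, identified with -1 modulo 2, and the invariant density
  \<open>1/(1 - x^2)\<close> of infinite mass, so there is no finite equilibrium with a spectral gap
  to converge to. The coefficients of that density are all 1, which is the statement that the kernel
  rows sum to 1; the weight \<open>1/(2n+1)\<close> is the integral of \<open>x^(2n)\<close> over
  (0,1), so its conservation is conservation of mass. Decay comes from the divergence of the sum of
  \<open>1/(2n+1)\<close>: a nonzero limit of the coefficients would be the same for all n and have
  infinite weight. Since \<open>1/(1 - x^2)\<close> blows up at 1 and -1, the decay is shown for
  sets inside [-a,a] with a < 1, and without a rate, so absolute continuity is exploited through
  Borel-Cantelli along a subsequence. For \<gamma> < 1 the inverse branches and their derivatives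
  are dominated by those for \<gamma> = 1. The converse starts at the same threshold: w = \<alpha>p
  must solve w(w + 2) = -\<gamma>, whose roots -1 +- i sqrt(\<gamma> - 1) leave the real line
  exactly for \<gamma> > 1.\<close>

lemma negative_binomial_sums:
  fixes r :: real
  assumes "\<bar>r\<bar> < 1"
  shows "(\<lambda>l. real ((l + k) choose k) * r ^ l) sums (1 / (1 - r) ^ Suc k)"
proof -
  have "(\<lambda>l. (- real (Suc k) gchoose l) * (- r) ^ l) sums (1 + (- r)) powr (- real (Suc k))"
    by (rule Generalised_Binomial_Theorem.gen_binomial_real) (use assms in simp)
  moreover have "(- real (Suc k) gchoose l) * (- r) ^ l = real ((l + k) choose k) * r ^ l" for l
  proof -
    have "(- real (Suc k) gchoose l) = (- 1) ^ l * real ((l + k) choose l)"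
      by (subst gbinomial_minus) (simp add: binomial_gbinomial add.commute)
    moreover have "(l + k) choose l = (l + k) choose k"
      using binomial_symmetric[of l "l + k"] by simp
    moreover have "(- 1) ^ l * (- r) ^ l = r ^ l" by (simp flip: power_mult_distrib)
    ultimately show ?thesis by (simp only: mult.assoc[symmetric] mult.commute[of "(- 1) ^ l" "real _"]) (simp only: mult.assoc)
  qed
  moreover have "(1 + (- r)) powr (- real (Suc k)) = 1 / (1 - r) ^ Suc k"
    using assms by (subst powr_minus_divide, subst powr_realpow) auto
  ultimately show ?thesis by simp
qed

text \<open>Subtracting the series at \<open>- r\<close> from the series at \<open>r\<close> cancels
  the even terms. With \<open>k = 2 * m\<close> this is the sum over \<open>n\<close> along row
  \<open>m\<close> of the kernel.\<close>

lemma negative_binomial_odd_sums: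
  fixes r :: real
  assumes "\<bar>r\<bar> < 1"
  shows "(\<lambda>n. 2 * real ((2 * n + 1 + k) choose k) * r ^ (2 * n + 1)) sums
           (1 / (1 - r) ^ Suc k - 1 / (1 + r) ^ Suc k)"
proof -
  let ?f = "\<lambda>l. real ((l + k) choose k) * r ^ l - real ((l + k) choose k) * (- r) ^ l"
  have s: "?f sums (1 / (1 - r) ^ Suc k - 1 / (1 + r) ^ Suc k)"
    using sums_diff[OF negative_binomial_sums[OF assms, of k] negative_binomial_sums[of "- r" k]] assms
    by simp
  have z: "?f n = 0" if "n \<notin> range (\<lambda>n. 2 * n + 1)" for n
  proof -
    have "even n" using that by (metis oddE rangeI)
    then show ?thesis by simp
  qed
  have "(\<lambda>n. ?f (2 * n + 1)) sums (1 / (1 - r) ^ Suc k - 1 / (1 + r) ^ Suc k)"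
    using sums_mono_reindex[of "\<lambda>n. 2 * n + 1" ?f] s z by (simp add: strict_mono_def)
  then show ?thesis by (simp add: algebra_simps)
qed

text \<open>Adding the series at \<open>r\<close> and \<open>- r\<close> cancels the odd terms. With
  \<open>k = 2 * n + 1\<close> this expands a symmetric pair of branches in powers of
  \<open>x^2\<close>.\<close>

lemma negative_binomial_even_sums:
  fixes r :: real
  assumes "\<bar>r\<bar> < 1"
  shows "(\<lambda>n. 2 * real ((2 * n + k) choose k) * r ^ (2 * n)) sums
           (1 / (1 - r) ^ Suc k + 1 / (1 + r) ^ Suc k)"
proof -
  let ?f = "\<lambda>l. real ((l + k) choose k) * r ^ l + real ((l + k) choose k) * (- r) ^ l"
  have s: "?f sums (1 / (1 - r) ^ Suc k + 1 / (1 + r) ^ Suc k)"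
    using sums_add[OF negative_binomial_sums[OF assms, of k] negative_binomial_sums[of "- r" k]] assms
    by simp
  have z: "?f n = 0" if "n \<notin> range (\<lambda>n. 2 * n)" for n
  proof -
    have "odd n" using that by (metis evenE rangeI)
    then show ?thesis by simp
  qed
  have "(\<lambda>n. ?f (2 * n)) sums (1 / (1 - r) ^ Suc k + 1 / (1 + r) ^ Suc k)"
    using sums_mono_reindex[of "\<lambda>n. 2 * n" ?f] s z by (simp add: strict_mono_def)
  then show ?thesis by (simp add: algebra_simps)
qed

section \<open>Double series, even zeta values and the Markov kernel\<close>

lemma suminf_ennreal_swap:
  fixes f :: "nat \<Rightarrow> nat \<Rightarrow> ennreal"
  shows "(\<Sum>i. \<Sum>j. f i j) = (\<Sum>j. \<Sum>i. f i j)"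
  using nn_integral_suminf[of f "count_space UNIV"] by (simp add: nn_integral_count_space_nat)

lemma suminf_ennreal_sums: "(\<And>n. 0 \<le> f n) \<Longrightarrow> f sums x \<Longrightarrow> (\<Sum>n. ennreal (f n)) = ennreal x"
  by (metis suminf_ennreal2 sums_summable sums_unique)

text \<open>This is \<zeta>(2s)/4^s, the sum over the positive even shifts; the negative shifts are
  accounted for by the factor 2 in \<open>gauss_kernel\<close>.\<close>

definition even_zeta :: "nat \<Rightarrow> real" where
  "even_zeta s = (\<Sum>j. 1 / (2 * real (Suc j)) ^ (2 * s))"

lemma summable_even_zeta: "s \<ge> 1 \<Longrightarrow> summable (\<lambda>j. 1 / (2 * real (Suc j)) ^ (2 * s))"
proof -
  assume "s \<ge> 1"
  then have "summable (\<lambda>n. inverse (real n ^ (2 * s)))" by (intro inverse_power_summable) simp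
  then have "summable (\<lambda>n. inverse (real (Suc n) ^ (2 * s)))" by (subst summable_Suc_iff)
  then have "summable (\<lambda>n. 1 / 2 ^ (2 * s) * inverse (real (Suc n) ^ (2 * s)))" by (rule summable_mult)
  moreover have "1 / 2 ^ (2 * s) * inverse (real (Suc n) ^ (2 * s)) = 1 / (2 * real (Suc n)) ^ (2 * s)" for n
    by (simp only: power_mult_distrib inverse_eq_divide) simp
  ultimately show ?thesis by (simp only:)
qed

lemma even_zeta_pos: "s \<ge> 1 \<Longrightarrow> even_zeta s > 0"
  unfolding even_zeta_def by (intro suminf_pos summable_even_zeta) auto

text \<open>Cauchy-Schwarz: for each shift the terms of consecutive zeta values are in geometric
  progression, so the quadratic in \<open>t\<close> is a sum of squares with positive
  weights.\<close>

lemma even_zeta_log_convex: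
  assumes "s \<ge> 1"
  shows "even_zeta (Suc s) ^ 2 \<le> even_zeta s * even_zeta (Suc (Suc s))"
proof -
  let ?x = "\<lambda>s j. 1 / (2 * real (Suc j)) ^ (2 * s)"
  \<comment> \<open>The minimiser of the quadratic; its nonnegativity at this point is the claim up
    to a positive factor.\<close>
  define t where "t = even_zeta (Suc s) / even_zeta (Suc (Suc s))"
  note S = summable_even_zeta[THEN summable_sums, folded even_zeta_def]
  have "(\<lambda>j. ?x s j - 2 * t * ?x (Suc s) j + t\<^sup>2 * ?x (Suc (Suc s)) j) sums
        (even_zeta s - 2 * t * even_zeta (Suc s) + t\<^sup>2 * even_zeta (Suc (Suc s)))"
    using assms by (intro sums_add sums_diff sums_mult S) auto
  moreover have "?x s j - 2 * t * ?x (Suc s) j + t\<^sup>2 * ?x (Suc (Suc s)) j =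
      ?x s j * (1 - t / (2 * real (Suc j)) ^ 2) ^ 2" for j
  proof -
    have "1 / P - 2 * t * (1 / (P * Q)) + t\<^sup>2 * (1 / (P * Q * Q)) = 1 / P * (1 - t / Q)\<^sup>2"
      if "P \<noteq> 0" "Q \<noteq> 0" for P Q :: real
      using that by (simp add: power2_eq_square field_simps)
    moreover have "y ^ (2 * Suc s) = y ^ (2 * s) * y\<^sup>2" for y :: real and s
      by (simp add: power2_eq_square)
    moreover have "2 * real (Suc j) \<noteq> 0" by simp
    ultimately show ?thesis by (simp only: power_not_zero not_False_eq_True)
  qed
  ultimately have "(\<lambda>j. ?x s j * (1 - t / (2 * real (Suc j)) ^ 2) ^ 2) sums
      (even_zeta s - 2 * t * even_zeta (Suc s) + t\<^sup>2 * even_zeta (Suc (Suc s)))"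
    by (simp only:)
  then have "0 \<le> even_zeta s - 2 * t * even_zeta (Suc s) + t\<^sup>2 * even_zeta (Suc (Suc s))"
    by (rule sums_le[OF _ sums_zero, rotated]) simp
  then have "0 \<le> (even_zeta s - 2 * t * even_zeta (Suc s) + t\<^sup>2 * even_zeta (Suc (Suc s))) * even_zeta (Suc (Suc s))"
    using even_zeta_pos[of "Suc (Suc s)"] by simp
  also have "\<dots> = even_zeta s * even_zeta (Suc (Suc s)) - 2 * (t * even_zeta (Suc (Suc s))) * even_zeta (Suc s)
      + (t * even_zeta (Suc (Suc s)))\<^sup>2"
    by (simp add: algebra_simps power2_eq_square)
  also have "t * even_zeta (Suc (Suc s)) = even_zeta (Suc s)"
    using even_zeta_pos[of "Suc (Suc s)"] by (simp add: t_def)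
  finally show ?thesis by (simp add: power2_eq_square)
qed

text \<open>
  \<open>gauss_kernel m n\<close> is the coefficient of \<open>x\<^sup>2\<^sup>m\<close> in the expansion of
  \<open>\<Sum>j \<noteq> 0. (x + 2j)\<^sup>-\<^sup>2 (-1/(x + 2j))\<^sup>2\<^sup>n\<close>, the image of \<open>x\<^sup>2\<^sup>n\<close> under the transfer operator.
\<close>

definition gauss_kernel :: "nat \<Rightarrow> nat \<Rightarrow> real" where
  "gauss_kernel m n = 2 * real ((2 * n + 1 + 2 * m) choose (2 * m)) * even_zeta (n + m + 1)"

lemma gauss_kernel_pos: "gauss_kernel m n > 0"
  unfolding gauss_kernel_def using even_zeta_pos[of "n + m + 1"] by (simp add: zero_less_binomial_iff)

lemma gauss_kernel_nonneg [simp]: "0 \<le> gauss_kernel m n"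
  by (rule less_imp_le[OF gauss_kernel_pos])

text \<open>Dividing the binomial coefficient by \<open>2 * m + 1\<close> gives
  \<open>(2m+2n+1)! / ((2m+1)! (2n+1)!)\<close>, which is symmetric, and the zeta factor depends on
  \<open>m + n\<close> alone. This is detailed balance for the weight
  \<open>1/(2n+1)\<close>.\<close>

lemma gauss_kernel_symmetric:
  "gauss_kernel m n / real (2 * m + 1) = gauss_kernel n m / real (2 * n + 1)"
proof -
  have e: "real ((2 * n + 1 + 2 * m) choose (2 * m)) / real (2 * m + 1) =
      fact (2 * n + 1 + 2 * m) / (fact (2 * m + 1) * fact (2 * n + 1))" for m n
    by (subst binomial_fact) (auto simp: field_simps)
  show ?thesis
  proof -
    have "real ((2 * n + 1 + 2 * m) choose (2 * m)) / real (2 * m + 1) =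
        real ((2 * m + 1 + 2 * n) choose (2 * n)) / real (2 * n + 1)"
      unfolding e by (simp add: ac_simps)
    moreover have "2 * B * Z / d = 2 * B' * Z / d'" if "B / d = B' / d'" for B B' d d' Z :: real
      using arg_cong[OF that, of "\<lambda>x. 2 * Z * x"] by (simp add: ac_simps)
    ultimately show ?thesis
      unfolding gauss_kernel_def add.commute[of n m]
      by blast
  qed
qed

lemma gauss_kernel_eq_suminf:
  "ennreal (gauss_kernel m n) =
     (\<Sum>j. ennreal (2 * real ((2 * n + 1 + 2 * m) choose (2 * m)) * (1 / (2 * real (Suc j))) ^ (2 * n + 2 * m + 2)))"
proof -
  have "(\<lambda>j. 2 * real ((2 * n + 1 + 2 * m) choose (2 * m)) * (1 / (2 * real (Suc j)) ^ (2 * (n + m + 1)))) sums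
      gauss_kernel m n"
    unfolding gauss_kernel_def even_zeta_def
    by (intro sums_mult summable_sums summable_even_zeta) simp
  moreover have "1 / (2 * real (Suc j)) ^ (2 * (n + m + 1)) = (1 / (2 * real (Suc j))) ^ (2 * n + 2 * m + 2)" for j
    by (simp add: power_divide algebra_simps del: of_nat_Suc)
  ultimately show ?thesis
    by (intro suminf_ennreal_sums[symmetric]) (simp_all only:, auto)
qed

text \<open>For the shift \<open>2 * Suc j\<close> the odd binomial sum is
  \<open>?d j - ?d (Suc j)\<close>, because \<open>r / (1 - r)\<close> and
  \<open>r / (1 + r)\<close> are reciprocals of neighbouring odd numbers; the sum over
  \<open>j\<close> telescopes to \<open>?d 0 = 1\<close>. Analytically, \<open>1/(1 - x^2)\<close>
  is an invariant density.\<close>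

lemma gauss_kernel_row_suminf: "(\<Sum>n. ennreal (gauss_kernel m n)) = 1"
proof -
  let ?d = "\<lambda>j. 1 / (2 * real j + 1) ^ (2 * m + 1)"
  have inner: "(\<Sum>n. ennreal (2 * real ((2 * n + 1 + 2 * m) choose (2 * m)) * (1 / (2 * real (Suc j))) ^ (2 * n + 2 * m + 2)))
      = ennreal (?d j - ?d (Suc j))" for j
  proof -
    define r where "r = 1 / (2 * real (Suc j))"
    have r: "0 < r" "r < 1" by (auto simp: r_def)
    have "(\<lambda>n. r ^ (2 * m + 1) * (2 * real ((2 * n + 1 + 2 * m) choose (2 * m)) * r ^ (2 * n + 1))) sums
        (r ^ (2 * m + 1) * (1 / (1 - r) ^ Suc (2 * m) - 1 / (1 + r) ^ Suc (2 * m)))"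
      by (intro sums_mult negative_binomial_odd_sums) (use r in auto)
    moreover have "r ^ (2 * m + 1) * (2 * real ((2 * n + 1 + 2 * m) choose (2 * m)) * r ^ (2 * n + 1)) =
        2 * real ((2 * n + 1 + 2 * m) choose (2 * m)) * r ^ (2 * n + 2 * m + 2)" for n
      by (simp add: power_add power2_eq_square mult_ac)
    moreover have "r ^ (2 * m + 1) * (1 / (1 - r) ^ Suc (2 * m) - 1 / (1 + r) ^ Suc (2 * m)) =
        (r / (1 - r)) ^ (2 * m + 1) - (r / (1 + r)) ^ (2 * m + 1)"
      by (simp add: power_divide right_diff_distrib)
    moreover have "r / (1 - r) = 1 / (2 * real j + 1)" "r / (1 + r) = 1 / (2 * real (Suc j) + 1)"
      unfolding r_def by (auto simp: field_simps)
    ultimately have "(\<lambda>n. 2 * real ((2 * n + 1 + 2 * m) choose (2 * m)) * r ^ (2 * n + 2 * m + 2)) sums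
        (?d j - ?d (Suc j))" by (simp only: power_one_over)
    then show ?thesis unfolding r_def[symmetric]
      by (intro suminf_ennreal_sums) (use r in auto)
  qed
  have "(\<Sum>n. ennreal (gauss_kernel m n)) = (\<Sum>j. ennreal (?d j - ?d (Suc j)))"
    unfolding gauss_kernel_eq_suminf by (subst suminf_ennreal_swap) (simp only: inner)
  also have "\<dots> = ennreal 1"
  proof (rule suminf_ennreal_sums)
    have "?d \<longlonglongrightarrow> 0"
    proof (rule tendsto_sandwich[OF _ _ tendsto_const LIMSEQ_inverse_real_of_nat])
      have "(2 * real j + 1) ^ 1 \<le> (2 * real j + 1) ^ (2 * m + 1)" for j
        by (rule power_increasing) auto
      moreover have "real (Suc j) \<le> (2 * real j + 1) ^ 1" for j by simp
      ultimately have "real (Suc j) \<le> (2 * real j + 1) ^ (2 * m + 1)" for j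
        using order_trans by blast
      then have "?d j \<le> inverse (real (Suc j))" for j
        unfolding inverse_eq_divide by (intro frac_le) auto
      then show "\<forall>\<^sub>F j in sequentially. ?d j \<le> inverse (real (Suc j))" by simp
    qed simp
    from telescope_sums'[OF this] show "(\<lambda>j. ?d j - ?d (Suc j)) sums 1" by simp
    show "0 \<le> ?d j - ?d (Suc j)" for j
      unfolding diff_ge_0_iff_ge by (intro frac_le power_mono) auto
  qed
  finally show ?thesis by simp
qed

lemma gauss_kernel_row_sums: "gauss_kernel m sums 1"
proof -
  have "summable (gauss_kernel m)"
    by (rule summable_suminf_not_top) (auto simp: gauss_kernel_row_suminf less_imp_le[OF gauss_kernel_pos])
  moreover have "ennreal (suminf (gauss_kernel m)) = ennreal 1"
    using suminf_ennreal2[OF less_imp_le[OF gauss_kernel_pos] calculation] gauss_kernel_row_suminf by simp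
  then have "suminf (gauss_kernel m) = 1" 
    using calculation suminf_nonneg[OF calculation less_imp_le[OF gauss_kernel_pos]] by (subst (asm) ennreal_inj) auto
  ultimately show ?thesis by (simp add: sums_iff)
qed

text \<open>The ratio of row \<open>Suc m\<close> to row \<open>m\<close> is an increasing quadratic
  in \<open>n\<close> times a ratio of consecutive even zeta values, nondecreasing by log-convexity.
  A monotone likelihood ratio of this kind makes the kernel preserve nonincreasing
  sequences.\<close>

lemma gauss_kernel_likelihood_ratio:
  assumes "i \<le> j"
  shows "gauss_kernel (Suc m) i * gauss_kernel m j \<le> gauss_kernel (Suc m) j * gauss_kernel m i"
proof -
  define R where "R n = gauss_kernel (Suc m) n / gauss_kernel m n" for n
  have binom: "real ((N + 2) choose (K + 2)) = (real N + 2) * (real N + 1) / ((real K + 2) * (real K + 1)) * real (N choose K)" for N K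
  proof -
    have 1: "real (Suc (Suc K)) * real (Suc (Suc N) choose Suc (Suc K)) = real (Suc (Suc N)) * real (Suc N choose Suc K)"
      by (metis Suc_times_binomial_eq of_nat_mult mult.commute)
    have 2: "real (Suc K) * real (Suc N choose Suc K) = real (Suc N) * real (N choose K)"
      by (metis Suc_times_binomial_eq of_nat_mult mult.commute)
    have "real (Suc (Suc K)) * real (Suc K) * real (Suc (Suc N) choose Suc (Suc K)) = real (Suc (Suc N)) * (real (Suc K) * real (Suc N choose Suc K))"
      using 1 by (simp only: mult.assoc mult.left_commute)
    also have "\<dots> = real (Suc (Suc N)) * real (Suc N) * real (N choose K)" by (simp only: 2 mult.assoc)
    finally have "(real K + 2) * (real K + 1) * real ((N + 2) choose (K + 2)) = (real N + 2) * (real N + 1) * real (N choose K)"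
      by (simp add: add.commute)
    moreover have "(real K + 2) * (real K + 1) \<noteq> 0"
      by (metis add_2_eq_Suc' mult_eq_0_iff of_nat_1 of_nat_add of_nat_eq_0_iff of_nat_numeral nat.distinct(1) Suc_eq_plus1)
    ultimately show ?thesis by (simp only: eq_divide_eq times_divide_eq_left) (simp add: mult.commute)
  qed
  have R: "R n = (real (2 * n + 1 + 2 * m) + 2) * (real (2 * n + 1 + 2 * m) + 1) / ((real (2 * m) + 2) * (real (2 * m) + 1)) *
      (even_zeta (n + m + 2) / even_zeta (n + m + 1))" for n
  proof -
    have e: "2 * n + 1 + 2 * Suc m = (2 * n + 1 + 2 * m) + 2" "2 * Suc m = 2 * m + 2" "n + Suc m + 1 = n + m + 2"
      "2 * n + 1 + (2 * m + 2) = (2 * n + 1 + 2 * m) + 2" by auto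
    have "2 * (X * C) * Z / (2 * C * Y) = X * (Z / Y)" if "C \<noteq> 0" for C X Y Z :: real
      using that by simp
    moreover have "real ((2 * n + 1 + 2 * m) choose (2 * m)) \<noteq> 0" by (simp add: zero_less_binomial_iff)
    ultimately show ?thesis
      unfolding R_def gauss_kernel_def e binom by blast
  qed
  have "incseq R"
  proof (rule incseq_SucI)
    fix n
    have pos: "even_zeta (n + m + 1) > 0" "even_zeta (n + m + 2) > 0" "even_zeta (n + m + 3) > 0"
      by (auto intro!: even_zeta_pos)
    have "even_zeta (n + m + 2) / even_zeta (n + m + 1) \<le> even_zeta (n + m + 3) / even_zeta (n + m + 2)"
    proof -
      have "even_zeta (n + m + 2) ^ 2 \<le> even_zeta (n + m + 1) * even_zeta (n + m + 3)"
        using even_zeta_log_convex[of "n + m + 1"] by (simp add: numeral_3_eq_3 numeral_2_eq_2)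
      then show ?thesis
        using pos by (simp only: pos_divide_le_eq pos_le_divide_eq times_divide_eq_left times_divide_eq_right power2_eq_square mult.commute)
    qed
    moreover have "Suc n + m + 2 = n + m + 3" "Suc n + m + 1 = n + m + 2" by auto
    moreover have "0 < even_zeta (n + m + 2) / even_zeta (n + m + 1)" using pos by simp
    ultimately show "R n \<le> R (Suc n)"
      unfolding R by (intro mult_mono divide_right_mono) (auto intro!: mult_mono simp: numeral_3_eq_3)
  qed
  then have "R i \<le> R j" using assms by (simp add: incseq_def)
  then show ?thesis using gauss_kernel_pos[of m i] gauss_kernel_pos[of m j] by (simp add: R_def field_simps)
qed

text \<open>Single crossing: the ratio \<open>q / p\<close> is nondecreasing, so
  \<open>q - p\<close> changes sign at most once, at the first index \<open>c\<close> with
  \<open>p c < q c\<close>. There \<open>a n - a c\<close> has the opposite sign, hence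
  \<open>(q n - p n) * (a n - a c) \<le> 0\<close> for every \<open>n\<close>; subtracting the
  constant \<open>a c\<close> costs nothing because both total masses are 1.\<close>

lemma sums_mono_likelihood_ratio:
  fixes p q a :: "nat \<Rightarrow> real"
  assumes p: "p sums 1" and q: "q sums 1" and pos: "\<And>n. 0 < p n"
    and ratio: "\<And>i j. i \<le> j \<Longrightarrow> q i * p j \<le> q j * p i"
    and a: "decseq a" "\<And>n. 0 \<le> a n"
    and sp: "(\<lambda>n. p n * a n) sums P" and sq: "(\<lambda>n. q n * a n) sums Q"
  shows "Q \<le> P"
proof (cases "\<exists>n. p n < q n")
  case True
  define c where "c = (LEAST n. p n < q n)"
  have c: "p c < q c" unfolding c_def using True by (rule LeastI_ex)
  have lt: "q n \<le> p n" if "n < c" for n using not_less_Least[of n "\<lambda>n. p n < q n"] that by (simp add: c_def)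
  have ge: "p n \<le> q n" if "c \<le> n" for n
  proof -
    have "p c * p n \<le> q c * p n" using c pos[of n] by simp
    also have "\<dots> \<le> q n * p c" using ratio[OF that] .
    finally show ?thesis using pos[of c] by (simp add: mult.commute)
  qed
  have "(q n * a n - p n * a n) - a c * (q n - p n) \<le> 0" for n
  proof -
    have "(q n - p n) * (a n - a c) \<le> 0"
    proof (cases "n < c")
      case True
      then show ?thesis using lt[of n] decseqD[OF a(1), of n c] by (intro mult_nonpos_nonneg) auto
    next
      case False
      then show ?thesis using ge[of n] decseqD[OF a(1), of c n] by (intro mult_nonneg_nonpos) auto
    qed
    then show ?thesis by (simp add: algebra_simps)
  qed
  moreover have "(\<lambda>n. (q n * a n - p n * a n) - a c * (q n - p n)) sums ((Q - P) - a c * (1 - 1))"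
    by (intro sums_diff sums_mult p q sp sq)
  ultimately have "(Q - P) - a c * (1 - 1) \<le> 0" by (rule sums_le[OF _ _ sums_zero])
  then show ?thesis by simp
next
  case False
  then have "q n * a n \<le> p n * a n" for n by (intro mult_right_mono a) (simp add: not_less)
  then show ?thesis using sums_le[OF _ sq sp] by blast
qed

section \<open>Decay of the iterated coefficients\<close>

primrec gauss_coeff :: "nat \<Rightarrow> nat \<Rightarrow> real" where
  "gauss_coeff 0 m = (if m = 0 then 1 else 0)"
| "gauss_coeff (Suc k) m = (\<Sum>n. gauss_kernel m n * gauss_coeff k n)"

lemma summable_gauss_kernel_mult:
  assumes "\<And>n. 0 \<le> a n \<and> a n \<le> 1"
  shows "summable (\<lambda>n. gauss_kernel m n * a n)"
  by (rule summable_comparison_test'[OF sums_summable[OF gauss_kernel_row_sums[of m]]])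
    (use assms in \<open>auto simp: abs_mult intro!: mult_left_le\<close>)

text \<open>The bounds are inherited because every row is a probability vector, the monotonicity
  because successive rows are ordered by likelihood ratio. The induction carries all three together:
  the bounds are what makes the series of the next iterate converge.\<close>

lemma gauss_coeff_props:
  "(\<forall>n. 0 \<le> gauss_coeff k n \<and> gauss_coeff k n \<le> 1) \<and> decseq (gauss_coeff k)"
proof (induction k)
  case 0
  then show ?case by (auto simp: decseq_def)
next
  case (Suc k)
  then have b: "\<And>n. 0 \<le> gauss_coeff k n \<and> gauss_coeff k n \<le> 1" and d: "decseq (gauss_coeff k)" by auto
  have s: "(\<lambda>n. gauss_kernel m n * gauss_coeff k n) sums gauss_coeff (Suc k) m" for m
    using summable_gauss_kernel_mult[OF b, of m] by (simp add: summable_sums)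
  have "0 \<le> gauss_coeff (Suc k) m" for m
    by (rule sums_le[OF _ sums_zero s]) (use b in simp)
  moreover have "gauss_coeff (Suc k) m \<le> 1" for m
    by (rule sums_le[OF _ s gauss_kernel_row_sums]) (use b in \<open>auto intro: mult_left_le\<close>)
  moreover have "decseq (gauss_coeff (Suc k))"
    by (rule decseq_SucI, rule sums_mono_likelihood_ratio[OF gauss_kernel_row_sums gauss_kernel_row_sums gauss_kernel_pos
          gauss_kernel_likelihood_ratio d _ s s]) (use b in auto)
  ultimately show ?case by blast
qed

lemma gauss_coeff_nonneg: "0 \<le> gauss_coeff k n" and gauss_coeff_le_1: "gauss_coeff k n \<le> 1"
  and gauss_coeff_decseq: "decseq (gauss_coeff k)"
  using gauss_coeff_props by auto

lemma gauss_coeff_Suc_sums: "(\<lambda>n. gauss_kernel m n * gauss_coeff k n) sums gauss_coeff (Suc k) m"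
  using summable_gauss_kernel_mult[of "gauss_coeff k" m] by (simp add: summable_sums gauss_coeff_nonneg gauss_coeff_le_1)

lemma ennreal_gauss_coeff_Suc:
  "ennreal (gauss_coeff (Suc k) m) = (\<Sum>n. ennreal (gauss_kernel m n * gauss_coeff k n))"
  by (rule suminf_ennreal_sums[symmetric, OF _ gauss_coeff_Suc_sums])
    (simp add: gauss_coeff_nonneg less_imp_le[OF gauss_kernel_pos])

text \<open>By detailed balance, summing \<open>gauss_kernel m n / (2m+1)\<close> over
  \<open>m\<close> gives \<open>1/(2n+1)\<close> times a row sum, so the weighted sum is invariant.
  In \<open>ennreal\<close> the exchange of sums needs no summability.\<close>

lemma gauss_coeff_weighted_suminf: "(\<Sum>n. ennreal (gauss_coeff k n / real (2 * n + 1))) = 1"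
proof (induction k)
  case 0
  have "(\<lambda>n. ennreal (gauss_coeff 0 n / real (2 * n + 1))) sums (\<Sum>n\<in>{0}. ennreal (gauss_coeff 0 n / real (2 * n + 1)))"
    by (rule sums_finite) auto
  then show ?case by (simp add: sums_iff)
next
  case (Suc k)
  have "ennreal (gauss_coeff (Suc k) m / real (2 * m + 1)) =
      (\<Sum>n. ennreal (gauss_kernel n m * (gauss_coeff k n / real (2 * n + 1))))" for m
  proof (rule suminf_ennreal_sums[symmetric])
    have "(\<lambda>n. gauss_kernel m n * gauss_coeff k n / real (2 * m + 1)) sums (gauss_coeff (Suc k) m / real (2 * m + 1))"
      by (intro sums_divide gauss_coeff_Suc_sums)
    moreover have "gauss_kernel m n * gauss_coeff k n / real (2 * m + 1) = gauss_kernel n m * (gauss_coeff k n / real (2 * n + 1))" for n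
      using gauss_kernel_symmetric[of m n] by (metis times_divide_eq_left times_divide_eq_right)
    ultimately show "(\<lambda>n. gauss_kernel n m * (gauss_coeff k n / real (2 * n + 1))) sums (gauss_coeff (Suc k) m / real (2 * m + 1))"
      by simp
  qed (simp add: gauss_coeff_nonneg less_imp_le[OF gauss_kernel_pos])
  then have "(\<Sum>m. ennreal (gauss_coeff (Suc k) m / real (2 * m + 1))) =
      (\<Sum>n. \<Sum>m. ennreal (gauss_kernel n m * (gauss_coeff k n / real (2 * n + 1))))"
    by (subst suminf_ennreal_swap) simp
  also have "\<dots> = (\<Sum>n. (\<Sum>m. ennreal (gauss_kernel n m)) * ennreal (gauss_coeff k n / real (2 * n + 1)))"
    by (simp only: ennreal_suminf_multc[symmetric] ennreal_mult[OF gauss_kernel_nonneg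
        divide_nonneg_nonneg[OF gauss_coeff_nonneg of_nat_0_le_iff]])
  also have "\<dots> = (\<Sum>n. ennreal (gauss_coeff k n / real (2 * n + 1)))"
    by (simp only: gauss_kernel_row_suminf mult_1)
  finally show ?case using Suc by simp
qed

lemma gauss_coeff_weighted_sum_le: "(\<Sum>n<N. gauss_coeff k n / real (2 * n + 1)) \<le> 1"
proof -
  have "ennreal (\<Sum>n<N. gauss_coeff k n / real (2 * n + 1)) = (\<Sum>n<N. ennreal (gauss_coeff k n / real (2 * n + 1)))"
    by (rule sum_ennreal[symmetric]) (simp add: gauss_coeff_nonneg)
  also have "\<dots> \<le> (\<Sum>n. ennreal (gauss_coeff k n / real (2 * n + 1)))" by (rule sum_le_suminf) auto
  finally show ?thesis by (simp only: gauss_coeff_weighted_suminf) simp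
qed

text \<open>The new entry at 0 is an average of the old entries, of which the one at 0 is the
  largest.\<close>

lemma gauss_coeff_0_decseq: "decseq (\<lambda>k. gauss_coeff k 0)"
proof (rule decseq_SucI)
  fix k
  have "gauss_coeff (Suc k) 0 \<le> 1 * gauss_coeff k 0"
    by (rule sums_le[OF _ gauss_coeff_Suc_sums sums_mult2[OF gauss_kernel_row_sums[of 0]]])
      (use decseqD[OF gauss_coeff_decseq, of 0 _ k] in \<open>auto intro!: mult_left_mono\<close>)
  then show "gauss_coeff (Suc k) 0 \<le> gauss_coeff k 0" by simp
qed

text \<open>In the average along row 0 every entry is replaced by the largest one, except that the
  exact deficit at the single index \<open>N\<close> is kept. Read backwards, a small drop at 0 from
  one iterate to the next forces \<open>gauss_coeff k N\<close> close to
  \<open>gauss_coeff k 0\<close>.\<close>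

lemma gauss_coeff_lower:
  "gauss_coeff (Suc k) 0 \<le> gauss_coeff k 0 - gauss_kernel 0 N * (gauss_coeff k 0 - gauss_coeff k N)"
proof -
  let ?e = "\<lambda>n. if n = N then gauss_kernel 0 N * (gauss_coeff k 0 - gauss_coeff k N) else 0"
  have "(\<lambda>n. gauss_kernel 0 n * gauss_coeff k 0 - ?e n) sums
      (1 * gauss_coeff k 0 - gauss_kernel 0 N * (gauss_coeff k 0 - gauss_coeff k N))"
    by (intro sums_diff sums_mult2 gauss_kernel_row_sums) (rule sums_single)
  moreover have "gauss_kernel 0 n * gauss_coeff k n \<le> gauss_kernel 0 n * gauss_coeff k 0 - ?e n" for n
    using decseqD[OF gauss_coeff_decseq, of 0 n k] gauss_kernel_pos[of 0 n] by (auto simp: algebra_simps)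
  ultimately show ?thesis using sums_le[OF _ gauss_coeff_Suc_sums] by fastforce
qed

lemma gauss_coeff_0_tendsto_0: "(\<lambda>k. gauss_coeff k 0) \<longlonglongrightarrow> 0"
proof -
  obtain M where M: "(\<lambda>k. gauss_coeff k 0) \<longlonglongrightarrow> M" and Mle: "\<And>k. M \<le> gauss_coeff k 0"
    using decseq_convergent[OF gauss_coeff_0_decseq, of 0] gauss_coeff_nonneg by metis
  have M0: "0 \<le> M" using LIMSEQ_le_const[OF M, of 0] gauss_coeff_nonneg by blast
  have lim: "(\<lambda>k. gauss_coeff k n) \<longlonglongrightarrow> M" for n
  proof (rule tendsto_sandwich[OF _ _ _ M])
    \<comment> \<open>\<open>gauss_coeff_lower\<close> solved for \<open>gauss_coeff k n\<close>;
      the drop in the numerator tends to 0 because the entries at 0 converge.\<close>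
    let ?l = "\<lambda>k. gauss_coeff k 0 - (gauss_coeff k 0 - gauss_coeff (Suc k) 0) / gauss_kernel 0 n"
    show "\<forall>\<^sub>F k in sequentially. ?l k \<le> gauss_coeff k n"
      using gauss_coeff_lower[of _ n] gauss_kernel_pos[of 0 n] by (intro always_eventually allI) (simp add: field_simps)
    show "\<forall>\<^sub>F k in sequentially. gauss_coeff k n \<le> gauss_coeff k 0"
      using decseqD[OF gauss_coeff_decseq] by (intro always_eventually allI) simp
    have "?l \<longlonglongrightarrow> M - (M - M) / gauss_kernel 0 n"
      using gauss_kernel_pos[of 0 n] by (intro tendsto_intros M LIMSEQ_Suc) auto
    then show "?l \<longlonglongrightarrow> M" by simp
  qed
  \<comment> \<open>Finite partial sums pass to the limit; the full sum, constantly 1, does not,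
    since its mass escapes to large \<open>n\<close>.\<close>
  have bound: "M * (\<Sum>n<N. 1 / real (2 * n + 1)) \<le> 1" for N
  proof -
    have "(\<lambda>k. \<Sum>n<N. gauss_coeff k n / real (2 * n + 1)) \<longlonglongrightarrow> (\<Sum>n<N. M / real (2 * n + 1))"
      by (intro tendsto_intros lim) auto
    then have "(\<Sum>n<N. M / real (2 * n + 1)) \<le> 1"
      by (rule LIMSEQ_le_const2) (use gauss_coeff_weighted_sum_le in blast)
    then show ?thesis by (simp add: sum_distrib_left)
  qed
  have "M = 0"
  proof (rule ccontr)
    assume "M \<noteq> 0"
    then have "M > 0" using M0 by simp
    have "summable (\<lambda>n. 1 / real (2 * n + 1))"
    proof (rule bounded_imp_summable)
      fix N
      show "(\<Sum>n\<le>N. 1 / real (2 * n + 1)) \<le> 1 / M" using bound[of "Suc N"] \<open>M > 0\<close>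
        by (simp add: lessThan_Suc_atMost field_simps del: sum.lessThan_Suc)
    qed simp
    then have "summable (\<lambda>n. 2 * (1 / real (2 * n + 1)))" by (rule summable_mult)
    then have "summable (\<lambda>n. inverse (real (Suc n)))"
      by (rule summable_comparison_test'[where N=0]) (simp add: field_simps)
    then have "summable (\<lambda>n. inverse (real n))" by (subst (asm) summable_Suc_iff)
    then show False using not_summable_harmonic[where 'a=real] by simp
  qed
  then show ?thesis using M by simp
qed

section \<open>The transfer operator of the Gauss-type map\<close>

text \<open>For |x| < 1 this is the \<open>k\<close>-th image of the constant 1 under the transfer
  operator for \<gamma> = 1. With values in \<open>ennreal\<close> the power series is meaningful at
  every \<open>x\<close>.\<close>

definition gauss_density :: "nat \<Rightarrow> real \<Rightarrow> ennreal" where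
  "gauss_density k x = (\<Sum>n. ennreal (gauss_coeff k n * x ^ (2 * n)))"

lemma measurable_gauss_density [measurable]: "gauss_density k \<in> borel_measurable borel"
  unfolding gauss_density_def[abs_def] by measurable

lemma gauss_density_0 [simp]: "gauss_density 0 x = 1"
proof -
  have "(\<lambda>n. ennreal (gauss_coeff 0 n * x ^ (2 * n))) sums (\<Sum>n\<in>{0}. ennreal (gauss_coeff 0 n * x ^ (2 * n)))"
    by (rule sums_finite) auto
  then show ?thesis by (simp add: gauss_density_def sums_iff)
qed

text \<open>Only even powers with nonnegative coefficients occur. This monotonicity is what lets a
  branch for \<gamma> \<le> 1 be compared with the one for \<gamma> = 1.\<close>

lemma gauss_density_mono: "\<bar>x\<bar> \<le> \<bar>y\<bar> \<Longrightarrow> gauss_density k x \<le> gauss_density k y"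
  unfolding gauss_density_def
  by (intro suminf_le ennreal_leI mult_left_mono) (auto simp: gauss_coeff_nonneg power_mult power_mono abs_le_square_iff)

text \<open>Replacing every coefficient by the largest, the one at 0, leaves a multiple of the
  invariant density.\<close>

lemma gauss_density_le:
  assumes "\<bar>x\<bar> < 1"
  shows "gauss_density k x \<le> ennreal (gauss_coeff k 0 / (1 - x\<^sup>2))"
proof -
  have x: "\<bar>x\<^sup>2\<bar> < 1" using assms by (simp add: abs_square_less_1)
  have "gauss_density k x \<le> (\<Sum>n. ennreal (gauss_coeff k 0 * (x\<^sup>2) ^ n))"
    unfolding gauss_density_def
    by (intro suminf_le ennreal_leI) (auto simp: power_mult intro!: mult_right_mono decseqD[OF gauss_coeff_decseq])
  also have "\<dots> = ennreal (gauss_coeff k 0 * (1 / (1 - x\<^sup>2)))"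
    using x by (intro suminf_ennreal_sums sums_mult geometric_sums) (auto simp: gauss_coeff_nonneg)
  finally show ?thesis by simp
qed

lemma inverse_square_gauss_density:
  assumes "t \<noteq> 0"
  shows "ennreal (1 / t\<^sup>2) * gauss_density k (1 / t) = (\<Sum>n. ennreal (gauss_coeff k n * (1 / t ^ (2 * n + 2))))"
proof -
  have "ennreal (1 / t\<^sup>2) * gauss_density k (1 / t) = (\<Sum>n. ennreal (1 / t\<^sup>2) * ennreal (gauss_coeff k n * (1 / t) ^ (2 * n)))"
    by (simp add: gauss_density_def)
  also have "\<dots> = (\<Sum>n. ennreal (gauss_coeff k n * (1 / t ^ (2 * n + 2))))"
  proof (intro suminf_cong)
    fix n
    have "0 \<le> gauss_coeff k n * (1 / t) ^ (2 * n)" by (simp add: gauss_coeff_nonneg power_mult)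
    then have "ennreal (1 / t\<^sup>2) * ennreal (gauss_coeff k n * (1 / t) ^ (2 * n)) = ennreal (1 / t\<^sup>2 * (gauss_coeff k n * (1 / t) ^ (2 * n)))"
      by (subst ennreal_mult) auto
    also have "1 / t\<^sup>2 * (gauss_coeff k n * (1 / t) ^ (2 * n)) = gauss_coeff k n * (1 / t ^ (2 * n + 2))"
      by (simp add: power_add power_divide power2_eq_square)
    finally show "ennreal (1 / t\<^sup>2) * ennreal (gauss_coeff k n * (1 / t) ^ (2 * n)) = ennreal (gauss_coeff k n * (1 / t ^ (2 * n + 2)))" .
  qed
  finally show ?thesis .
qed

text \<open>Odd powers of \<open>x\<close> cancel between the shifts \<open>s\<close> and
  \<open>- s\<close>, which is why even power series are mapped to even ones. The coefficients are
  the summands in \<open>gauss_kernel_eq_suminf\<close>.\<close>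

lemma two_sided_power_suminf:
  fixes s x :: real
  assumes "\<bar>x\<bar> < s"
  shows "ennreal (1 / (s + x) ^ (2 * n + 2) + 1 / (s - x) ^ (2 * n + 2)) =
    (\<Sum>m. ennreal (2 * real ((2 * n + 1 + 2 * m) choose (2 * m)) * (1 / s) ^ (2 * n + 2 * m + 2)) * ennreal (x ^ (2 * m)))"
proof -
  define r where "r = x / s"
  have s: "s > 0" using assms by linarith
  have r: "\<bar>r\<bar> < 1" using assms s by (simp add: r_def)
  have "(\<lambda>m. 1 / s ^ (2 * n + 2) * (2 * real ((2 * m + (2 * n + 1)) choose (2 * n + 1)) * r ^ (2 * m))) sums
      (1 / s ^ (2 * n + 2) * (1 / (1 - r) ^ Suc (2 * n + 1) + 1 / (1 + r) ^ Suc (2 * n + 1)))"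
    by (intro sums_mult negative_binomial_even_sums r)
  moreover have "1 / s ^ (2 * n + 2) * (1 / (1 - r) ^ Suc (2 * n + 1) + 1 / (1 + r) ^ Suc (2 * n + 1)) =
      1 / (s + x) ^ (2 * n + 2) + 1 / (s - x) ^ (2 * n + 2)"
  proof -
    have "s + x = s * (1 + r)" "s - x = s * (1 - r)" using s by (auto simp: r_def field_simps)
    then show ?thesis by (simp only: power_mult_distrib Suc_eq_plus1 add.assoc one_add_one) (simp add: distrib_left add.commute)
  qed
  moreover have "1 / s ^ (2 * n + 2) * (2 * real ((2 * m + (2 * n + 1)) choose (2 * n + 1)) * r ^ (2 * m)) =
      2 * real ((2 * n + 1 + 2 * m) choose (2 * m)) * (1 / s) ^ (2 * n + 2 * m + 2) * x ^ (2 * m)" for m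
  proof -
    have "(2 * m + (2 * n + 1)) choose (2 * n + 1) = (2 * n + 1 + 2 * m) choose (2 * m)"
      using binomial_symmetric[of "2 * m" "2 * n + 1 + 2 * m"] by (simp add: add.commute)
    then show ?thesis by (simp add: r_def power_divide power_add mult_ac)
  qed
  ultimately have "(\<lambda>m. 2 * real ((2 * n + 1 + 2 * m) choose (2 * m)) * (1 / s) ^ (2 * n + 2 * m + 2) * x ^ (2 * m)) sums
      (1 / (s + x) ^ (2 * n + 2) + 1 / (s - x) ^ (2 * n + 2))" by (simp only:)
  moreover have "0 \<le> x ^ (2 * m)" for m by (simp add: power_mult)
  ultimately have "(\<Sum>m. ennreal (2 * real ((2 * n + 1 + 2 * m) choose (2 * m)) * (1 / s) ^ (2 * n + 2 * m + 2) * x ^ (2 * m))) =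
      ennreal (1 / (s + x) ^ (2 * n + 2) + 1 / (s - x) ^ (2 * n + 2))"
    using s by (intro suminf_ennreal_sums) auto
  then show ?thesis using \<open>\<And>m. 0 \<le> x ^ (2 * m)\<close> s by (subst (asm) ennreal_mult) auto
qed

text \<open>The transfer operator of the Gauss-type map \<open>x \<mapsto> -1/x mod 2\<close> maps one density to the next.\<close>

lemma gauss_density_transfer:
  assumes x: "\<bar>x\<bar> < 1"
  shows "(\<Sum>i. ennreal (1 / (2 * real (Suc i) + x)\<^sup>2) * gauss_density k (1 / (2 * real (Suc i) + x)) +
              ennreal (1 / (2 * real (Suc i) - x)\<^sup>2) * gauss_density k (1 / (2 * real (Suc i) - x)))
         = gauss_density (Suc k) x"
proof -
  let ?s = "\<lambda>i. 2 * real (Suc i)"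
  let ?c = "\<lambda>m n i. ennreal (2 * real ((2 * n + 1 + 2 * m) choose (2 * m)) * (1 / ?s i) ^ (2 * n + 2 * m + 2))"
  let ?a = "\<lambda>n. ennreal (gauss_coeff k n)"
  let ?x = "\<lambda>m. ennreal (x ^ (2 * m))"
  have s: "\<bar>x\<bar> < ?s i" for i using x by simp
  have xm: "0 \<le> x ^ (2 * m)" for m by (simp add: power_mult)
  have "ennreal (1 / (?s i + x)\<^sup>2) * gauss_density k (1 / (?s i + x)) + ennreal (1 / (?s i - x)\<^sup>2) * gauss_density k (1 / (?s i - x))
      = (\<Sum>n. \<Sum>m. ?a n * (?c m n i * ?x m))" for i
  proof -
    have nz: "?s i + x > 0" "?s i - x > 0" using s[of i] by linarith+
    have "ennreal (1 / (?s i + x)\<^sup>2) * gauss_density k (1 / (?s i + x)) + ennreal (1 / (?s i - x)\<^sup>2) * gauss_density k (1 / (?s i - x))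
      = (\<Sum>n. ennreal (gauss_coeff k n * (1 / (?s i + x) ^ (2 * n + 2))) + ennreal (gauss_coeff k n * (1 / (?s i - x) ^ (2 * n + 2))))"
      using nz by (subst inverse_square_gauss_density, simp, subst inverse_square_gauss_density, simp, subst suminf_add) auto
    also have "\<dots> = (\<Sum>n. ?a n * ennreal (1 / (?s i + x) ^ (2 * n + 2) + 1 / (?s i - x) ^ (2 * n + 2)))"
      using nz by (intro suminf_cong) (simp add: gauss_coeff_nonneg distrib_left flip: ennreal_mult ennreal_plus del: of_nat_Suc power_Suc)
    also have "\<dots> = (\<Sum>n. \<Sum>m. ?a n * (?c m n i * ?x m))"
      unfolding two_sided_power_suminf[OF s] by (simp only: ennreal_suminf_cmult)
    finally show ?thesis .
  qed
  then have "(\<Sum>i. ennreal (1 / (?s i + x)\<^sup>2) * gauss_density k (1 / (?s i + x)) + ennreal (1 / (?s i - x)\<^sup>2) * gauss_density k (1 / (?s i - x)))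
      = (\<Sum>i. \<Sum>n. \<Sum>m. ?a n * (?c m n i * ?x m))" by simp
  \<comment> \<open>Tonelli brings the sum over the shifts innermost, where it turns the binomial
    terms into \<open>gauss_kernel m n\<close>.\<close>
  also have "\<dots> = (\<Sum>n. \<Sum>i. \<Sum>m. ?a n * (?c m n i * ?x m))" by (rule suminf_ennreal_swap)
  also have "\<dots> = (\<Sum>n. \<Sum>m. \<Sum>i. ?a n * (?c m n i * ?x m))" by (intro suminf_cong suminf_ennreal_swap)
  also have "\<dots> = (\<Sum>n. \<Sum>m. ?a n * (ennreal (gauss_kernel m n) * ?x m))"
    by (simp only: ennreal_suminf_cmult ennreal_suminf_multc gauss_kernel_eq_suminf)
  also have "\<dots> = (\<Sum>m. \<Sum>n. ?a n * (ennreal (gauss_kernel m n) * ?x m))" by (rule suminf_ennreal_swap)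
  also have "\<dots> = (\<Sum>m. (\<Sum>n. ennreal (gauss_kernel m n * gauss_coeff k n)) * ?x m)"
  proof (intro suminf_cong)
    fix m
    have "?a n * (ennreal (gauss_kernel m n) * ?x m) = ennreal (gauss_kernel m n * gauss_coeff k n) * ?x m" for n
      unfolding ennreal_mult[OF gauss_kernel_nonneg gauss_coeff_nonneg] by (simp only: mult_ac)
    then show "(\<Sum>n. ?a n * (ennreal (gauss_kernel m n) * ?x m)) = (\<Sum>n. ennreal (gauss_kernel m n * gauss_coeff k n)) * ?x m"
      by (simp only: ennreal_suminf_multc)
  qed
  also have "\<dots> = gauss_density (Suc k) x"
    unfolding gauss_density_def ennreal_gauss_coeff_Suc[symmetric]
    by (simp only: ennreal_mult[OF gauss_coeff_nonneg xm])
  finally show ?thesis .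
qed

section \<open>Preimages under the Gauss-type map\<close>

definition gauss_preimage :: "real \<Rightarrow> real set \<Rightarrow> real set" where
  "gauss_preimage \<gamma> A = {y. y \<noteq> 0 \<and> \<bar>y\<bar> < \<gamma> \<and> (\<exists>j::int. - \<gamma> / y - 2 * of_int j \<in> A)}"

lemma gauss_preimage_measurable [measurable]:
  assumes [measurable]: "A \<in> sets borel"
  shows "gauss_preimage \<gamma> A \<in> sets borel"
  unfolding gauss_preimage_def by measurable

text \<open>Substitution \<open>y = - \<gamma> / (x + d)\<close>, which is increasing on [-1,1] with
  derivative \<open>\<gamma> / (x + d)^2\<close>; the bound on \<open>d\<close> keeps
  \<open>x + d\<close> away from 0.\<close>

lemma branch_integral:
  assumes \<gamma>: "0 < \<gamma>" and A [measurable]: "A \<in> sets borel" and sub: "A \<subseteq> {-1<..<1}" and d: "\<bar>d\<bar> \<ge> 2"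
    and f [measurable]: "f \<in> borel_measurable borel"
  shows "(\<integral>\<^sup>+y\<in>{y. y \<noteq> 0 \<and> - \<gamma> / y - d \<in> A}. f y \<partial>lborel) =
         (\<integral>\<^sup>+x\<in>A. f (- \<gamma> / (x + d)) * ennreal (\<gamma> / (x + d)\<^sup>2) \<partial>lborel)"
proof -
  let ?B = "{y. y \<noteq> 0 \<and> - \<gamma> / y - d \<in> A}"
  let ?g = "\<lambda>x. - \<gamma> / (x + d)"
  have nz: "x + d \<noteq> 0" if "x \<in> {-1..1}" for x using that d by auto
  have inv: "- \<gamma> / ?g x - d = x" if "x \<in> {-1..1}" for x using nz[OF that] \<gamma> by simp
  have [measurable]: "?B \<in> sets borel" by measurable
  have der: "(?g has_real_derivative \<gamma> / (x + d)\<^sup>2) (at x)" if "x \<in> {-1..1}" for x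
    using nz[OF that] by (auto intro!: derivative_eq_intros simp: power2_eq_square)
  have cont: "continuous_on {-1..1} (\<lambda>x. \<gamma> / (x + d)\<^sup>2)"
    using nz by (intro continuous_intros) auto
  have "(\<integral>\<^sup>+y\<in>{?g (-1)..?g 1}. (f y * indicator ?B y) \<partial>lborel) =
      (\<integral>\<^sup>+x\<in>{-1..1}. (f (?g x) * indicator ?B (?g x)) * ennreal (\<gamma> / (x + d)\<^sup>2) \<partial>lborel)"
    by (rule nn_integral_substitution_aux) (use der cont \<gamma> in auto)
  \<comment> \<open>The interval indicator is redundant: since \<open>A\<close> lies in (-1,1),
    every point of \<open>?B\<close> lies in the image of [-1,1].\<close>
  moreover have "f y * indicator ?B y * indicator {?g (-1)..?g 1} y = f y * indicator ?B y" for y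
  proof (cases "y \<in> ?B")
    case True
    then have y: "y \<noteq> 0" "- \<gamma> / y - d \<in> {-1<..<1}" using sub by auto
    define x where "x = - \<gamma> / y - d"
    have x: "x \<in> {-1<..<1}" using y by (simp add: x_def)
    have yx: "y = ?g x" using y \<gamma> by (simp add: x_def)
    have mono: "?g a \<le> ?g b" if "-1 \<le> a" "a \<le> b" "b \<le> 1" for a b
      by (rule DERIV_nonneg_imp_nondecreasing[OF that(2)]) (rule exI, rule conjI, rule der, use that \<gamma> in auto)
    have "y \<in> {?g (-1)..?g 1}" unfolding yx using mono[of "-1" x] mono[of x 1] x by auto
    then show ?thesis by simp
  qed simp
  moreover have "f (?g x) * indicator ?B (?g x) * ennreal (\<gamma> / (x + d)\<^sup>2) * indicator {-1..1} x =
      f (?g x) * ennreal (\<gamma> / (x + d)\<^sup>2) * indicator A x" for x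
  proof (cases "x \<in> {-1..1}")
    case True
    then show ?thesis using inv[OF True] nz[OF True] \<gamma> by (auto simp: indicator_def)
  next
    case False
    then show ?thesis using sub by (auto simp: indicator_def)
  qed
  ultimately show ?thesis by simp
qed

text \<open>Cover the preimage by its branches, substitute in each, and replace \<gamma> by 1: this
  can only increase the Jacobian and the modulus of the argument, hence the density there. What
  remains is the transfer operator applied to \<open>gauss_density k\<close>.\<close>

lemma gauss_preimage_integral_le:
  assumes \<gamma>: "0 < \<gamma>" "\<gamma> \<le> 1" and A [measurable]: "A \<in> sets borel" and sub: "A \<subseteq> {-1<..<1}"
  shows "(\<integral>\<^sup>+y\<in>gauss_preimage \<gamma> A. gauss_density k y \<partial>lborel) \<le> (\<integral>\<^sup>+x\<in>A. gauss_density (Suc k) x \<partial>lborel)"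
proof -
  let ?s = "\<lambda>i::nat. 2 * real (Suc i)"
  let ?B = "\<lambda>d. {y. y \<noteq> 0 \<and> - \<gamma> / y - d \<in> A}"
  have [measurable]: "?B d \<in> sets borel" for d by measurable
  have "gauss_density k y * indicator (gauss_preimage \<gamma> A) y \<le>
      (\<Sum>i. gauss_density k y * indicator (?B (?s i)) y + gauss_density k y * indicator (?B (- ?s i)) y)" for y
  proof (cases "y \<in> gauss_preimage \<gamma> A")
    case True
    then obtain j :: int where y: "y \<noteq> 0" "\<bar>y\<bar> < \<gamma>" "- \<gamma> / y - 2 * of_int j \<in> A" by (auto simp: gauss_preimage_def)
    \<comment> \<open>The condition |y| < \<gamma> in \<open>gauss_preimage\<close> rules out the
      shift 0: a value of modulus above 1 needs a nonzero even shift to enter (-1,1).\<close>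
    have "\<bar>\<gamma> / y\<bar> > 1" using y(1,2) \<gamma> by (simp add: divide_simps)
    moreover have "- \<gamma> / y - 2 * of_int j \<in> {-1<..<1}" using y(3) sub by blast
    then have "\<bar>- \<gamma> / y - 2 * of_int j\<bar> < 1" by auto
    ultimately have "j \<noteq> 0" by auto
    define i where "i = nat \<bar>j\<bar> - 1"
    have "real (Suc i) = of_int \<bar>j\<bar>" using \<open>j \<noteq> 0\<close> by (simp add: i_def)
    then have "y \<in> ?B (?s i) \<or> y \<in> ?B (- ?s i)" using y by (cases "j > 0") auto
    then have "gauss_density k y \<le> gauss_density k y * indicator (?B (?s i)) y + gauss_density k y * indicator (?B (- ?s i)) y"
      by (auto simp: indicator_def simp del: of_nat_Suc)
    also have "\<dots> \<le> (\<Sum>i. gauss_density k y * indicator (?B (?s i)) y + gauss_density k y * indicator (?B (- ?s i)) y)"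
      using sum_le_suminf[of "\<lambda>i. gauss_density k y * indicator (?B (?s i)) y + gauss_density k y * indicator (?B (- ?s i)) y" "{i}"] by simp
    finally show ?thesis using True by simp
  qed simp
  then have "(\<integral>\<^sup>+y\<in>gauss_preimage \<gamma> A. gauss_density k y \<partial>lborel) \<le>
      (\<integral>\<^sup>+y. (\<Sum>i. gauss_density k y * indicator (?B (?s i)) y + gauss_density k y * indicator (?B (- ?s i)) y) \<partial>lborel)"
    by (rule nn_integral_mono)
  also have "\<dots> = (\<Sum>i. (\<integral>\<^sup>+y\<in>?B (?s i). gauss_density k y \<partial>lborel) + (\<integral>\<^sup>+y\<in>?B (- ?s i). gauss_density k y \<partial>lborel))"
    by (subst nn_integral_suminf) (auto simp: nn_integral_add simp del: of_nat_Suc)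
  also have "\<dots> = (\<Sum>i. (\<integral>\<^sup>+x\<in>A. gauss_density k (- \<gamma> / (x + ?s i)) * ennreal (\<gamma> / (x + ?s i)\<^sup>2) \<partial>lborel) +
      (\<integral>\<^sup>+x\<in>A. gauss_density k (- \<gamma> / (x + - ?s i)) * ennreal (\<gamma> / (x + - ?s i)\<^sup>2) \<partial>lborel))"
    by (intro suminf_cong arg_cong2[where f="(+)"] branch_integral \<gamma> A sub) auto
  also have "\<dots> = (\<Sum>i. (\<integral>\<^sup>+x. gauss_density k (- \<gamma> / (x + ?s i)) * ennreal (\<gamma> / (x + ?s i)\<^sup>2) * indicator A x +
      gauss_density k (- \<gamma> / (x + - ?s i)) * ennreal (\<gamma> / (x + - ?s i)\<^sup>2) * indicator A x \<partial>lborel))"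
    by (intro suminf_cong nn_integral_add[symmetric]) (auto simp del: of_nat_Suc)
  also have "\<dots> = (\<integral>\<^sup>+x. (\<Sum>i. gauss_density k (- \<gamma> / (x + ?s i)) * ennreal (\<gamma> / (x + ?s i)\<^sup>2) * indicator A x +
      gauss_density k (- \<gamma> / (x + - ?s i)) * ennreal (\<gamma> / (x + - ?s i)\<^sup>2) * indicator A x) \<partial>lborel)"
    by (intro nn_integral_suminf[symmetric]) (auto simp del: of_nat_Suc)
  also have "\<dots> \<le> (\<integral>\<^sup>+x\<in>A. gauss_density (Suc k) x \<partial>lborel)"
  proof (rule nn_integral_mono)
    fix x
    show "(\<Sum>i. gauss_density k (- \<gamma> / (x + ?s i)) * ennreal (\<gamma> / (x + ?s i)\<^sup>2) * indicator A x +
      gauss_density k (- \<gamma> / (x + - ?s i)) * ennreal (\<gamma> / (x + - ?s i)\<^sup>2) * indicator A x) \<le> gauss_density (Suc k) x * indicator A x"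
    proof (cases "x \<in> A")
      case True
      then have "x \<in> {-1<..<1}" using sub by blast
      then have x: "\<bar>x\<bar> < 1" by auto
      have le: "gauss_density k (- \<gamma> / t') * ennreal (\<gamma> / t'\<^sup>2) \<le> ennreal (1 / t\<^sup>2) * gauss_density k (1 / t)"
        if "t > 0" "t' = t \<or> t' = - t" for t t' :: real
      proof -
        have "gauss_density k (- \<gamma> / t') \<le> gauss_density k (1 / t)"
          using that \<gamma> by (intro gauss_density_mono) (auto simp: divide_right_mono)
        moreover have "ennreal (\<gamma> / t'\<^sup>2) \<le> ennreal (1 / t\<^sup>2)"
          using that \<gamma> by (intro ennreal_leI) (auto simp: divide_right_mono)
        ultimately show ?thesis by (subst mult.commute) (rule mult_mono, auto)
      qed
      have "(\<Sum>i. gauss_density k (- \<gamma> / (x + ?s i)) * ennreal (\<gamma> / (x + ?s i)\<^sup>2) +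
          gauss_density k (- \<gamma> / (x + - ?s i)) * ennreal (\<gamma> / (x + - ?s i)\<^sup>2)) \<le> gauss_density (Suc k) x"
        unfolding gauss_density_transfer[OF x, symmetric]
        by (intro suminf_le add_mono le) (use x in auto)
      then show ?thesis using True by simp
    qed simp
  qed
  finally show ?thesis .
qed

lemma gauss_preimage_subset: "0 < \<gamma> \<Longrightarrow> \<gamma> \<le> 1 \<Longrightarrow> gauss_preimage \<gamma> A \<subseteq> {-1<..<1}"
  by (auto simp: gauss_preimage_def)

lemma gauss_preimage_power:
  assumes \<gamma>: "0 < \<gamma>" "\<gamma> \<le> 1" and A: "A \<in> sets borel" "A \<subseteq> {-1<..<1}"
  shows "(gauss_preimage \<gamma> ^^ k) A \<in> sets borel \<and> (gauss_preimage \<gamma> ^^ k) A \<subseteq> {-1<..<1}"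
  by (induction k) (use A gauss_preimage_subset[OF \<gamma>] in auto)

text \<open>Each preimage is traded for one application of the transfer operator, which raises the
  index of the density; hence the induction is over all \<open>l\<close>.\<close>

lemma gauss_preimage_power_integral_le:
  assumes \<gamma>: "0 < \<gamma>" "\<gamma> \<le> 1" and A: "A \<in> sets borel" "A \<subseteq> {-1<..<1}"
  shows "(\<integral>\<^sup>+x\<in>(gauss_preimage \<gamma> ^^ k) A. gauss_density l x \<partial>lborel) \<le> (\<integral>\<^sup>+x\<in>A. gauss_density (k + l) x \<partial>lborel)"
proof (induction k arbitrary: l)
  case (Suc k)
  have "(\<integral>\<^sup>+x\<in>(gauss_preimage \<gamma> ^^ Suc k) A. gauss_density l x \<partial>lborel) \<le>
      (\<integral>\<^sup>+x\<in>(gauss_preimage \<gamma> ^^ k) A. gauss_density (Suc l) x \<partial>lborel)"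
    using gauss_preimage_power[OF assms, of k] by (auto intro: gauss_preimage_integral_le[OF \<gamma>])
  also have "\<dots> \<le> (\<integral>\<^sup>+x\<in>A. gauss_density (k + Suc l) x \<partial>lborel)" by (rule Suc)
  finally show ?case by simp
qed simp

text \<open>Lebesgue measure of the iterated preimage is bounded by the integral of the
  \<open>k\<close>-th density over \<open>A\<close>; on [-a,a] that density is at most
  \<open>gauss_coeff k 0 / (1 - a^2)\<close>, and the interval has length
  \<open>2 * a\<close>.\<close>

lemma emeasure_gauss_preimage_power_tendsto_0:
  assumes \<gamma>: "0 < \<gamma>" "\<gamma> \<le> 1" and a: "0 \<le> a" "a < 1" and A: "A \<in> sets borel" "A \<subseteq> {- a..a}"
  shows "(\<lambda>k. emeasure lborel ((gauss_preimage \<gamma> ^^ k) A)) \<longlonglongrightarrow> 0"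
proof (rule tendsto_sandwich[OF _ _ tendsto_const])
  have sub: "A \<subseteq> {-1<..<1}" using A a by auto
  have a2: "a\<^sup>2 < 1" using a by (simp add: abs_square_less_1)
  show "\<forall>\<^sub>F k in sequentially. emeasure lborel ((gauss_preimage \<gamma> ^^ k) A) \<le> ennreal (gauss_coeff k 0 * (2 * a / (1 - a\<^sup>2)))"
  proof (intro always_eventually allI)
    fix k
    have "emeasure lborel ((gauss_preimage \<gamma> ^^ k) A) = (\<integral>\<^sup>+x\<in>(gauss_preimage \<gamma> ^^ k) A. gauss_density 0 x \<partial>lborel)"
      using gauss_preimage_power[OF \<gamma> A(1) sub, of k] by simp
    also have "\<dots> \<le> (\<integral>\<^sup>+x\<in>A. gauss_density k x \<partial>lborel)"
      using gauss_preimage_power_integral_le[OF \<gamma> A(1) sub, where k=k and l=0] by (simp only: add_0_right)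
    also have "\<dots> \<le> (\<integral>\<^sup>+x. ennreal (gauss_coeff k 0 / (1 - a\<^sup>2)) * indicator {- a..a} x \<partial>lborel)"
    proof (rule nn_integral_mono)
      fix x
      show "gauss_density k x * indicator A x \<le> ennreal (gauss_coeff k 0 / (1 - a\<^sup>2)) * indicator {- a..a} x"
      proof (cases "x \<in> A")
        case True
        then have "x \<in> {- a..a}" using A by blast
        then have x: "\<bar>x\<bar> \<le> a" by auto
        then have "x\<^sup>2 \<le> a\<^sup>2" by (metis abs_le_square_iff abs_of_nonneg a(1))
        have "gauss_density k x \<le> ennreal (gauss_coeff k 0 / (1 - x\<^sup>2))" using x a by (intro gauss_density_le) simp
        also have "\<dots> \<le> ennreal (gauss_coeff k 0 / (1 - a\<^sup>2))"
          using \<open>x\<^sup>2 \<le> a\<^sup>2\<close> a2 by (intro ennreal_leI divide_left_mono) (auto simp: gauss_coeff_nonneg)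
        finally show ?thesis using x True by (auto simp: indicator_def)
      qed simp
    qed
    also have "\<dots> = ennreal (gauss_coeff k 0 / (1 - a\<^sup>2)) * ennreal (2 * a)"
      using a by (subst nn_integral_cmult_indicator) auto
    also have "\<dots> = ennreal (gauss_coeff k 0 * (2 * a / (1 - a\<^sup>2)))"
      using a a2 by (subst ennreal_mult[symmetric]) (auto simp: gauss_coeff_nonneg)
    finally show "emeasure lborel ((gauss_preimage \<gamma> ^^ k) A) \<le> ennreal (gauss_coeff k 0 * (2 * a / (1 - a\<^sup>2)))" .
  qed
  have "(\<lambda>k. ennreal (gauss_coeff k 0 * (2 * a / (1 - a\<^sup>2)))) \<longlonglongrightarrow> ennreal (0 * (2 * a / (1 - a\<^sup>2)))"
    by (intro tendsto_intros tendsto_ennrealI gauss_coeff_0_tendsto_0)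
  then show "(\<lambda>k. ennreal (gauss_coeff k 0 * (2 * a / (1 - a\<^sup>2)))) \<longlonglongrightarrow> 0" by simp
qed simp

section \<open>Signed measures and uniqueness of Fourier coefficients\<close>

text \<open>These are the hypotheses of \<open>emeasure_pos_variation\<close>. Values off the Borel
  sets are left free, so real and imaginary parts and measures transported by preimages qualify
  without renormalisation.\<close>

definition signed_measure :: "('a::topological_space set \<Rightarrow> real) \<Rightarrow> bool" where
  "signed_measure \<nu> \<longleftrightarrow> \<nu> {} = 0 \<and>
     (\<forall>A. range A \<subseteq> sets borel \<longrightarrow> disjoint_family A \<longrightarrow> (\<lambda>i::nat. \<nu> (A i)) sums \<nu> (\<Union>i. A i))"

lemma signed_measureD:
  assumes "signed_measure \<nu>"
  shows "\<nu> {} = 0"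
    and "range A \<subseteq> sets borel \<Longrightarrow> disjoint_family A \<Longrightarrow> (\<lambda>i::nat. \<nu> (A i)) sums \<nu> (\<Union>i. A i)"
  using assms unfolding signed_measure_def by blast+

lemma signed_measure_uminus: "signed_measure \<nu> \<Longrightarrow> signed_measure (\<lambda>A. - \<nu> A)"
  unfolding signed_measure_def[of "\<lambda>A. - \<nu> A"] by (simp add: signed_measureD sums_minus)

lemma signed_measure_Un:
  assumes "signed_measure \<nu>" "B \<in> sets borel" "C \<in> sets borel" "B \<inter> C = {}"
  shows "\<nu> (B \<union> C) = \<nu> B + \<nu> C"
proof -
  have "(\<lambda>i. \<nu> (binaryset B C i)) sums \<nu> (\<Union>i. binaryset B C i)"
    using assms by (intro signed_measureD(2)) (auto simp: binaryset_def disjoint_family_on_def)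
  then have "(\<lambda>i. \<nu> (binaryset B C i)) sums \<nu> (B \<union> C)" by (simp add: UN_binaryset_eq)
  moreover have "(\<lambda>i. \<nu> (binaryset B C i)) sums (\<nu> B + \<nu> C)"
    by (rule binaryset_sums) (rule signed_measureD(1)[OF assms(1)])
  ultimately show ?thesis by (rule sums_unique2)
qed

lemma signed_measure_Diff:
  assumes "signed_measure \<nu>" "B \<in> sets borel" "C \<in> sets borel" "C \<subseteq> B"
  shows "\<nu> (B - C) = \<nu> B - \<nu> C"
proof -
  have "\<nu> ((B - C) \<union> C) = \<nu> (B - C) + \<nu> C"
    using assms by (intro signed_measure_Un) auto
  moreover have "(B - C) \<union> C = B" using assms(4) by auto
  ultimately show ?thesis by simp
qed

lemma sets_pos_variation [simp, measurable_cong]: "sets (pos_variation \<nu>) = sets borel"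
proof -
  have "sigma_sets UNIV (sets (borel :: 'a measure)) = sets borel"
    using sets.sigma_sets_eq[of "borel :: 'a measure"] by simp
  then show ?thesis by (simp add: pos_variation_def sets_measure_of)
qed

lemma space_pos_variation [simp]: "space (pos_variation \<nu>) = UNIV"
  using sets_eq_imp_space_eq[OF sets_pos_variation[of \<nu>]] by simp

lemma emeasure_pos_variation_signed:
  "signed_measure \<nu> \<Longrightarrow> A \<in> sets borel \<Longrightarrow>
     emeasure (pos_variation \<nu>) A = (SUP B\<in>{B \<in> sets borel. B \<subseteq> A}. ennreal (\<nu> B))"
  by (rule emeasure_pos_variation) (auto simp: signed_measure_def)

text \<open>A set of infinite positive variation splits into a part that still has infinite
  variation and a remainder on which |\<nu>| is at least 1. Iterating yields disjoint sets whose
  values do not tend to 0, against countable additivity.\<close>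

lemma finite_measure_pos_variation:
  assumes \<nu>: "signed_measure \<nu>"
  shows "finite_measure (pos_variation \<nu>)"
proof (rule finite_measureI, rule notI)
  let ?p = "emeasure (pos_variation \<nu>)"
  assume "?p (space (pos_variation \<nu>)) = \<infinity>"
  then have top: "?p UNIV = \<infinity>" by simp
  have step: "\<exists>Y. (Y \<in> sets borel \<and> ?p Y = \<infinity>) \<and> Y \<subseteq> X \<and> 1 \<le> \<bar>\<nu> (X - Y)\<bar>"
    if X: "X \<in> sets borel \<and> ?p X = \<infinity>" for X
  proof -
    \<comment> \<open>The margin makes both \<open>B\<close> and \<open>X - B\<close> have |\<nu>|
      at least 1, so either of them may be the piece removed.\<close>
    have "ennreal (\<bar>\<nu> X\<bar> + 1) < (SUP B\<in>{B \<in> sets borel. B \<subseteq> X}. ennreal (\<nu> B))"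
      using X emeasure_pos_variation_signed[OF \<nu>, of X] by simp
    then obtain B where B: "B \<in> sets borel" "B \<subseteq> X" "ennreal (\<bar>\<nu> X\<bar> + 1) < ennreal (\<nu> B)"
      unfolding less_SUP_iff by auto
    have gt: "\<bar>\<nu> X\<bar> + 1 < \<nu> B" using B(3) by (subst (asm) ennreal_less_iff) auto
    have "?p X = ?p B + ?p (X - B)"
      using plus_emeasure[of B "pos_variation \<nu>" "X - B"] B X by (auto simp: Un_absorb1)
    then have "?p B + ?p (X - B) = top" using X by simp
    then consider "?p B = \<infinity>" | "?p (X - B) = \<infinity>" unfolding ennreal_add_eq_top by auto
    then show ?thesis
    proof cases
      case 1
      have "\<nu> (X - B) = \<nu> X - \<nu> B" using X B by (intro signed_measure_Diff \<nu>) auto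
      then show ?thesis using 1 gt B by (intro exI[of _ B]) auto
    next
      case 2
      have "X - (X - B) = B" using B by auto
      then show ?thesis using 2 gt B X by (intro exI[of _ "X - B"]) auto
    qed
  qed
  obtain X where X: "\<And>n. X n \<in> sets borel \<and> ?p (X n) = \<infinity>" "\<And>n. X (Suc n) \<subseteq> X n \<and> 1 \<le> \<bar>\<nu> (X n - X (Suc n))\<bar>"
    using dependent_nat_choice[of "\<lambda>_ Y. Y \<in> sets borel \<and> ?p Y = \<infinity>" "\<lambda>_ X Y. Y \<subseteq> X \<and> 1 \<le> \<bar>\<nu> (X - Y)\<bar>"]
      step top by (metis (no_types, lifting) sets.top space_borel)
  define C where "C n = X n - X (Suc n)" for n
  have "decseq X" using X(2) by (intro decseq_SucI) auto
  have "C i \<inter> C j = {}" if "i < j" for i j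
  proof -
    have "X j \<subseteq> X (Suc i)" using decseqD[OF \<open>decseq X\<close>, of "Suc i" j] that by simp
    then show ?thesis by (auto simp: C_def)
  qed
  then have "disjoint_family C"
    unfolding disjoint_family_on_def by (metis Int_commute linorder_neqE_nat)
  moreover have "range C \<subseteq> sets borel" using X by (auto simp: C_def)
  ultimately have "(\<lambda>n. \<nu> (C n)) sums \<nu> (\<Union>n. C n)" using \<nu> by (simp add: signed_measure_def)
  then have "(\<lambda>n. \<nu> (C n)) \<longlonglongrightarrow> 0" by (intro summable_LIMSEQ_zero sums_summable)
  then have "\<forall>\<^sub>F n in sequentially. \<bar>\<nu> (C n)\<bar> < 1"
    using order_tendstoD(2)[OF tendsto_rabs_zero, of _ sequentially 1] by simp
  then obtain n where "\<bar>\<nu> (C n)\<bar> < 1" by (auto simp: eventually_sequentially)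
  then show False using X(2)[of n] by (simp add: C_def)
qed

lemma le_measure_pos_variation:
  assumes "signed_measure \<nu>" "A \<in> sets borel" "B \<in> sets borel" "B \<subseteq> A"
  shows "\<nu> B \<le> measure (pos_variation \<nu>) A"
proof -
  interpret finite_measure "pos_variation \<nu>" by (rule finite_measure_pos_variation) fact
  have "ennreal (\<nu> B) \<le> emeasure (pos_variation \<nu>) A"
    using assms by (subst emeasure_pos_variation_signed) (auto intro: SUP_upper)
  then show ?thesis by (simp add: emeasure_eq_measure)
qed

lemma measure_pos_variation_le:
  assumes \<nu>: "signed_measure \<nu>" and A: "A \<in> sets borel"
    and le: "\<And>B. B \<in> sets borel \<Longrightarrow> B \<subseteq> A \<Longrightarrow> \<nu> B \<le> c"
  shows "measure (pos_variation \<nu>) A \<le> c"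
proof -
  interpret finite_measure "pos_variation \<nu>" by (rule finite_measure_pos_variation) fact
  have "0 \<le> c" using le[of "{}"] \<nu> by (simp add: signed_measure_def)
  moreover have "emeasure (pos_variation \<nu>) A \<le> ennreal c"
    using le by (subst emeasure_pos_variation_signed[OF \<nu> A]) (auto intro!: SUP_least ennreal_leI)
  ultimately show ?thesis by (simp add: emeasure_eq_measure)
qed

text \<open>For \<open>B\<close> inside \<open>A\<close>, the value
  \<open>\<nu> B = \<nu> A - \<nu> (A - B)\<close> is at most \<open>\<nu> A\<close> plus the
  negative variation of \<open>A\<close>. The supremum over \<open>B\<close> gives one inequality
  and \<open>- \<nu>\<close> gives the other, without a Hahn set.\<close>

lemma jordan_decomposition:
  assumes \<nu>: "signed_measure \<nu>" and A: "A \<in> sets borel"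
  shows "\<nu> A = measure (pos_variation \<nu>) A - measure (pos_variation (\<lambda>A. - \<nu> A)) A"
proof -
  have le: "measure (pos_variation \<nu>) A \<le> \<nu> A + measure (pos_variation (\<lambda>A. - \<nu> A)) A" if \<nu>: "signed_measure \<nu>" for \<nu> :: "'a set \<Rightarrow> real"
  proof (rule measure_pos_variation_le[OF \<nu> A])
    fix B assume B: "B \<in> sets borel" "B \<subseteq> A"
    have "- \<nu> (A - B) \<le> measure (pos_variation (\<lambda>A. - \<nu> A)) A"
      using B A by (intro le_measure_pos_variation signed_measure_uminus \<nu>) auto
    then show "\<nu> B \<le> \<nu> A + measure (pos_variation (\<lambda>A. - \<nu> A)) A"
      using signed_measure_Diff[OF \<nu> A B] by simp
  qed
  show ?thesis using le[OF \<nu>] le[OF signed_measure_uminus[OF \<nu>]] by simp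
qed

section \<open>Trigonometric polynomials and measures on the circle\<close>

lemma sum_list_cis_mult:
  "(\<Sum>(c, j)\<leftarrow>xs. c * cis (of_int j * \<theta>)) * (\<Sum>(d, k)\<leftarrow>ys. d * cis (of_int k * \<theta>)) =
   (\<Sum>(c, j)\<leftarrow>concat (map (\<lambda>(c, j). map (\<lambda>(d, k). (c * d, j + k)) ys) xs). c * cis (of_int j * \<theta>))"
proof (induction xs)
  case (Cons x xs)
  obtain c j where x: "x = (c, j)" by (cases x)
  have "c * cis (of_int j * \<theta>) * (\<Sum>(d, k)\<leftarrow>ys. d * cis (of_int k * \<theta>)) =
      (\<Sum>(c, j)\<leftarrow>map (\<lambda>(d, k). (c * d, j + k)) ys. c * cis (of_int j * \<theta>))"
    by (induction ys) (auto simp: distrib_left distrib_right cis_mult[symmetric])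
  then show ?case using Cons by (simp add: x distrib_right)
qed simp

text \<open>A list of coefficients and frequencies, repetitions allowed, encodes a trigonometric
  polynomial; sums are concatenations. A linear form is determined by its values at 1 and
  \<open>\<i>\<close>, which gives the two frequencies 1 and -1.\<close>

lemma real_polynomial_function_on_circle:
  fixes g :: "complex \<Rightarrow> real"
  assumes "real_polynomial_function g"
  shows "\<exists>xs. \<forall>\<theta>. complex_of_real (g (cis \<theta>)) = (\<Sum>(c, j)\<leftarrow>xs. c * cis (of_int (j::int) * \<theta>))"
  using assms
proof induction
  case (linear f)
  let ?xs = "[((f 1 - \<i> * f \<i>) / 2, 1::int), ((f 1 + \<i> * f \<i>) / 2, - 1)]"
  have "complex_of_real (f (cis \<theta>)) = (\<Sum>(c, j)\<leftarrow>?xs. c * cis (of_int j * \<theta>))" for \<theta>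
  proof -
    have "cis \<theta> = cos \<theta> *\<^sub>R 1 + sin \<theta> *\<^sub>R \<i>" by (simp add: complex_eq_iff)
    then have "f (cis \<theta>) = cos \<theta> * f 1 + sin \<theta> * f \<i>"
      using linear by (simp add: bounded_linear.linear linear_add linear_scale)
    then show ?thesis by (simp add: complex_eq_iff field_simps)
  qed
  then show ?case by blast
next
  case (const c)
  show ?case by (rule exI[of _ "[(complex_of_real c, 0)]"]) simp
next
  case (add f g)
  then obtain xs ys where "\<forall>\<theta>. complex_of_real (f (cis \<theta>)) = (\<Sum>(c, j)\<leftarrow>xs. c * cis (of_int (j::int) * \<theta>))"
    "\<forall>\<theta>. complex_of_real (g (cis \<theta>)) = (\<Sum>(c, j)\<leftarrow>ys. c * cis (of_int (j::int) * \<theta>))" by blast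
  then show ?case by (intro exI[of _ "xs @ ys"]) simp
next
  case (mult f g)
  then obtain xs ys where "\<forall>\<theta>. complex_of_real (f (cis \<theta>)) = (\<Sum>(c, j)\<leftarrow>xs. c * cis (of_int (j::int) * \<theta>))"
    "\<forall>\<theta>. complex_of_real (g (cis \<theta>)) = (\<Sum>(c, j)\<leftarrow>ys. c * cis (of_int (j::int) * \<theta>))" by blast
  then show ?case
    by (intro exI[of _ "concat (map (\<lambda>(c, j). map (\<lambda>(d, k). (c * d, j + k)) ys) xs)"])
      (simp add: sum_list_cis_mult[symmetric])
qed

context
  fixes P Q :: "'a::topological_space measure" and u :: "'a \<Rightarrow> real"
  assumes fin: "finite_measure P" "finite_measure Q"
    and sets_PQ [measurable_cong]: "sets P = sets borel" "sets Q = sets borel"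
    and u [measurable]: "u \<in> borel_measurable borel"
    and moments: "\<And>j::int. (\<integral>x. cis (of_int j * u x) \<partial>P) = (\<integral>x. cis (of_int j * u x) \<partial>Q)"
begin

lemma measurable_cis_u [measurable]: "(\<lambda>x. cis (of_int j * u x)) \<in> borel_measurable borel"
  unfolding cis_conv_exp by measurable

lemma measurable_cis_u' [measurable]: "(\<lambda>x. cis (u x)) \<in> borel_measurable borel"
  unfolding cis_conv_exp by measurable

lemma integrable_bounded:
  fixes h :: "'a::topological_space \<Rightarrow> 'b::{banach, second_countable_topology}"
  assumes "h \<in> borel_measurable borel" "\<And>x. norm (h x) \<le> B"
  shows "integrable P h" "integrable Q h"
  using assms
  by (auto intro!: finite_measure.integrable_const_bound[OF fin(1), of _ B] finite_measure.integrable_const_bound[OF fin(2), of _ B]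
      simp: measurable_cong_sets[OF sets_PQ(1) refl] measurable_cong_sets[OF sets_PQ(2) refl])

lemma integral_cis_sum_list:
  "(\<integral>x. (\<Sum>(c, j)\<leftarrow>xs. c * cis (of_int (j::int) * u x)) \<partial>P) = (\<integral>x. (\<Sum>(c, j)\<leftarrow>xs. c * cis (of_int j * u x)) \<partial>Q) \<and>
   integrable P (\<lambda>x. \<Sum>(c, j)\<leftarrow>xs. c * cis (of_int j * u x)) \<and> integrable Q (\<lambda>x. \<Sum>(c, j)\<leftarrow>xs. c * cis (of_int j * u x))"
proof (induction xs)
  case (Cons x xs)
  obtain c j where x: "x = (c, j)" by (cases x)
  have "integrable P (\<lambda>x. cis (of_int j * u x))" "integrable Q (\<lambda>x. cis (of_int j * u x))"
    by (rule integrable_bounded[of _ 1]; simp)+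
  then have "integrable P (\<lambda>x. c * cis (of_int j * u x))" "integrable Q (\<lambda>x. c * cis (of_int j * u x))" by auto
  then show ?case using Cons by (simp add: x moments)
qed simp

text \<open>Stone-Weierstrass on the unit circle replaces \<open>f\<close> by a polynomial within
  \<open>e\<close>. Its integrals agree by the moment hypothesis, so those of \<open>f\<close>
  differ by at most \<open>e\<close> times the total mass.\<close>

lemma integral_continuous_circle:
  fixes f :: "complex \<Rightarrow> real"
  assumes f: "continuous_on UNIV f" and bound: "\<And>z. \<bar>f z\<bar> \<le> B"
  shows "(\<integral>x. f (cis (u x)) \<partial>P) = (\<integral>x. f (cis (u x)) \<partial>Q)"
proof -
  have [measurable]: "f \<in> borel_measurable borel" using f by (rule borel_measurable_continuous_onI)
  have fi: "integrable P (\<lambda>x. f (cis (u x)))" "integrable Q (\<lambda>x. f (cis (u x)))"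
    using bound by (auto intro!: integrable_bounded[of _ B])
  define m where "m = measure P (space P) + measure Q (space Q)"
  have le: "\<bar>(\<integral>x. f (cis (u x)) \<partial>P) - (\<integral>x. f (cis (u x)) \<partial>Q)\<bar> \<le> e * m" if "e > 0" for e
  proof -
    have "continuous_on (sphere 0 1) f" using f by (rule continuous_on_subset) simp
    then obtain g where g: "real_polynomial_function g" "\<And>z. z \<in> sphere 0 1 \<Longrightarrow> \<bar>f z - g z\<bar> < e"
      using Stone_Weierstrass_real_polynomial_function[OF compact_sphere _ \<open>e > 0\<close>, of 0 1 f] by blast
    obtain xs where xs: "\<And>\<theta>. complex_of_real (g (cis \<theta>)) = (\<Sum>(c, j)\<leftarrow>xs. c * cis (of_int (j::int) * \<theta>))"
      using real_polynomial_function_on_circle[OF g(1)] by blast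
    have "integrable P (\<lambda>x. complex_of_real (g (cis (u x))))" "integrable Q (\<lambda>x. complex_of_real (g (cis (u x))))"
      "(\<integral>x. complex_of_real (g (cis (u x))) \<partial>P) = (\<integral>x. complex_of_real (g (cis (u x))) \<partial>Q)"
      unfolding xs using integral_cis_sum_list[of xs] by auto
    then have gi: "integrable P (\<lambda>x. g (cis (u x)))" "integrable Q (\<lambda>x. g (cis (u x)))"
      "(\<integral>x. g (cis (u x)) \<partial>P) = (\<integral>x. g (cis (u x)) \<partial>Q)"
      by (auto dest: complex_of_real_integrable_eq[THEN iffD1])
    have d: "\<bar>(\<integral>x. f (cis (u x)) \<partial>M) - (\<integral>x. g (cis (u x)) \<partial>M)\<bar> \<le> e * measure M (space M)"
      if "finite_measure M" "integrable M (\<lambda>x. f (cis (u x)))" "integrable M (\<lambda>x. g (cis (u x)))" for M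
    proof -
      interpret finite_measure M by fact
      have "\<bar>(\<integral>x. f (cis (u x)) - g (cis (u x)) \<partial>M)\<bar> \<le> (\<integral>x. \<bar>f (cis (u x)) - g (cis (u x))\<bar> \<partial>M)"
        by (rule integral_abs_bound)
      also have "\<dots> \<le> (\<integral>x. e \<partial>M)"
        using that g(2)[of "cis _"] by (intro integral_mono integrable_abs Bochner_Integration.integrable_diff) (auto intro: less_imp_le)
      finally show ?thesis using that by (simp add: mult.commute)
    qed
    show ?thesis
      using d[OF fin(1) fi(1) gi(1)] d[OF fin(2) fi(2) gi(2)] gi(3) unfolding m_def distrib_left by linarith
  qed
  have "(\<integral>x. f (cis (u x)) \<partial>P) - (\<integral>x. f (cis (u x)) \<partial>Q) = 0"
  proof (rule ccontr)
    assume "(\<integral>x. f (cis (u x)) \<partial>P) - (\<integral>x. f (cis (u x)) \<partial>Q) \<noteq> 0"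
    then have pos: "\<bar>(\<integral>x. f (cis (u x)) \<partial>P) - (\<integral>x. f (cis (u x)) \<partial>Q)\<bar> > 0" (is "?D > 0") by simp
    have m: "0 \<le> m" by (simp add: m_def)
    \<comment> \<open>This choice of \<open>e\<close> gives \<open>e * m < ?D\<close>; the 1 in the
      denominator covers zero total mass.\<close>
    have "?D \<le> ?D / (2 * (m + 1)) * m" using pos m by (intro le) auto
    also have "\<dots> = ?D * (m / (2 * (m + 1)))" by simp
    also have "\<dots> < ?D * 1" using pos m by (intro mult_strict_left_mono) (auto simp: divide_less_eq)
    finally show False by simp
  qed
  then show ?thesis by simp
qed

lemma emeasure_open_circle:
  assumes "open U"
  shows "emeasure P {x. cis (u x) \<in> U} = emeasure Q {x. cis (u x) \<in> U}"
proof -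
  interpret P: finite_measure P by (rule fin)
  interpret Q: finite_measure Q by (rule fin)
  have sp: "space P = UNIV" "space Q = UNIV" using sets_PQ[THEN sets_eq_imp_space_eq] by auto
  \<comment> \<open>Continuous functions increasing to the indicator of \<open>U\<close>. The whole
    plane is separate because the distance to the empty set is 0 by convention.\<close>
  define f where "f n z = (if U = UNIV then 1 else min 1 (real n * infdist z (- U)))" for n z
  have cont: "continuous_on UNIV (f n)" for n
    unfolding f_def by (cases "U = UNIV") (auto intro!: continuous_intros)
  have f01: "0 \<le> f n z" "f n z \<le> 1" for n z by (auto simp: f_def infdist_nonneg)
  have lim: "(\<lambda>n. f n z) \<longlonglongrightarrow> indicator U z" for z
  proof (cases "z \<in> U")
    case True
    show ?thesis
    proof (cases "U = UNIV")
      case False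
      then have "infdist z (- U) > 0"
        using True assms infdist_pos_not_in_closed[of "- U" z] by (auto simp: closed_def)
      then obtain N :: nat where N: "1 < real N * infdist z (- U)"
        using reals_Archimedean3 by blast
      have "f n z = 1" if "n \<ge> N" for n
      proof -
        have "real N * infdist z (- U) \<le> real n * infdist z (- U)"
          using that by (intro mult_right_mono) (auto simp: infdist_nonneg)
        then show ?thesis using N False by (simp add: f_def)
      qed
      then show ?thesis using True
        by (intro tendsto_eventually eventually_sequentiallyI[of N]) auto
    qed (simp add: f_def)
  next
    case False
    then have "infdist z (- U) = 0" by (intro infdist_zero) auto
    moreover have "U \<noteq> UNIV" using False by auto
    ultimately show ?thesis using False by (simp add: f_def)
  qed
  have [measurable]: "f n \<in> borel_measurable borel" for n using cont by (rule borel_measurable_continuous_onI)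
  have [measurable]: "U \<in> sets borel" using assms by auto
  have S: "{x. cis (u x) \<in> U} \<in> sets borel" by measurable
  have conv: "(\<lambda>n. \<integral>x. f n (cis (u x)) \<partial>M) \<longlonglongrightarrow> measure M {x. cis (u x) \<in> U}"
    if M: "finite_measure M" "sets M = sets borel" for M
  proof -
    interpret finite_measure M by fact
    have spM: "space M = UNIV" using sets_eq_imp_space_eq[OF M(2)] by simp
    note [measurable_cong] = M(2)
    have "(\<lambda>n. \<integral>x. f n (cis (u x)) \<partial>M) \<longlonglongrightarrow> (\<integral>x. indicator {x. cis (u x) \<in> U} x \<partial>M)"
    proof (rule integral_dominated_convergence[where w="\<lambda>_. 1"])
      show "AE x in M. (\<lambda>n. f n (cis (u x))) \<longlonglongrightarrow> indicator {x. cis (u x) \<in> U} x"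
        using lim by (auto simp: indicator_def)
      show "(\<lambda>x. indicat_real {x. cis (u x) \<in> U} x) \<in> borel_measurable M" using S M by simp
    qed (use f01 in auto)
    then show ?thesis using S M spM by simp
  qed
  have "(\<integral>x. f n (cis (u x)) \<partial>P) = (\<integral>x. f n (cis (u x)) \<partial>Q)" for n
    by (rule integral_continuous_circle[OF cont, of n 1]) (use f01 in auto)
  then have "measure P {x. cis (u x) \<in> U} = measure Q {x. cis (u x) \<in> U}"
    using conv[OF fin(1) sets_PQ(1)] conv[OF fin(2) sets_PQ(2)] by (auto intro: LIMSEQ_unique)
  then show ?thesis by (simp add: P.emeasure_eq_measure Q.emeasure_eq_measure)
qed

text \<open>The open sets generate the Borel sets, are closed under intersection and include the
  whole plane, which has finite mass.\<close>

lemma emeasure_circle: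
  assumes "S \<in> sets borel"
  shows "emeasure P {x. cis (u x) \<in> S} = emeasure Q {x. cis (u x) \<in> S}"
proof -
  interpret P: finite_measure P by (rule fin)
  have sp: "space P = UNIV" "space Q = UNIV" using sets_PQ[THEN sets_eq_imp_space_eq] by auto
  have [measurable]: "(\<lambda>x. cis (u x)) \<in> P \<rightarrow>\<^sub>M borel" "(\<lambda>x. cis (u x)) \<in> Q \<rightarrow>\<^sub>M borel" by measurable
  have eq: "emeasure (distr M borel (\<lambda>x. cis (u x))) S = emeasure M {x. cis (u x) \<in> S}"
    if "(\<lambda>x. cis (u x)) \<in> M \<rightarrow>\<^sub>M borel" "space M = UNIV" "S \<in> sets borel" for M S
    using that by (simp add: emeasure_distr vimage_def)
  have "distr P borel (\<lambda>x. cis (u x)) = distr Q borel (\<lambda>x. cis (u x))"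
  proof (rule measure_eqI_generator_eq[where E="{S. open S}" and \<Omega>=UNIV and A="\<lambda>_. UNIV"])
    show "Int_stable {S::complex set. open S}" by (auto simp: Int_stable_def)
    show "sets (distr P borel (\<lambda>x. cis (u x))) = sigma_sets UNIV {S. open S}" by (simp add: borel_def)
    show "sets (distr Q borel (\<lambda>x. cis (u x))) = sigma_sets UNIV {S. open S}" by (simp add: borel_def)
    show "emeasure (distr P borel (\<lambda>x. cis (u x))) X = emeasure (distr Q borel (\<lambda>x. cis (u x))) X" if "X \<in> {S. open S}" for X
      using that emeasure_open_circle[of X] by (simp add: eq sp)
  qed (auto simp: eq sp)
  then show ?thesis using eq[of P S] eq[of Q S] assms sp by simp
qed

end

text \<open>The quotient \<open>sin \<theta> / (1 + cos \<theta>)\<close> is tan(\<theta>/2), so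
  this is an explicit Borel inverse of t -> cis(\<pi> t) on (-1,1).\<close>

lemma arctan_cis_pi:
  assumes "\<bar>t - 2 * of_int j\<bar> < 1"
  shows "2 / pi * arctan (Im (cis (pi * t)) / (Re (cis (pi * t)) + 1)) = t - 2 * of_int j"
proof -
  define s where "s = t - 2 * of_int j"
  have "pi * t = pi * s + 2 * pi * of_int j" by (simp add: s_def algebra_simps)
  then have "cis (pi * t) = cis (pi * s)" by (simp add: complex_eq_iff sin_add cos_add)
  then have "Im (cis (pi * t)) / (Re (cis (pi * t)) + 1) = tan (pi * s / 2)" by (simp add: tan_half)
  moreover have "arctan (tan (pi * s / 2)) = pi * s / 2"
  proof (rule arctan_tan)
    have "-1 < s" "s < 1" using assms by (auto simp: s_def)
    then show "- (pi / 2) < pi * s / 2" "pi * s / 2 < pi / 2"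
      using mult_strict_left_mono[of "-1" s pi] mult_strict_left_mono[of s 1 pi] by simp_all
  qed
  ultimately have "2 / pi * arctan (Im (cis (pi * t)) / (Re (cis (pi * t)) + 1)) = 2 / pi * (pi * s / 2)"
    by (simp only:)
  then show ?thesis by (simp add: s_def)
qed

text \<open>The set A + 2Z is the preimage of a Borel set under t -> cis(\<pi> t), so equality of
  all moments on the circle applies.\<close>

lemma emeasure_mod_2_eq:
  fixes P Q :: "'a::topological_space measure"
  assumes fin: "finite_measure P" "finite_measure Q" and sets: "sets P = sets borel" "sets Q = sets borel"
    and u [measurable]: "u \<in> borel_measurable borel"
    and moments: "\<And>j::int. (\<integral>x. cis (of_int j * (pi * u x)) \<partial>P) = (\<integral>x. cis (of_int j * (pi * u x)) \<partial>Q)"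
    and A [measurable]: "A \<in> sets borel" and sub: "A \<subseteq> {-1<..<1}"
  shows "emeasure P {x. \<exists>j::int. u x - 2 * of_int j \<in> A} = emeasure Q {x. \<exists>j::int. u x - 2 * of_int j \<in> A}"
proof -
  \<comment> \<open>\<open>Re z + 1 > 0\<close> excludes z = -1, the image of the odd integers:
    there the quotient is 0 by convention and would be mistaken for the residue 0.\<close>
  define S where "S = {z. (Re z + 1 > 0 \<and> 2 / pi * arctan (Im z / (Re z + 1)) \<in> A)}"
  have [measurable]: "S \<in> sets borel" unfolding S_def by measurable
  have "(\<exists>j::int. t - 2 * of_int j \<in> A) \<longleftrightarrow> cis (pi * t) \<in> S" for t :: real
  proof
    assume "\<exists>j::int. t - 2 * of_int j \<in> A"
    then obtain j :: int where j: "t - 2 * of_int j \<in> A" by blast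
    then have "t - 2 * of_int j \<in> {-1<..<1}" using sub by blast
    then have lt: "\<bar>t - 2 * of_int j\<bar> < 1" by auto
    have "pi * t = pi * (t - 2 * of_int j) + 2 * pi * of_int j" by (simp add: algebra_simps)
    then have "cos (pi * t) = cos (pi * (t - 2 * of_int j))" by (simp add: cos_add)
    moreover have "cos pi < cos \<bar>pi * (t - 2 * of_int j)\<bar>"
      using lt by (intro cos_monotone_0_pi) (auto simp: abs_mult)
    ultimately have "Re (cis (pi * t)) + 1 > 0" by simp
    then show "cis (pi * t) \<in> S" unfolding S_def using arctan_cis_pi[OF lt] j by simp
  next
    assume z: "cis (pi * t) \<in> S"
    define j where "j = \<lfloor>(t + 1) / 2\<rfloor>"
    have "of_int j \<le> (t + 1) / 2" "(t + 1) / 2 < of_int j + 1" unfolding j_def by linarith+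
    then have t: "-1 \<le> t - 2 * of_int j" "t - 2 * of_int j < 1" by simp_all
    have "t - 2 * of_int j \<noteq> -1"
    proof
      assume "t - 2 * of_int j = -1"
      then have "t = 2 * of_int j - 1" by simp
      then have "pi * t = pi * (2 * of_int j - 1)" by (simp only:)
      also have "\<dots> = - pi + 2 * pi * of_int j" by (simp add: algebra_simps)
      finally have "cos (pi * t) = -1" by (simp add: cos_add)
      then show False using z by (simp add: S_def)
    qed
    then have "\<bar>t - 2 * of_int j\<bar> < 1" using t by auto
    then show "\<exists>j::int. t - 2 * of_int j \<in> A" using z arctan_cis_pi[of t j] by (auto simp: S_def)
  qed
  then have "{x. \<exists>j::int. u x - 2 * of_int j \<in> A} = {x. cis (pi * u x) \<in> S}" by simp
  moreover have "emeasure P {x. cis (pi * u x) \<in> S} = emeasure Q {x. cis (pi * u x) \<in> S}"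
    by (rule emeasure_circle[OF fin sets _ moments]) measurable
  ultimately show ?thesis by simp
qed

section \<open>Vanishing of signed measures with two vanishing periodizations\<close>

text \<open>Differentiable maps preserve negligible sets. The statement is about a Borel set
  \<open>B\<close> inside the image because the image itself need not be Borel.\<close>

lemma null_sets_lborel_differentiable_image:
  fixes f :: "real \<Rightarrow> real"
  assumes N: "N \<in> null_sets lborel" and f: "f differentiable_on S" "S \<subseteq> N" and B: "B \<in> sets borel" "B \<subseteq> f ` S"
  shows "B \<in> null_sets lborel"
proof -
  have "negligible N" using N by (simp add: negligible_iff_null_sets null_sets_completionI)
  then have "negligible (f ` S)"
    by (intro negligible_differentiable_image_negligible f negligible_subset[OF _ f(2)]) auto
  then have "negligible B" by (rule negligible_subset) (rule B)
  then have "emeasure lebesgue B = 0" by (auto simp: negligible_iff_null_sets)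
  then show ?thesis using B by auto
qed

text \<open>Borel-Cantelli makes \<open>limsup A\<close> null for \<open>M\<close>, hence for
  \<open>K\<close>; so the indicators tend to 0 almost everywhere for \<open>K\<close>, and
  dominated convergence applies because \<open>K\<close> is finite.\<close>

lemma measure_tendsto_0_if_summable:
  fixes K :: "'a measure"
  assumes fin: "finite_measure K" and sets [measurable_cong]: "sets K = sets M"
    and ac: "\<And>N. N \<in> null_sets M \<Longrightarrow> emeasure K N = 0"
    and A [measurable]: "\<And>n::nat. A n \<in> sets M" and "\<And>n. emeasure M (A n) < \<infinity>" "summable (\<lambda>n. measure M (A n))"
  shows "(\<lambda>n. measure K (A n)) \<longlonglongrightarrow> 0"
proof -
  interpret finite_measure K by fact
  have "limsup A \<in> null_sets M" by (rule borel_cantelli_limsup1[OF A assms(5,6)])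
  then have "limsup A \<in> null_sets K" using ac[of "limsup A"] sets by (simp add: null_sets_def)
  then have ae: "AE x in K. x \<notin> limsup A" by (rule AE_not_in)
  have "(\<lambda>n. \<integral>x. indicator (A n) x \<partial>K) \<longlonglongrightarrow> (\<integral>x. (0::real) \<partial>K)"
  proof (rule integral_dominated_convergence[where w="\<lambda>_. 1"])
    show "AE x in K. (\<lambda>n. indicat_real (A n) x) \<longlonglongrightarrow> 0"
      using ae
    proof eventually_elim
      case (elim x)
      then have "\<forall>\<^sub>F n in sequentially. x \<notin> A n"
        by (auto simp: limsup_INF_SUP eventually_sequentially)
      then show ?case by (intro tendsto_eventually) (auto elim: eventually_mono)
    qed
  qed (auto simp: indicator_def)
  moreover have "(\<integral>x. indicator (A n) x \<partial>K) = measure K (A n)" for n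
    using A[of n] sets sets.sets_into_space[of "A n" K] by (simp add: Int_absorb2)
  ultimately show ?thesis by simp
qed

section \<open>Total variation and 2-periodization\<close>

definition variation :: "('a::topological_space set \<Rightarrow> real) \<Rightarrow> 'a set \<Rightarrow> real" where
  "variation \<nu> A = measure (pos_variation \<nu>) A + measure (pos_variation (\<lambda>B. - \<nu> B)) A"

lemma variation_nonneg [simp]: "0 \<le> variation \<nu> A"
  by (simp add: variation_def)

lemma variation_mono:
  assumes "signed_measure \<nu>" "A \<subseteq> B" "B \<in> sets borel"
  shows "variation \<nu> A \<le> variation \<nu> B"
  unfolding variation_def
  using assms finite_measure.finite_measure_mono[OF finite_measure_pos_variation[OF assms(1)], of A B]
    finite_measure.finite_measure_mono[OF finite_measure_pos_variation[OF signed_measure_uminus[OF assms(1)]], of A B]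
  by simp

lemma variation_eq_0:
  assumes "signed_measure \<nu>" "A \<in> sets borel" "\<And>B. B \<in> sets borel \<Longrightarrow> B \<subseteq> A \<Longrightarrow> \<nu> B = 0"
  shows "variation \<nu> A = 0"
  using measure_pos_variation_le[OF assms(1,2), of 0] measure_pos_variation_le[OF signed_measure_uminus[OF assms(1)] assms(2), of 0]
    assms(3) by (simp add: variation_def measure_le_0_iff)

lemma variation_UN_eq_0:
  assumes \<nu>: "signed_measure \<nu>" and A: "\<And>n::nat. A n \<in> sets borel" and z: "\<And>n. variation \<nu> (A n) = 0"
  shows "variation \<nu> (\<Union>n. A n) = 0"
proof -
  have "measure (pos_variation \<rho>) (\<Union>n. A n) = 0"
    if \<rho>: "signed_measure \<rho>" and "\<And>n. measure (pos_variation \<rho>) (A n) = 0" for \<rho>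
  proof -
    interpret finite_measure "pos_variation \<rho>" by (rule finite_measure_pos_variation) fact
    have "A n \<in> null_sets (pos_variation \<rho>)" for n using that A by (simp add: null_sets_def emeasure_eq_measure)
    then have "(\<Union>n. A n) \<in> null_sets (pos_variation \<rho>)" by (intro null_sets_UN) auto
    then show ?thesis by (simp add: measure_eq_0_null_sets)
  qed
  moreover have "measure (pos_variation \<nu>) (A n) = 0 \<and> measure (pos_variation (\<lambda>B. - \<nu> B)) (A n) = 0" for n
    using z[of n] measure_nonneg[of "pos_variation \<nu>" "A n"] measure_nonneg[of "pos_variation (\<lambda>B. - \<nu> B)" "A n"]
    unfolding variation_def by linarith
  ultimately show ?thesis using \<nu> signed_measure_uminus[OF \<nu>] by (simp add: variation_def)
qed

lemma variation_Un_eq_0: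
  assumes "signed_measure \<nu>" "A \<in> sets borel" "B \<in> sets borel" "variation \<nu> A = 0" "variation \<nu> B = 0"
  shows "variation \<nu> (A \<union> B) = 0"
proof -
  have "(\<Union>n::nat. if n = 0 then A else B) = A \<union> B"
    by (auto split: if_splits intro: exI[of _ "0::nat"] exI[of _ "1::nat"])
  then show ?thesis using variation_UN_eq_0[of \<nu> "\<lambda>n. if n = 0 then A else B"] assms by simp
qed

lemma abs_le_variation:
  assumes "signed_measure \<nu>" "A \<in> sets borel"
  shows "\<bar>\<nu> A\<bar> \<le> variation \<nu> A"
  using le_measure_pos_variation[OF assms assms(2) subset_refl]
    le_measure_pos_variation[OF signed_measure_uminus[OF assms(1)] assms(2) assms(2) subset_refl]
    measure_nonneg[of "pos_variation \<nu>" A] measure_nonneg[of "pos_variation (\<lambda>B. - \<nu> B)" A]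
  unfolding variation_def by linarith

text \<open>The saturation A + 2Z, not a set of representatives.\<close>

definition mod_2 :: "real set \<Rightarrow> real set" where
  "mod_2 A = {t. \<exists>j::int. t - 2 * of_int j \<in> A}"

lemma mod_2_measurable [measurable]:
  assumes [measurable]: "A \<in> sets borel"
  shows "mod_2 A \<in> sets borel"
  unfolding mod_2_def by measurable

lemma mod_2_diff:
  assumes "A \<subseteq> {-1<..<1}" "t \<in> mod_2 A" "t \<notin> A"
  shows "\<bar>t\<bar> > 1"
proof -
  obtain j :: int where j: "t - 2 * of_int j \<in> A" using assms(2) by (auto simp: mod_2_def)
  then have "t - 2 * of_int j \<in> {-1<..<1}" using assms(1) by blast
  then have b: "-1 < t - 2 * of_int j" "t - 2 * of_int j < 1" by auto
  have "j \<noteq> 0" using j assms(3) by auto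
  then consider "j \<ge> 1" | "j \<le> -1" by linarith
  then show ?thesis
  proof cases
    case 1
    then have "(1::real) \<le> of_int j" by simp
    then show ?thesis using b by linarith
  next
    case 2
    then have "of_int j \<le> (-1::real)" by simp
    then show ?thesis using b by linarith
  qed
qed

text \<open>For \<open>B\<close> inside \<open>A\<close>, periodization gives
  \<open>\<kappa> B = - \<kappa> (mod_2 B - B)\<close>. The points of \<open>mod_2 B - B\<close>
  come from nonzero even shifts, so they have modulus above 1 and avoid \<open>A\<close>.\<close>

lemma pos_variation_mod_2_le:
  assumes \<kappa>: "signed_measure \<kappa>" and A: "A \<in> sets borel" "A \<subseteq> {-1<..<1}"
    and per: "\<And>A. A \<in> sets borel \<Longrightarrow> A \<subseteq> {-1<..<1} \<Longrightarrow> \<kappa> (mod_2 A) = 0"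
  shows "measure (pos_variation \<kappa>) A \<le> measure (pos_variation (\<lambda>B. - \<kappa> B)) (mod_2 A - A)"
proof (rule measure_pos_variation_le[OF \<kappa> A(1)])
  fix B assume B: "B \<in> sets borel" "B \<subseteq> A"
  have "B \<subseteq> mod_2 B" by (auto simp: mod_2_def intro: exI[of _ 0])
  then have "\<kappa> (mod_2 B - B) = \<kappa> (mod_2 B) - \<kappa> B" using B by (intro signed_measure_Diff[OF \<kappa>]) auto
  moreover have "\<kappa> (mod_2 B) = 0" using B A by (intro per) auto
  moreover have "- \<kappa> (mod_2 B - B) \<le> measure (pos_variation (\<lambda>B. - \<kappa> B)) (mod_2 A - A)"
  proof (rule le_measure_pos_variation[OF signed_measure_uminus[OF \<kappa>]])
    have "\<bar>t\<bar> > 1" if "t \<in> mod_2 B" "t \<notin> B" for t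
      using mod_2_diff[of B t] that B A by auto
    then have "t \<notin> A" if "t \<in> mod_2 B" "t \<notin> B" for t using A that by fastforce
    then show "mod_2 B - B \<subseteq> mod_2 A - A" using B by (auto simp: mod_2_def)
  qed (use A B in auto)
  ultimately show "\<kappa> B \<le> measure (pos_variation (\<lambda>B. - \<kappa> B)) (mod_2 A - A)" by simp
qed

lemma variation_mod_2_le:
  assumes \<kappa>: "signed_measure \<kappa>" and A: "A \<in> sets borel" "A \<subseteq> {-1<..<1}"
    and per: "\<And>A. A \<in> sets borel \<Longrightarrow> A \<subseteq> {-1<..<1} \<Longrightarrow> \<kappa> (mod_2 A) = 0"
  shows "variation \<kappa> A \<le> variation \<kappa> (mod_2 A - A)"
proof -
  have "measure (pos_variation (\<lambda>B. - \<kappa> B)) A \<le> measure (pos_variation (\<lambda>B. - (- \<kappa> B))) (mod_2 A - A)"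
    by (rule pos_variation_mod_2_le[OF signed_measure_uminus[OF \<kappa>] A]) (simp add: per)
  then show ?thesis using pos_variation_mod_2_le[OF assms] by (simp add: variation_def)
qed

lemma signed_measure_vimage:
  fixes \<nu> :: "'a::topological_space set \<Rightarrow> real" and f :: "'a \<Rightarrow> 'b::topological_space"
  assumes \<nu>: "signed_measure \<nu>" and f: "f \<in> borel_measurable borel"
  shows "signed_measure (\<lambda>A. \<nu> (f -` A))"
  unfolding signed_measure_def
proof (intro conjI allI impI)
  fix A :: "nat \<Rightarrow> 'b set" assume A: "range A \<subseteq> sets borel" "disjoint_family A"
  have "f -` A i \<in> sets borel" for i using measurable_sets[OF f, of "A i"] A by auto
  moreover have "disjoint_family (\<lambda>i. f -` A i)" using A(2) by (auto simp: disjoint_family_on_def)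
  ultimately have "(\<lambda>i. \<nu> (f -` A i)) sums \<nu> (\<Union>i. f -` A i)"
    by (intro signed_measureD(2)[OF \<nu>]) auto
  then show "(\<lambda>i. \<nu> (f -` A i)) sums \<nu> (f -` (\<Union>i. A i))" by (simp add: vimage_UN)
qed (use \<nu> in \<open>simp add: signed_measure_def\<close>)

text \<open>Taking preimages under an involution is a bijection between the Borel subsets of
  \<open>A\<close> and those of its preimage, so the suprema defining the variations agree.\<close>

lemma variation_vimage_involution:
  assumes \<nu>: "signed_measure \<nu>" and f: "f \<in> borel_measurable borel" and inv: "\<And>x. f (f x) = x" and A: "A \<in> sets borel"
  shows "variation (\<lambda>A. \<nu> (f -` A)) A = variation \<nu> (f -` A)"
proof -
  have vm: "f -` B \<in> sets borel" if "B \<in> sets borel" for B using measurable_sets[OF f that] by simp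
  have ff: "f -` (f -` B) = B" for B using inv by auto
  have "measure (pos_variation (\<lambda>A. \<rho> (f -` A))) A = measure (pos_variation \<rho>) (f -` A)" if \<rho>: "signed_measure \<rho>" for \<rho>
  proof (rule antisym)
    show "measure (pos_variation (\<lambda>A. \<rho> (f -` A))) A \<le> measure (pos_variation \<rho>) (f -` A)"
      by (rule measure_pos_variation_le[OF signed_measure_vimage[OF \<rho> f] A], rule le_measure_pos_variation[OF \<rho>])
        (use vm A in auto)
    show "measure (pos_variation \<rho>) (f -` A) \<le> measure (pos_variation (\<lambda>A. \<rho> (f -` A))) A"
    proof (rule measure_pos_variation_le[OF \<rho> vm[OF A]])
      fix B assume B: "B \<in> sets borel" "B \<subseteq> f -` A"
      have "\<rho> (f -` (f -` B)) \<le> measure (pos_variation (\<lambda>A. \<rho> (f -` A))) A"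
      proof (rule le_measure_pos_variation[OF signed_measure_vimage[OF \<rho> f] A vm[OF B(1)]])
        show "f -` B \<subseteq> A" using B(2) ff[of A] by blast
      qed
      then show "\<rho> B \<le> measure (pos_variation (\<lambda>A. \<rho> (f -` A))) A" by (simp add: ff)
    qed
  qed
  from this[OF \<nu>] this[OF signed_measure_uminus[OF \<nu>]] show ?thesis by (simp add: variation_def)
qed

text \<open>A nonzero even shift moves (-1,1) into |t| > 1, which the inversion \<open>J\<close>
  sends into |y| < \<gamma>. Thus \<kappa> on \<open>A\<close> is controlled by the inverted measure
  \<kappa>' on the Gauss preimage, and \<kappa>' by \<kappa>; their sum \<open>H\<close> obeys an
  estimate that can be iterated.\<close>

lemma signed_measure_eq_0:
  fixes \<kappa> :: "real set \<Rightarrow> real"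
  assumes \<kappa>: "signed_measure \<kappa>" and \<gamma>: "0 < \<gamma>" "\<gamma> \<le> 1"
    and ac: "\<And>N. N \<in> null_sets lborel \<Longrightarrow> \<kappa> N = 0"
    and per: "\<And>A. A \<in> sets borel \<Longrightarrow> A \<subseteq> {-1<..<1} \<Longrightarrow> \<kappa> (mod_2 A) = 0"
    and per': "\<And>A. A \<in> sets borel \<Longrightarrow> A \<subseteq> {-1<..<1} \<Longrightarrow> \<kappa> ((\<lambda>t. - \<gamma> / t) -` mod_2 A) = 0"
    and A: "A \<in> sets borel"
  shows "\<kappa> A = 0"
proof -
  \<comment> \<open>Division by 0 gives \<open>J 0 = 0\<close>, so \<open>J\<close> is an involution
    of the whole line.\<close>
  define J where "J t = - \<gamma> / t" for t :: real
  have J: "J \<in> borel_measurable borel" unfolding J_def[abs_def] by measurable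
  have JJ: "J (J t) = t" for t using \<gamma> by (simp add: J_def)
  have JV: "J -` (J -` A) = A" for A using JJ by auto
  have Jm: "J -` A \<in> sets borel" if "A \<in> sets borel" for A using measurable_sets[OF J that] by simp
  define \<kappa>' where "\<kappa>' A = \<kappa> (J -` A)" for A
  have \<kappa>': "signed_measure \<kappa>'" unfolding \<kappa>'_def by (rule signed_measure_vimage[OF \<kappa> J])
  have var': "variation \<kappa>' A = variation \<kappa> (J -` A)" if "A \<in> sets borel" for A
    unfolding \<kappa>'_def by (rule variation_vimage_involution[OF \<kappa> J JJ that])
  have null': "J -` N \<in> null_sets lborel" if N: "N \<in> null_sets lborel" for N
  proof -
    have NB: "N \<in> sets borel" using N by auto
    \<comment> \<open>The origin, where \<open>J\<close> is not differentiable, is split off and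
      restored as a null point.\<close>
    have "J -` N - {0} \<in> null_sets lborel"
    proof (rule null_sets_lborel_differentiable_image[OF N])
      show "J differentiable_on (N - {0})"
        unfolding J_def[abs_def] by (auto simp: differentiable_on_def intro!: derivative_intros)
      show "J -` N - {0} \<subseteq> J ` (N - {0})"
      proof
        fix t assume "t \<in> J -` N - {0}"
        then have "J t \<in> N - {0}" using \<gamma> by (auto simp: J_def)
        then show "t \<in> J ` (N - {0})" using JJ[of t] by (metis imageI)
      qed
    qed (use Jm[OF NB] in auto)
    then have "insert 0 (J -` N - {0}) \<in> null_sets lborel" using null_sets.insert_in_sets by (metis insert_is_Un null_sets.Un finite_imp_null_set_lborel finite.emptyI finite_insert)
    then show ?thesis by (rule null_sets_subset) (use Jm[OF NB] in auto)
  qed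
  have ac': "\<kappa>' N = 0" if "N \<in> null_sets lborel" for N unfolding \<kappa>'_def by (rule ac[OF null'[OF that]])
  have var_null: "variation \<rho> N = 0"
    if \<rho>: "signed_measure \<rho>" "\<And>N. N \<in> null_sets lborel \<Longrightarrow> \<rho> N = 0" and N: "N \<in> null_sets lborel" for \<rho> :: "real set \<Rightarrow> real" and N
  proof (rule variation_eq_0[OF \<rho>(1)])
    show "\<rho> B = 0" if "B \<in> sets borel" "B \<subseteq> N" for B using that N by (intro \<rho>(2) null_sets_subset[OF N]) auto
  qed (use N in auto)
  have tend: "(\<lambda>n. variation \<rho> (B n)) \<longlonglongrightarrow> 0"
    if \<rho>: "signed_measure \<rho>" "\<And>N. N \<in> null_sets lborel \<Longrightarrow> \<rho> N = 0"
      and B: "\<And>n. B n \<in> sets borel" "\<And>n. emeasure lborel (B n) < \<infinity>" "summable (\<lambda>n. measure lborel (B n))" for \<rho> :: "real set \<Rightarrow> real" and B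
  proof -
    have "(\<lambda>n. measure (pos_variation \<sigma>) (B n)) \<longlonglongrightarrow> 0" if \<sigma>: "signed_measure \<sigma>" "\<And>N. N \<in> null_sets lborel \<Longrightarrow> \<sigma> N = 0" for \<sigma> :: "real set \<Rightarrow> real"
    proof (rule measure_tendsto_0_if_summable[OF finite_measure_pos_variation[OF \<sigma>(1)], of lborel])
      fix N :: "real set" assume N: "N \<in> null_sets lborel"
      interpret finite_measure "pos_variation \<sigma>" by (rule finite_measure_pos_variation) fact
      have "variation \<sigma> N = 0" by (rule var_null[OF \<sigma> N])
      then have "measure (pos_variation \<sigma>) N = 0"
        using measure_nonneg[of "pos_variation \<sigma>" N] measure_nonneg[of "pos_variation (\<lambda>B. - \<sigma> B)" N]
        unfolding variation_def by linarith
      then show "emeasure (pos_variation \<sigma>) N = 0" by (simp add: emeasure_eq_measure)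
    qed (use B in auto)
    from tendsto_add[OF this[OF \<rho>] this[OF signed_measure_uminus[OF \<rho>(1)]]] \<rho>(2) show ?thesis
      by (simp add: variation_def)
  qed
  define H where "H A = variation \<kappa> A + variation \<kappa>' A" for A
  have step: "H A \<le> H (gauss_preimage \<gamma> A)" if A: "A \<in> sets borel" "A \<subseteq> {-1<..<1}" for A
  proof -
    have sub: "mod_2 A - A \<subseteq> J -` gauss_preimage \<gamma> A"
    proof
      fix t assume t: "t \<in> mod_2 A - A"
      then have "\<bar>t\<bar> > 1" using mod_2_diff[OF A(2)] by auto
      then have "J t \<noteq> 0" "\<bar>J t\<bar> < \<gamma>" using \<gamma> by (auto simp: J_def divide_less_eq)
      moreover have "- \<gamma> / J t = t" using JJ[of t] by (simp add: J_def)
      ultimately show "t \<in> J -` gauss_preimage \<gamma> A" using t by (simp add: gauss_preimage_def mod_2_def)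
    qed
    have m: "gauss_preimage \<gamma> A \<in> sets borel" using A by simp
    have "variation \<kappa> A \<le> variation \<kappa> (mod_2 A - A)" by (rule variation_mod_2_le[OF \<kappa> A per])
    also have "\<dots> \<le> variation \<kappa> (J -` gauss_preimage \<gamma> A)" by (rule variation_mono[OF \<kappa> sub Jm[OF m]])
    also have "\<dots> = variation \<kappa>' (gauss_preimage \<gamma> A)" by (rule var'[OF m, symmetric])
    finally have 1: "variation \<kappa> A \<le> variation \<kappa>' (gauss_preimage \<gamma> A)" .
    have "variation \<kappa>' A \<le> variation \<kappa>' (mod_2 A - A)"
      by (rule variation_mod_2_le[OF \<kappa>' A]) (unfold \<kappa>'_def J_def[abs_def], rule per')
    also have "\<dots> \<le> variation \<kappa>' (J -` gauss_preimage \<gamma> A)" by (rule variation_mono[OF \<kappa>' sub Jm[OF m]])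
    also have "\<dots> = variation \<kappa> (gauss_preimage \<gamma> A)" using var'[OF Jm[OF m]] by (simp add: JV)
    finally show ?thesis using 1 by (simp add: H_def)
  qed
  have iter: "H A \<le> H ((gauss_preimage \<gamma> ^^ k) A)" if A: "A \<in> sets borel" "A \<subseteq> {-1<..<1}" for A k
  proof (induction k)
    case (Suc k)
    then show ?case using step[of "(gauss_preimage \<gamma> ^^ k) A"] gauss_preimage_power[OF \<gamma> A, of k] by simp
  qed simp
  have H0: "H A = 0" if a: "0 \<le> a" "a < 1" and A: "A \<in> sets borel" "A \<subseteq> {- a..a}" for a A
  proof -
    have A1: "A \<subseteq> {-1<..<1}" using A a by auto
    \<comment> \<open>The decay has no rate, so a subsequence of iterates is chosen whose lengths
      are below a summable geometric sequence.\<close>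
    have "\<exists>k. emeasure lborel ((gauss_preimage \<gamma> ^^ k) A) < ennreal ((1/2) ^ n)" for n
      using order_tendstoD(2)[OF emeasure_gauss_preimage_power_tendsto_0[OF \<gamma> a A], of "ennreal ((1/2) ^ n)"]
      by (auto simp: eventually_sequentially)
    then obtain f where f: "\<And>n. emeasure lborel ((gauss_preimage \<gamma> ^^ f n) A) < ennreal ((1/2) ^ n)" by metis
    define B where "B n = (gauss_preimage \<gamma> ^^ f n) A" for n
    have Bm: "B n \<in> sets borel" for n using gauss_preimage_power[OF \<gamma> A(1) A1] by (simp add: B_def)
    have Bfin: "emeasure lborel (B n) < \<infinity>" for n using less_trans[OF f[of n], of top] by (simp add: B_def)
    have "measure lborel (B n) \<le> (1/2) ^ n" for n
      using f[of n] unfolding B_def[symmetric] measure_def by (intro enn2real_leI) (auto intro: less_imp_le)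
    then have Bs: "summable (\<lambda>n. measure lborel (B n))"
      by (intro summable_comparison_test'[OF summable_geometric[of "1/2 :: real"], of 0]) auto
    have "(\<lambda>n. H (B n)) \<longlonglongrightarrow> 0 + 0"
      unfolding H_def by (intro tendsto_add tend \<kappa> \<kappa>' ac ac' Bm Bfin Bs)
    then have "H A \<le> 0 + 0"
      by (rule LIMSEQ_le_const) (use iter[OF A(1) A1] in \<open>auto simp: B_def\<close>)
    then show ?thesis unfolding H_def using variation_nonneg[of \<kappa> A] variation_nonneg[of \<kappa>' A] by linarith
  qed
  have I: "{-1<..<1} = (\<Union>n. {- (1 - 1 / real (Suc n))..1 - 1 / real (Suc n)})"
  proof (intro equalityI subsetI)
    fix x :: real assume x: "x \<in> {-1<..<1}"
    then have "0 < 1 - \<bar>x\<bar>" by auto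
    then obtain n where "inverse (real (Suc n)) < 1 - \<bar>x\<bar>" using reals_Archimedean by blast
    then show "x \<in> (\<Union>n. {- (1 - 1 / real (Suc n))..1 - 1 / real (Suc n)})"
      by (auto simp: inverse_eq_divide intro!: exI[of _ n])
  next
    fix x :: real assume "x \<in> (\<Union>n. {- (1 - 1 / real (Suc n))..1 - 1 / real (Suc n)})"
    then obtain n where "- (1 - 1 / real (Suc n)) \<le> x" "x \<le> 1 - 1 / real (Suc n)" by auto
    moreover have "0 < 1 / real (Suc n)" by simp
    ultimately show "x \<in> {-1<..<1}" unfolding greaterThanLessThan_iff by linarith
  qed
  have "variation \<kappa> {- (1 - 1 / real (Suc n))..1 - 1 / real (Suc n)} = 0 \<and> variation \<kappa>' {- (1 - 1 / real (Suc n))..1 - 1 / real (Suc n)} = 0" for n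
    using H0[of "1 - 1 / real (Suc n)" "{- (1 - 1 / real (Suc n))..1 - 1 / real (Suc n)}"]
      variation_nonneg[of \<kappa> "{- (1 - 1 / real (Suc n))..1 - 1 / real (Suc n)}"]
      variation_nonneg[of \<kappa>' "{- (1 - 1 / real (Suc n))..1 - 1 / real (Suc n)}"]
    unfolding H_def by (auto simp: add_nonneg_eq_0_iff)
  then have "variation \<kappa> {-1<..<1} = 0" and v': "variation \<kappa>' {-1<..<1} = 0"
    unfolding I by (intro variation_UN_eq_0 \<kappa> \<kappa>'; simp)+
  \<comment> \<open>Beyond [-1,1] the measure is seen through \<open>J\<close>, which maps |t| > 1
    into (-1,1), where \<kappa>' already vanishes. The two endpoints are a null set.\<close>
  moreover have "variation \<kappa> (J -` {-1<..<1}) = 0" using v' by (subst var'[symmetric]) auto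
  moreover have "variation \<kappa> {-1, 1} = 0" by (rule var_null[OF \<kappa> ac]) (auto intro: finite_imp_null_set_lborel)
  ultimately have "variation \<kappa> ({-1<..<1} \<union> J -` {-1<..<1} \<union> {-1, 1}) = 0"
    using Jm[of "{-1<..<1}"] by (intro variation_Un_eq_0 \<kappa>) auto
  moreover have "{-1<..<1} \<union> J -` {-1<..<1} \<union> {-1, 1} = UNIV"
  proof -
    have "\<bar>J t\<bar> < 1" if "\<bar>t\<bar> > 1" for t using that \<gamma> by (auto simp: J_def divide_less_eq)
    then have "J t \<in> {-1<..<1}" if "\<bar>t\<bar> > 1" for t using that by (auto simp: abs_less_iff dest!: minus_less_iff[THEN iffD1])
    moreover have "t \<in> {-1<..<1} \<or> t \<in> {-1, 1} \<or> \<bar>t\<bar> > 1" for t :: real by auto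
    ultimately show ?thesis by blast
  qed
  ultimately have "variation \<kappa> UNIV = 0" by simp
  then show ?thesis
    using abs_le_variation[OF \<kappa> A] variation_mono[OF \<kappa>, of A UNIV] by simp
qed

section \<open>Measures on the hyperbola\<close>

text \<open>Arc length has a density with respect to Lebesgue measure in the parameter, so a null
  set of parameters suffices. The parameter 0 is removed because it corresponds to no point of the
  curve when \<open>m\<close> is nonzero.\<close>

lemma null_sets_arc_length_measure:
  assumes S: "S \<in> sets borel" and N: "{t. hyperbola_param m t \<in> S} - {0} \<in> null_sets lborel"
  shows "S \<in> null_sets (arc_length_measure m)"
proof -
  let ?R = "restrict_space lborel (- {0::real})"
  have "hyperbola_param m -` S \<inter> space ?R = {t. hyperbola_param m t \<in> S} - {0}"
    by (auto simp: space_restrict_space)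
  moreover have "{t. hyperbola_param m t \<in> S} - {0} \<in> null_sets ?R"
    using N by (subst null_sets_restrict_space) auto
  moreover have "absolutely_continuous ?R (density ?R (\<lambda>t. ennreal (norm (vector_derivative (hyperbola_param m) (at t)))))"
    by (rule absolutely_continuousI_density[OF measurable_hyperbola_speed])
  ultimately have "hyperbola_param m -` S \<inter> space ?R \<in> null_sets (density ?R (\<lambda>t. ennreal (norm (vector_derivative (hyperbola_param m) (at t)))))"
    unfolding absolutely_continuous_def by auto
  then show ?thesis
    unfolding arc_length_measure_def using S measurable_hyperbola_param[of m]
    by (subst null_sets_distr_iff) (auto simp: measurable_cong_sets[OF sets_density refl])
qed

lemma complex_signed_measures:
  assumes "complex_borel_measure \<mu>"
  shows "signed_measure (\<lambda>A. Re (\<mu> A))" "signed_measure (\<lambda>A. Im (\<mu> A))"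
proof -
  have sums: "(\<lambda>i. \<mu> (A i)) sums \<mu> (\<Union>i. A i)"
    if "range A \<subseteq> sets borel" "disjoint_family A" for A :: "nat \<Rightarrow> 'a set"
    using assms that unfolding complex_borel_measure_def by blast
  have "\<mu> {} = 0" using assms by (simp add: complex_borel_measure_def)
  then show "signed_measure (\<lambda>A. Re (\<mu> A))" "signed_measure (\<lambda>A. Im (\<mu> A))"
    unfolding signed_measure_def by (simp_all add: sums_Re[OF sums] sums_Im[OF sums])
qed

text \<open>Since \<open>j\<close> runs over all integers, conjugating the equation at
  \<open>- j\<close> gives the equation at \<open>j\<close> with the sign of the imaginary part's
  contribution reversed. Adding and subtracting decouples the real and imaginary parts of
  \<mu>.\<close>

lemma integral_pos_variation_cis_eq:
  assumes ft: "\<And>j::int. complex_measure_integral \<mu> (\<lambda>x. cis (of_int j * (pi * u x))) = 0"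
  shows "(\<integral>x. cis (of_int j * (pi * u x)) \<partial>pos_variation (\<lambda>A. Re (\<mu> A))) =
           (\<integral>x. cis (of_int j * (pi * u x)) \<partial>pos_variation (\<lambda>A. - Re (\<mu> A)))" (is "?a j = ?b j")
    and "(\<integral>x. cis (of_int j * (pi * u x)) \<partial>pos_variation (\<lambda>A. Im (\<mu> A))) =
           (\<integral>x. cis (of_int j * (pi * u x)) \<partial>pos_variation (\<lambda>A. - Im (\<mu> A)))" (is "?c j = ?d j")
proof -
  have cnj: "(\<integral>x. cis (of_int (- j) * (pi * u x)) \<partial>M) = cnj (\<integral>x. cis (of_int j * (pi * u x)) \<partial>M)" for M
  proof -
    have "cis (of_int (- j) * (pi * u x)) = cnj (cis (of_int j * (pi * u x)))" for x by (simp add: cis_cnj)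
    then show ?thesis by (simp only: Bochner_Integration.integral_cnj)
  qed
  have 1: "(?a j - ?b j) + \<i> * (?c j - ?d j) = 0"
    using ft[of j] by (simp add: complex_measure_integral_def)
  have "cnj ((cnj (?a j) - cnj (?b j)) + \<i> * (cnj (?c j) - cnj (?d j))) = 0"
    using ft[of "- j"] unfolding complex_measure_integral_def cnj by simp
  then have 2: "(?a j - ?b j) - \<i> * (?c j - ?d j) = 0" by simp
  have "2 * (?a j - ?b j) = 0" using arg_cong2[OF 1 2, of "(+)"] by simp
  then show "?a j = ?b j" by simp
  then show "?c j = ?d j" using 1 by simp
qed

text \<open>The moments force the positive and negative variations to agree on the preimage of A +
  2Z, and \<nu> is their difference.\<close>

lemma signed_measure_mod_2_eq_0:
  assumes \<nu>: "signed_measure \<nu>" and u: "u \<in> borel_measurable borel"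
    and moments: "\<And>j::int. (\<integral>x. cis (of_int j * (pi * u x)) \<partial>pos_variation \<nu>) =
           (\<integral>x. cis (of_int j * (pi * u x)) \<partial>pos_variation (\<lambda>A. - \<nu> A))"
    and A: "A \<in> sets borel" "A \<subseteq> {-1<..<1}"
  shows "\<nu> (u -` mod_2 A) = 0"
proof -
  have e: "u -` mod_2 A = {x. \<exists>j::int. u x - 2 * of_int j \<in> A}" by (auto simp: mod_2_def)
  have "emeasure (pos_variation \<nu>) {x. \<exists>j::int. u x - 2 * of_int j \<in> A} =
      emeasure (pos_variation (\<lambda>A. - \<nu> A)) {x. \<exists>j::int. u x - 2 * of_int j \<in> A}"
    by (rule emeasure_mod_2_eq[OF finite_measure_pos_variation[OF \<nu>] finite_measure_pos_variation[OF signed_measure_uminus[OF \<nu>]]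
          sets_pos_variation sets_pos_variation u moments A])
  moreover have "u -` mod_2 A \<in> sets borel" using measurable_sets[OF u, of "mod_2 A"] A by simp
  ultimately show ?thesis using jordan_decomposition[OF \<nu>, of "u -` mod_2 A"] by (simp add: e measure_def)
qed

lemma signed_measure_hyperbola_eq_0:
  assumes \<nu>: "signed_measure \<nu>" and pos: "\<alpha> > 0" "\<beta> > 0" "m > 0" and small: "\<alpha> * \<beta> * m\<^sup>2 \<le> 4 * pi\<^sup>2"
    and supp: "\<And>A. A \<in> sets borel \<Longrightarrow> A \<inter> hyperbola m = {} \<Longrightarrow> \<nu> A = 0"
    and ac: "\<And>A. A \<in> null_sets (arc_length_measure m) \<Longrightarrow> \<nu> A = 0"
    and per1: "\<And>A. A \<in> sets borel \<Longrightarrow> A \<subseteq> {-1<..<1} \<Longrightarrow> \<nu> ((\<lambda>x. \<alpha> * fst x) -` mod_2 A) = 0"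
    and per2: "\<And>A. A \<in> sets borel \<Longrightarrow> A \<subseteq> {-1<..<1} \<Longrightarrow> \<nu> ((\<lambda>x. \<beta> * snd x) -` mod_2 A) = 0"
    and B: "B \<in> sets borel"
  shows "\<nu> B = 0"
proof -
  define c where "c = m\<^sup>2 / (4 * pi\<^sup>2)"
  define \<gamma> where "\<gamma> = \<alpha> * \<beta> * c"
  define u where "u x = \<alpha> * fst x" for x :: "real \<times> real"
  have c: "c > 0" using pos by (simp add: c_def)
  have \<gamma>: "0 < \<gamma>" "\<gamma> \<le> 1" using pos c small by (auto simp: \<gamma>_def c_def field_simps)
  have fst_m: "fst \<in> borel_measurable (borel :: (real \<times> real) measure)" and snd_m: "snd \<in> borel_measurable (borel :: (real \<times> real) measure)"
    by (intro borel_measurable_continuous_onI continuous_intros)+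
  have u: "u \<in> borel_measurable borel" unfolding u_def[abs_def] using fst_m by measurable
  have v: "(\<lambda>x. \<beta> * snd x) \<in> borel_measurable (borel :: (real \<times> real) measure)" using snd_m by measurable
  have vm: "u -` A \<in> sets borel" if "A \<in> sets borel" for A using measurable_sets[OF u that] by simp
  have hyp: "x \<in> hyperbola m \<longleftrightarrow> fst x \<noteq> 0 \<and> snd x = - c / fst x" for x
  proof -
    have "x \<in> hyperbola m \<longleftrightarrow> fst x * snd x = - c" by (cases x) (simp add: hyperbola_def c_def)
    also have "a * b = - c \<longleftrightarrow> a \<noteq> 0 \<and> b = - c / a" for a b
    proof
      assume ab: "a * b = - c"
      then have "a \<noteq> 0" using c by auto
      moreover from this have "b = (a * b) / a" by simp
      ultimately show "a \<noteq> 0 \<and> b = - c / a" unfolding ab by simp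
    qed simp
    finally show ?thesis .
  qed
  \<comment> \<open>\<nu> sees only the trace of a set on the hyperbola, so conditions on the two
    coordinates may be exchanged when they agree on the curve.\<close>
  have cong: "\<nu> S = \<nu> S'" if "S \<in> sets borel" "S' \<in> sets borel" "S \<inter> hyperbola m = S' \<inter> hyperbola m" for S S'
  proof -
    have split: "\<nu> S = \<nu> (S - S') + \<nu> (S \<inter> S')" if "S \<in> sets borel" "S' \<in> sets borel" for S S'
    proof -
      have "\<nu> ((S - S') \<union> (S \<inter> S')) = \<nu> (S - S') + \<nu> (S \<inter> S')"
        using that by (intro signed_measure_Un[OF \<nu>]) auto
      moreover have "(S - S') \<union> (S \<inter> S') = S" by auto
      ultimately show ?thesis by simp
    qed
    have "\<nu> (S - S') = 0" "\<nu> (S' - S) = 0" using that by (auto intro!: supp)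
    then show ?thesis using split[of S S'] split[of S' S] that(1,2) by (simp add: Int_commute)
  qed
  define \<kappa> where "\<kappa> A = \<nu> (u -` A)" for A
  have \<kappa>: "signed_measure \<kappa>" unfolding \<kappa>_def by (rule signed_measure_vimage[OF \<nu> u])
  have zero: "\<kappa> A = 0" if "A \<in> sets borel" for A
  proof (rule signed_measure_eq_0[OF \<kappa> \<gamma> _ _ _ that])
    fix N :: "real set" assume N: "N \<in> null_sets lborel"
    then have NB: "N \<in> sets borel" by auto
    show "\<kappa> N = 0"
      unfolding \<kappa>_def
    proof (rule ac, rule null_sets_arc_length_measure[OF vm[OF NB]])
      have e: "{t. hyperbola_param m t \<in> u -` N} = (\<lambda>t. \<alpha> * t) -` N" by (auto simp: u_def hyperbola_param_def)
      have m: "(\<lambda>t. \<alpha> * t) -` N \<in> sets borel"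
        using measurable_sets[of "\<lambda>t. \<alpha> * t" borel borel N] NB by simp
      show "{t. hyperbola_param m t \<in> u -` N} - {0} \<in> null_sets lborel"
        unfolding e
      proof (rule null_sets_lborel_differentiable_image[OF N])
        show "(\<lambda>s. s / \<alpha>) differentiable_on N" using pos by (auto simp: differentiable_on_def intro!: derivative_intros)
        show "(\<lambda>t. \<alpha> * t) -` N - {0} \<subseteq> (\<lambda>s. s / \<alpha>) ` N"
        proof
          fix t assume "t \<in> (\<lambda>t. \<alpha> * t) -` N - {0}"
          then have "\<alpha> * t \<in> N" by simp
          moreover have "t = \<alpha> * t / \<alpha>" using pos by simp
          ultimately show "t \<in> (\<lambda>s. s / \<alpha>) ` N" by blast
        qed
      qed (use m in auto)
    qed
  next
    fix A :: "real set" assume "A \<in> sets borel" "A \<subseteq> {-1<..<1}"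
    then show "\<kappa> (mod_2 A) = 0" using per1 by (simp add: \<kappa>_def u_def[abs_def])
  next
    fix A :: "real set" assume A: "A \<in> sets borel" "A \<subseteq> {-1<..<1}"
    have "(\<lambda>t. - \<gamma> / t) -` mod_2 A \<in> sets borel"
      using measurable_sets[of "\<lambda>t. - \<gamma> / t" borel borel "mod_2 A"] A by simp
    then have "\<kappa> ((\<lambda>t. - \<gamma> / t) -` mod_2 A) = \<nu> ((\<lambda>x. \<beta> * snd x) -` mod_2 A)"
      unfolding \<kappa>_def
    proof (intro cong vm)
      show "(\<lambda>x. \<beta> * snd x) -` mod_2 A \<in> sets (borel :: (real \<times> real) measure)" using measurable_sets[OF v, of "mod_2 A"] A by simp
      have "- \<gamma> / u x = \<beta> * snd x" if "x \<in> hyperbola m" for x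
        using that pos by (auto simp: hyp u_def \<gamma>_def)
      then show "u -` (\<lambda>t. - \<gamma> / t) -` mod_2 A \<inter> hyperbola m = (\<lambda>x. \<beta> * snd x) -` mod_2 A \<inter> hyperbola m" by auto
    qed
    then show "\<kappa> ((\<lambda>t. - \<gamma> / t) -` mod_2 A) = 0" using per2[OF A] by simp
  qed
  \<comment> \<open>\<open>B\<close> expressed in the coordinate \<open>u\<close>, which is
    injective on the curve; the preimage of \<open>A\<close> under \<open>u\<close> has the same
    trace as \<open>B\<close>.\<close>
  define A where "A = {t. hyperbola_param m (t / \<alpha>) \<in> B}"
  have A: "A \<in> sets borel"
  proof -
    have "(\<lambda>t. hyperbola_param m (t / \<alpha>)) \<in> borel_measurable borel"
      unfolding hyperbola_param_def[abs_def] by measurable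
    from measurable_sets[OF this B] show ?thesis by (simp add: A_def vimage_def)
  qed
  have "hyperbola_param m (u x / \<alpha>) = x" if "x \<in> hyperbola m" for x
    using that pos by (cases x) (auto simp: hyp hyperbola_param_def u_def c_def)
  then have "\<nu> B = \<kappa> A"
    unfolding \<kappa>_def by (intro cong B vm A) (auto simp: A_def)
  then show ?thesis using zero[OF A] by simp
qed

lemma fourier_uniqueness_set_absolutely_continuous:
  assumes pos: "\<alpha> > 0" "\<beta> > 0" "m > 0" and small: "\<alpha> * \<beta> * m\<^sup>2 \<le> 4 * pi\<^sup>2"
    and \<mu>: "\<mu> \<in> measures_on (hyperbola m)" and ac: "absolutely_continuous_wrt \<mu> (arc_length_measure m)"
    and ft: "\<And>\<xi>. \<xi> \<in> lattice_cross \<alpha> \<beta> \<Longrightarrow> fourier_transform \<mu> \<xi> = 0"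
  shows "\<mu> = (\<lambda>_. 0)"
proof
  fix B :: "(real \<times> real) set"
  have cm: "complex_borel_measure \<mu>" and supp: "\<And>A. A \<in> sets borel \<Longrightarrow> A \<inter> hyperbola m = {} \<Longrightarrow> \<mu> A = 0"
    using \<mu> by (auto simp: measures_on_def)
  have fst_m: "fst \<in> borel_measurable (borel :: (real \<times> real) measure)" and snd_m: "snd \<in> borel_measurable (borel :: (real \<times> real) measure)"
    by (intro borel_measurable_continuous_onI continuous_intros)+
  have u: "(\<lambda>x. \<alpha> * fst x) \<in> borel_measurable (borel :: (real \<times> real) measure)" using fst_m by measurable
  have v: "(\<lambda>x. \<beta> * snd x) \<in> borel_measurable (borel :: (real \<times> real) measure)" using snd_m by measurable
  have cis_exp: "exp (\<i> * complex_of_real (pi * (x \<bullet> (\<alpha> * of_int j, 0)))) = cis (of_int j * (pi * (\<alpha> * fst x)))"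
    "exp (\<i> * complex_of_real (pi * (x \<bullet> (0, \<beta> * of_int j)))) = cis (of_int j * (pi * (\<beta> * snd x)))" for x :: "real \<times> real" and j :: int
    by (cases x; simp add: cis_conv_exp mult_ac)+
  have 1: "complex_measure_integral \<mu> (\<lambda>x. cis (of_int j * (pi * (\<alpha> * fst x)))) = 0" for j :: int
    using ft[of "(\<alpha> * of_int j, 0)"] unfolding fourier_transform_def cis_exp lattice_cross_def by blast
  have 2: "complex_measure_integral \<mu> (\<lambda>x. cis (of_int j * (pi * (\<beta> * snd x)))) = 0" for j :: int
    using ft[of "(0, \<beta> * of_int j)"] unfolding fourier_transform_def cis_exp lattice_cross_def by blast
  note sm = complex_signed_measures[OF cm]
  show "\<mu> B = 0"
  proof (cases "B \<in> sets borel")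
    case True
    have "Re (\<mu> B) = 0"
      by (rule signed_measure_hyperbola_eq_0[OF sm(1) pos small _ _ _ _ True])
        (use supp ac in \<open>auto simp: absolutely_continuous_wrt_def
           intro!: signed_measure_mod_2_eq_0[OF sm(1) u integral_pos_variation_cis_eq(1)[OF 1]]
             signed_measure_mod_2_eq_0[OF sm(1) v integral_pos_variation_cis_eq(1)[OF 2]]\<close>)
    moreover have "Im (\<mu> B) = 0"
      by (rule signed_measure_hyperbola_eq_0[OF sm(2) pos small _ _ _ _ True])
        (use supp ac in \<open>auto simp: absolutely_continuous_wrt_def
           intro!: signed_measure_mod_2_eq_0[OF sm(2) u integral_pos_variation_cis_eq(2)[OF 1]]
             signed_measure_mod_2_eq_0[OF sm(2) v integral_pos_variation_cis_eq(2)[OF 2]]\<close>)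
    ultimately show ?thesis by (simp add: complex_eq_iff)
  next
    case False
    then show ?thesis using cm by (simp add: complex_borel_measure_def)
  qed
qed

section \<open>Integrals of functions holomorphic in the upper half-plane\<close>

text \<open>Cauchy's theorem on the triangle with vertices -n, n and in. On the slanted sides |z| is
  at least n/sqrt 2, so each contributes at most
  \<open>(2 * |C| / n^2) * 2 * n = 4 * |C| / n\<close>.\<close>

lemma half_plane_integral_eq_0:
  fixes G :: "complex \<Rightarrow> complex"
  assumes hol: "G holomorphic_on {z. 0 \<le> Im z}"
    and decay: "\<And>z. 0 \<le> Im z \<Longrightarrow> R0 \<le> norm z \<Longrightarrow> norm (G z) \<le> C / (norm z)\<^sup>2"
    and int: "integrable lborel (\<lambda>x. G (complex_of_real x))"
  shows "(\<integral>x. G (complex_of_real x) \<partial>lborel) = 0"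
proof -
  let ?I = "\<lambda>n::nat. integral {- real n..real n} (\<lambda>x. G (complex_of_real x))"
  have conv: "(\<lambda>n. \<integral>x. indicator {- real n..real n} x *\<^sub>R G (complex_of_real x) \<partial>lborel)
      \<longlonglongrightarrow> (\<integral>x. G (complex_of_real x) \<partial>lborel)"
  proof (rule integral_dominated_convergence[where w="\<lambda>x. norm (G (complex_of_real x))"])
    show "AE x in lborel. (\<lambda>n. indicator {- real n..real n} x *\<^sub>R G (complex_of_real x)) \<longlonglongrightarrow> G (complex_of_real x)"
    proof (rule AE_I2)
      fix x :: real
      have "\<forall>\<^sub>F n in sequentially. indicator {- real n..real n} x *\<^sub>R G (complex_of_real x) = G (complex_of_real x)"
      proof (rule eventually_sequentiallyI[of "nat \<lceil>\<bar>x\<bar>\<rceil>"])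
        fix n :: nat assume "n \<ge> nat \<lceil>\<bar>x\<bar>\<rceil>"
        then have "\<bar>x\<bar> \<le> real n" by linarith
        then show "indicator {- real n..real n} x *\<^sub>R G (complex_of_real x) = G (complex_of_real x)"
          by (auto simp: indicator_def abs_le_iff)
      qed
      then show "(\<lambda>n. indicator {- real n..real n} x *\<^sub>R G (complex_of_real x)) \<longlonglongrightarrow> G (complex_of_real x)"
        by (rule tendsto_eventually)
    qed
  qed (use int in \<open>auto simp: indicator_def\<close>)
  have eq: "(\<integral>x. indicator {- real n..real n} x *\<^sub>R G (complex_of_real x) \<partial>lborel) = ?I n" for n
  proof -
    have "set_integrable lborel {- real n..real n} (\<lambda>x. G (complex_of_real x))"
      using set_integrable_subset[of lborel UNIV "\<lambda>x. G (complex_of_real x)" "{- real n..real n}"] int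
      by (simp add: set_integrable_def)
    from set_borel_integral_eq_integral(2)[OF this] show ?thesis
      by (simp add: set_lebesgue_integral_def)
  qed
  have bound: "norm (?I n) \<le> 8 * \<bar>C\<bar> / real n" if n: "n > 0" "2 * R0 \<le> real n" for n
  proof -
    define a b c where "a = complex_of_real (- real n)" and "b = complex_of_real (real n)" and "c = \<i> * complex_of_real (real n)"
    have sub: "convex hull {a, b, c} \<subseteq> {z. 0 \<le> Im z}"
      by (rule hull_minimal) (auto simp: a_def b_def c_def convex_halfspace_Im_ge)
    have "(G has_contour_integral 0) (linepath a b +++ linepath b c +++ linepath c a)"
      by (rule Cauchy_theorem_triangle) (rule holomorphic_on_subset[OF hol sub])
    then have sum0: "contour_integral (linepath a b) G + contour_integral (linepath b c) G + contour_integral (linepath c a) G = 0"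
      by (rule has_chain_integral_chain_integral3)
    have ab: "contour_integral (linepath a b) G = ?I n"
      using n by (subst contour_integral_linepath_Reals_eq) (auto simp: a_def b_def)
    have seg: "norm (contour_integral (linepath p q) G) \<le> 4 * \<bar>C\<bar> / real n"
      if pq: "p \<in> {a, b, c}" "q \<in> {a, b, c}" "norm (q - p) \<le> 2 * real n / sqrt 2"
        and far: "\<And>z. z \<in> closed_segment p q \<Longrightarrow> real n / sqrt 2 \<le> norm z" for p q
    proof -
      have s: "closed_segment p q \<subseteq> {z. 0 \<le> Im z}"
        using pq sub by (metis (no_types, lifting) closed_segment_subset convex_convex_hull hull_inc order_trans)
      have "(G has_contour_integral contour_integral (linepath p q) G) (linepath p q)"
        by (intro has_contour_integral_integral contour_integrable_continuous_linepath
            continuous_on_subset[OF holomorphic_on_imp_continuous_on[OF hol] s])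
      then have "norm (contour_integral (linepath p q) G) \<le> (2 * \<bar>C\<bar> / (real n)\<^sup>2) * norm (q - p)"
      proof (rule has_contour_integral_bound_linepath)
        fix z assume z: "z \<in> closed_segment p q"
        have z2: "(real n)\<^sup>2 / 2 \<le> (norm z)\<^sup>2"
          using power_mono[OF far[OF z], of 2] by (simp add: power_divide)
        have "real n / 2 \<le> real n / sqrt 2" by (intro divide_left_mono) (auto simp: real_le_lsqrt)
        then have "R0 \<le> real n / sqrt 2" using n by linarith
        then have "norm (G z) \<le> C / (norm z)\<^sup>2" using z s far[OF z] by (intro decay) auto
        also have "\<dots> \<le> \<bar>C\<bar> / (norm z)\<^sup>2" by (intro divide_right_mono) auto
        also have "\<dots> \<le> \<bar>C\<bar> / ((real n)\<^sup>2 / 2)" using z2 n order_less_le_trans[OF _ z2, of 0]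
          by (intro divide_left_mono mult_pos_pos) auto
        finally show "norm (G z) \<le> 2 * \<bar>C\<bar> / (real n)\<^sup>2" by (simp add: mult.commute)
      qed simp
      also have "\<dots> \<le> (2 * \<bar>C\<bar> / (real n)\<^sup>2) * (2 * real n)"
      proof (rule mult_left_mono)
        have "2 * real n / sqrt 2 \<le> 2 * real n / 1" by (intro divide_left_mono) auto
        then show "norm (q - p) \<le> 2 * real n" using pq by simp
      qed simp
      also have "\<dots> = 4 * \<bar>C\<bar> / real n" using n by (simp add: power2_eq_square)
      finally show ?thesis .
    qed
    \<comment> \<open>A point at parameter \<open>u\<close> of a slanted side has squared modulus
      \<open>n^2 * ((1 - u)^2 + u^2)\<close>.\<close>
    have half: "1 / 2 \<le> (1 - u)\<^sup>2 + u\<^sup>2" for u :: real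
      using zero_le_power2[of "2 * u - 1"] by (simp add: power2_eq_square algebra_simps)
    have nrm: "real n / sqrt 2 \<le> norm z" if "(real n)\<^sup>2 * ((1 - u)\<^sup>2 + u\<^sup>2) = (norm z)\<^sup>2" for z :: complex and u
    proof (rule power2_le_imp_le)
      show "(real n / sqrt 2)\<^sup>2 \<le> (norm z)\<^sup>2"
        unfolding that[symmetric] using mult_left_mono[OF half[of u], of "(real n)\<^sup>2"] by (simp add: power_divide)
    qed simp
    have len: "norm z \<le> 2 * real n / sqrt 2" if "(norm z)\<^sup>2 = 2 * (real n)\<^sup>2" for z :: complex
      by (rule power2_le_imp_le) (use that in \<open>auto simp: power_divide power_mult_distrib\<close>)
    have bc: "norm (contour_integral (linepath b c) G) \<le> 4 * \<bar>C\<bar> / real n"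
    proof (rule seg)
      show "norm (c - b) \<le> 2 * real n / sqrt 2" by (rule len) (simp add: b_def c_def cmod_power2)
      fix z assume "z \<in> closed_segment b c"
      then obtain u where z: "z = (1 - u) *\<^sub>R b + u *\<^sub>R c" by (auto simp: closed_segment_def)
      show "real n / sqrt 2 \<le> norm z"
        by (rule nrm[of u]) (simp only: cmod_power2, simp add: z b_def c_def power2_eq_square algebra_simps)
    qed auto
    have ca: "norm (contour_integral (linepath c a) G) \<le> 4 * \<bar>C\<bar> / real n"
    proof (rule seg)
      show "norm (a - c) \<le> 2 * real n / sqrt 2" by (rule len) (simp add: a_def c_def cmod_power2)
      fix z assume "z \<in> closed_segment c a"
      then obtain u where z: "z = (1 - u) *\<^sub>R c + u *\<^sub>R a" by (auto simp: closed_segment_def)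
      show "real n / sqrt 2 \<le> norm z"
        by (rule nrm[of u]) (simp only: cmod_power2, simp add: z a_def c_def power2_eq_square algebra_simps)
    qed auto
    have "?I n = - (contour_integral (linepath b c) G + contour_integral (linepath c a) G)"
      unfolding ab[symmetric] using sum0 by (metis add.assoc eq_neg_iff_add_eq_0)
    then have "norm (?I n) \<le> norm (contour_integral (linepath b c) G) + norm (contour_integral (linepath c a) G)"
      by (simp only: norm_minus_cancel norm_triangle_ineq)
    then show ?thesis using bc ca by simp
  qed
  have "?I \<longlonglongrightarrow> 0"
  proof (rule Lim_null_comparison)
    show "\<forall>\<^sub>F n in sequentially. norm (?I n) \<le> 8 * \<bar>C\<bar> / real n"
    proof (rule eventually_sequentiallyI[of "max 1 (nat \<lceil>2 * R0\<rceil>)"])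
      fix n assume "max 1 (nat \<lceil>2 * R0\<rceil>) \<le> n"
      then have "n > 0" "2 * R0 \<le> real n" by linarith+
      then show "norm (?I n) \<le> 8 * \<bar>C\<bar> / real n" by (rule bound)
    qed
    show "(\<lambda>n. 8 * \<bar>C\<bar> / real n) \<longlonglongrightarrow> 0" by (rule lim_const_over_n)
  qed
  with conv show ?thesis unfolding eq by (rule LIMSEQ_unique)
qed

text \<open>Each integral over a line at height y > 0 vanishes, and dominated convergence lets y
  tend to 0. No boundary value is required at the single point 0, where the functions used below may
  have an essential singularity.\<close>

lemma half_plane_boundary_integral_eq_0:
  fixes G :: "complex \<Rightarrow> complex" and g :: "real \<Rightarrow> complex"
  assumes hol: "G holomorphic_on {z. 0 < Im z}"
    and decay: "\<And>z. 0 < Im z \<Longrightarrow> R0 \<le> norm z \<Longrightarrow> norm (G z) \<le> C / (norm z)\<^sup>2"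
    and y0: "y0 > 0" and dom: "\<And>x y. 0 < y \<Longrightarrow> y < y0 \<Longrightarrow> norm (G (Complex x y)) \<le> w x"
    and w: "integrable lborel w" and g: "g \<in> borel_measurable borel"
    and lim: "\<And>x. x \<noteq> 0 \<Longrightarrow> ((\<lambda>y. G (Complex x y)) \<longlongrightarrow> g x) (at_right 0)"
  shows "(\<integral>x. g x \<partial>lborel) = 0"
proof -
  have cont: "continuous_on UNIV (\<lambda>x. G (Complex x y))" if "y > 0" for y
    by (rule continuous_on_compose2[OF holomorphic_on_imp_continuous_on[OF hol]])
      (use that in \<open>auto simp: Complex_eq intro!: continuous_intros\<close>)
  have meas: "(\<lambda>x. G (Complex x y)) \<in> borel_measurable borel" if "y > 0" for y
    using cont[OF that] by (rule borel_measurable_continuous_onI)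
  have zero: "(\<integral>x. G (Complex x y) \<partial>lborel) = 0" if y: "0 < y" "y < y0" for y
  proof -
    let ?H = "\<lambda>z. G (z + \<i> * complex_of_real y)"
    have e: "Complex x y = complex_of_real x + \<i> * complex_of_real y" for x by (simp add: Complex_eq)
    have "(\<integral>x. ?H (complex_of_real x) \<partial>lborel) = 0"
    proof (rule half_plane_integral_eq_0)
      show "?H holomorphic_on {z. 0 \<le> Im z}"
        by (rule holomorphic_on_compose_gen[OF _ hol, unfolded o_def]) (use y in \<open>auto intro!: holomorphic_intros\<close>)
      fix z assume z: "0 \<le> Im z" "max R0 1 \<le> norm z"
      have "(Im z)\<^sup>2 \<le> (Im z + y)\<^sup>2" using z y by (intro power_mono) auto
      then have "(norm z)\<^sup>2 \<le> (norm (z + \<i> * complex_of_real y))\<^sup>2" by (simp add: cmod_power2)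
      then have le: "norm z \<le> norm (z + \<i> * complex_of_real y)" by (rule power2_le_imp_le) simp
      have "z \<noteq> 0" using z by auto
      show "norm (?H z) \<le> \<bar>C\<bar> / (norm z)\<^sup>2"
      proof -
        have "norm (?H z) \<le> C / (norm (z + \<i> * complex_of_real y))\<^sup>2"
          using z y le by (intro decay) auto
        also have "\<dots> \<le> \<bar>C\<bar> / (norm (z + \<i> * complex_of_real y))\<^sup>2" by (intro divide_right_mono) auto
        also have "\<dots> \<le> \<bar>C\<bar> / (norm z)\<^sup>2" using le \<open>z \<noteq> 0\<close> by (intro divide_left_mono power_mono mult_pos_pos) auto
        finally show ?thesis .
      qed
    next
      show "integrable lborel (\<lambda>x. ?H (complex_of_real x))"
        unfolding e[symmetric]
        by (rule Bochner_Integration.integrable_bound[OF w])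
          (use meas dom[OF y] y in \<open>auto intro: order_trans[OF _ abs_ge_self]\<close>)
    qed
    then show ?thesis by (simp only: e)
  qed
  \<comment> \<open>A sequence of heights, as dominated convergence is sequential; the 2 keeps
    \<open>Y 0\<close> strictly below \<open>y0\<close>.\<close>
  define Y where "Y n = y0 / (real n + 2)" for n
  have Y: "0 < Y n" "Y n < y0" for n using y0 by (auto simp: Y_def divide_less_eq intro!: less_le_trans[of y0 "y0 * 2"] mult_left_mono)
  have Y0: "filterlim Y (at_right 0) sequentially"
    unfolding filterlim_at
  proof
    have "(\<lambda>n. y0 / real (n + 2)) \<longlonglongrightarrow> 0"
      by (rule LIMSEQ_ignore_initial_segment[OF lim_const_over_n])
    then show "Y \<longlonglongrightarrow> 0" by (simp add: Y_def[abs_def] add.commute)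
    show "\<forall>\<^sub>F n in sequentially. Y n \<in> {0<..} \<and> Y n \<noteq> 0" using Y(1) by (simp add: less_imp_neq[symmetric])
  qed
  have "(\<lambda>n. \<integral>x. G (Complex x (Y n)) \<partial>lborel) \<longlonglongrightarrow> (\<integral>x. g x \<partial>lborel)"
  proof (rule integral_dominated_convergence[OF _ _ w])
    show "AE x in lborel. (\<lambda>n. G (Complex x (Y n))) \<longlonglongrightarrow> g x"
      using AE_lborel_singleton[of 0] by eventually_elim (rule filterlim_compose[OF lim Y0])
    show "AE x in lborel. norm (G (Complex x (Y n))) \<le> w x" for n
      using dom[OF Y] by simp
  qed (use g meas Y in auto)
  then show ?thesis using zero Y by (simp add: LIMSEQ_const_iff)
qed

lemma integrable_inverse_shifted_square:
  fixes a d :: real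
  assumes "d > 0"
  shows "integrable lborel (\<lambda>x. 1 / ((x - a)\<^sup>2 + d\<^sup>2))"
proof -
  have "integrable lborel (\<lambda>x::real. inverse (1 + x\<^sup>2))"
    using integrable_inverse_1_plus_square by (simp add: set_integrable_def)
  then have "integrable lborel (\<lambda>x. inverse (1 + (- a / d + 1 / d * x)\<^sup>2))"
    by (rule lborel_integrable_real_affine) (use assms in simp)
  then have "integrable lborel (\<lambda>x. inverse (d\<^sup>2) * inverse (1 + (- a / d + 1 / d * x)\<^sup>2))"
    by (rule integrable_mult_right)
  moreover have "inverse (d\<^sup>2) * inverse (1 + (- a / d + 1 / d * x)\<^sup>2) = 1 / ((x - a)\<^sup>2 + d\<^sup>2)" for x
  proof -
    have "- a / d + 1 / d * x = (x - a) / d" by (simp add: diff_divide_distrib)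
    moreover have "d\<^sup>2 * (1 + ((x - a) / d)\<^sup>2) = (x - a)\<^sup>2 + d\<^sup>2"
      using assms by (simp add: power_divide field_simps)
    ultimately show ?thesis by (metis inverse_eq_divide inverse_mult_distrib)
  qed
  ultimately show ?thesis by (simp only:)
qed

section \<open>Complex measures given by a density\<close>

lemma set_lebesgue_integral_sums:
  fixes f :: "'a \<Rightarrow> 'b::{banach, second_countable_topology}"
  assumes "integrable M f" "range A \<subseteq> sets M" "disjoint_family A"
  shows "(\<lambda>i::nat. \<integral>x\<in>A i. f x \<partial>M) sums (\<integral>x\<in>(\<Union>i. A i). f x \<partial>M)"
proof -
  have sub: "set_integrable M B f" if "B \<in> sets M" for B
    using assms(1) that unfolding set_integrable_def by (rule integrable_mult_indicator[rotated])
  have A: "\<And>i. A i \<in> sets M" using assms(2) by auto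
  have "(\<integral>x\<in>(\<Union>i. A i). f x \<partial>M) = (\<Sum>i. \<integral>x\<in>A i. f x \<partial>M)"
    using assms(3) A by (intro lebesgue_integral_countable_add sub) (auto simp: disjoint_family_on_def)
  moreover have "summable (\<lambda>i. \<integral>x\<in>A i. f x \<partial>M)"
  proof (rule summable_norm_cancel, rule summable_comparison_test')
    have n: "integrable M (\<lambda>x. norm (f x))" using assms(1) by (rule integrable_norm)
    have s: "set_integrable M B (\<lambda>x. norm (f x))" if "B \<in> sets M" for B
      using n that unfolding set_integrable_def by (rule integrable_mult_indicator[rotated])
    show "summable (\<lambda>i. \<integral>x\<in>A i. norm (f x) \<partial>M)"
    proof (rule bounded_imp_summable)
      show "0 \<le> (\<integral>x\<in>A i. norm (f x) \<partial>M)" for i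
        unfolding set_lebesgue_integral_def by (rule Bochner_Integration.integral_nonneg) simp
      fix n
      have "(\<Sum>i\<le>n. \<integral>x\<in>A i. norm (f x) \<partial>M) = (\<integral>x\<in>(\<Union>i\<le>n. A i). norm (f x) \<partial>M)"
        using A assms(3) by (intro set_integral_finite_Union[symmetric] s) (auto intro: disjoint_family_on_mono)
      also have "\<dots> \<le> (\<integral>x. norm (f x) \<partial>M)"
        unfolding set_lebesgue_integral_def using A
        by (intro integral_mono n integrable_mult_indicator) (auto simp: indicator_def)
      finally show "(\<Sum>i\<le>n. \<integral>x\<in>A i. norm (f x) \<partial>M) \<le> (\<integral>x. norm (f x) \<partial>M)" .
    qed
    show "norm (norm (\<integral>x\<in>A i. f x \<partial>M)) \<le> (\<integral>x\<in>A i. norm (f x) \<partial>M)" for i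
      using integral_norm_bound[of M "\<lambda>x. indicator (A i) x *\<^sub>R f x"] by (simp add: set_lebesgue_integral_def)
  qed
  ultimately show ?thesis by (simp add: sums_iff)
qed

text \<open>The supremum defining the positive variation is attained on the part of \<open>A\<close>
  where \<open>R\<close> is nonnegative.\<close>

lemma pos_variation_density:
  fixes Q :: "'a::topological_space measure"
  assumes Q: "sets Q = sets borel" and R: "integrable Q R"
    and \<nu>: "\<And>A. A \<in> sets borel \<Longrightarrow> \<nu> A = (\<integral>x\<in>A. R x \<partial>Q)"
  shows "pos_variation \<nu> = density Q (\<lambda>x. ennreal (R x))"
proof (rule measure_eqI)
  have sp: "sets (pos_variation \<nu>) = sets borel"
    unfolding pos_variation_def using sets.sigma_sets_eq[of "borel :: 'a measure"] by (simp add: sets_measure_of)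
  then show "sets (pos_variation \<nu>) = sets (density Q (\<lambda>x. ennreal (R x)))" by (simp add: Q)
  have [measurable]: "R \<in> borel_measurable Q" using R by auto
  have S: "{x \<in> space Q. 0 \<le> R x} \<in> sets Q" by measurable
  have val: "ennreal (\<nu> B) = (\<integral>\<^sup>+x\<in>B. ennreal (R x) \<partial>Q)" if "B \<in> sets borel" "\<And>x. x \<in> B \<Longrightarrow> 0 \<le> R x" for B
  proof -
    have "integrable Q (\<lambda>x. indicator B x *\<^sub>R R x)" using R that Q by (intro integrable_mult_indicator) auto
    then have "(\<integral>\<^sup>+x. ennreal (indicator B x *\<^sub>R R x) \<partial>Q) = ennreal (\<integral>x. indicator B x *\<^sub>R R x \<partial>Q)"
      by (rule nn_integral_eq_integral) (use that in \<open>auto simp: indicator_def\<close>)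
    moreover have "ennreal (indicator B x *\<^sub>R R x) = ennreal (R x) * indicator B x" for x
      by (simp add: indicator_def)
    ultimately show ?thesis using \<nu>[OF that(1)] by (simp add: set_lebesgue_integral_def)
  qed
  fix A assume "A \<in> sets (pos_variation \<nu>)"
  then have A: "A \<in> sets borel" by (simp add: sp)
  have "emeasure (pos_variation \<nu>) A = (SUP B\<in>{B \<in> sets borel. B \<subseteq> A}. ennreal (\<nu> B))"
  proof (rule emeasure_pos_variation[OF _ _ A])
    show "\<nu> {} = 0" by (simp add: \<nu> set_lebesgue_integral_def)
    fix F :: "nat \<Rightarrow> 'a set" assume F: "range F \<subseteq> sets borel" "disjoint_family F"
    have "(\<lambda>i. \<integral>x\<in>F i. R x \<partial>Q) sums (\<integral>x\<in>(\<Union>i. F i). R x \<partial>Q)"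
      using F by (intro set_lebesgue_integral_sums R) (auto simp: Q)
    moreover have "(\<Union>i. F i) \<in> sets borel" using F by auto
    ultimately show "(\<lambda>i. \<nu> (F i)) sums \<nu> (\<Union>i. F i)" using F \<nu> by (simp add: range_subsetD)
  qed
  also have "\<dots> = (\<integral>\<^sup>+x\<in>A. ennreal (R x) \<partial>Q)"
  proof (rule antisym)
    show "(SUP B\<in>{B \<in> sets borel. B \<subseteq> A}. ennreal (\<nu> B)) \<le> (\<integral>\<^sup>+x\<in>A. ennreal (R x) \<partial>Q)"
    proof (rule SUP_least, clarify)
      fix B assume B: "B \<in> sets borel" "B \<subseteq> A"
      have P: "B \<inter> {x \<in> space Q. 0 \<le> R x} \<in> sets borel" using B(1) S unfolding Q[symmetric] by (rule sets.Int)
      have "\<nu> B \<le> \<nu> (B \<inter> {x \<in> space Q. 0 \<le> R x})"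
        unfolding \<nu>[OF B(1)] \<nu>[OF P] set_lebesgue_integral_def
        using B P Q by (intro integral_mono integrable_mult_indicator R) (auto simp: indicator_def)
      then have "ennreal (\<nu> B) \<le> (\<integral>\<^sup>+x\<in>(B \<inter> {x \<in> space Q. 0 \<le> R x}). ennreal (R x) \<partial>Q)"
        using val[OF P] by (auto dest: ennreal_leI)
      also have "\<dots> \<le> (\<integral>\<^sup>+x\<in>A. ennreal (R x) \<partial>Q)"
        using B by (intro nn_integral_mono) (auto simp: indicator_def)
      finally show "ennreal (\<nu> B) \<le> (\<integral>\<^sup>+x\<in>A. ennreal (R x) \<partial>Q)" .
    qed
    have P: "A \<inter> {x \<in> space Q. 0 \<le> R x} \<in> sets borel" using A S unfolding Q[symmetric] by (rule sets.Int)
    have "(\<integral>\<^sup>+x\<in>A. ennreal (R x) \<partial>Q) = (\<integral>\<^sup>+x\<in>(A \<inter> {x \<in> space Q. 0 \<le> R x}). ennreal (R x) \<partial>Q)"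
      by (intro nn_integral_cong) (auto simp: indicator_def ennreal_neg)
    also have "\<dots> = ennreal (\<nu> (A \<inter> {x \<in> space Q. 0 \<le> R x}))" by (rule val[OF P, symmetric]) auto
    also have "\<dots> \<le> (SUP B\<in>{B \<in> sets borel. B \<subseteq> A}. ennreal (\<nu> B))"
      using P by (intro SUP_upper) auto
    finally show "(\<integral>\<^sup>+x\<in>A. ennreal (R x) \<partial>Q) \<le> (SUP B\<in>{B \<in> sets borel. B \<subseteq> A}. ennreal (\<nu> B))" .
  qed
  also have "\<dots> = emeasure (density Q (\<lambda>x. ennreal (R x))) A"
    using A by (subst emeasure_density) (auto simp: Q)
  finally show "emeasure (pos_variation \<nu>) A = emeasure (density Q (\<lambda>x. ennreal (R x))) A" .
qed

text \<open>The value 0 off the Borel sets is the normalisation demanded by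
  \<open>complex_borel_measure\<close>.\<close>

definition density_cmeasure :: "'a::topological_space measure \<Rightarrow> ('a \<Rightarrow> complex) \<Rightarrow> 'a set \<Rightarrow> complex" where
  "density_cmeasure Q G A = (if A \<in> sets borel then \<integral>x\<in>A. G x \<partial>Q else 0)"

lemma complex_borel_measure_density:
  assumes "sets Q = sets borel" "integrable Q G"
  shows "complex_borel_measure (density_cmeasure Q G)"
  unfolding complex_borel_measure_def density_cmeasure_def
proof (intro conjI allI impI)
  fix F :: "nat \<Rightarrow> 'a set" assume F: "range F \<subseteq> sets borel" "disjoint_family F"
  then have "(\<lambda>i. \<integral>x\<in>F i. G x \<partial>Q) sums (\<integral>x\<in>(\<Union>i. F i). G x \<partial>Q)"
    using assms by (intro set_lebesgue_integral_sums) auto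
  moreover have "(\<Union>i. F i) \<in> sets borel" using F by auto
  ultimately show "(\<lambda>i. if F i \<in> sets borel then \<integral>x\<in>F i. G x \<partial>Q else 0) sums
      (if (\<Union>i. F i) \<in> sets borel then \<integral>x\<in>(\<Union>i. F i). G x \<partial>Q else 0)"
    using F by (simp add: range_subsetD)
qed (auto simp: set_lebesgue_integral_def)

text \<open>The four Jordan parts have as densities the positive parts of the real and imaginary
  parts of \<open>G\<close> and of their negatives; \<open>max 0 r - max 0 (- r) = r\<close>
  recombines them.\<close>

lemma complex_measure_integral_density:
  fixes Q :: "'a::topological_space measure"
  assumes Q: "sets Q = sets borel" and G: "integrable Q G"
    and e: "e \<in> borel_measurable borel" and bound: "\<And>x. norm (e x) \<le> B"
  shows "complex_measure_integral (density_cmeasure Q G) e = (\<integral>x. e x * G x \<partial>Q)"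
proof -
  have R: "integrable Q (\<lambda>x. Re (G x))" "integrable Q (\<lambda>x. Im (G x))" using G by auto
  have re: "Re (density_cmeasure Q G A) = (\<integral>x\<in>A. Re (G x) \<partial>Q)"
    and im: "Im (density_cmeasure Q G A) = (\<integral>x\<in>A. Im (G x) \<partial>Q)" if "A \<in> sets borel" for A
  proof -
    have "integrable Q (\<lambda>x. indicator A x *\<^sub>R G x)" using G that Q by (intro integrable_mult_indicator) auto
    then show "Re (density_cmeasure Q G A) = (\<integral>x\<in>A. Re (G x) \<partial>Q)" "Im (density_cmeasure Q G A) = (\<integral>x\<in>A. Im (G x) \<partial>Q)"
      using that by (simp_all add: density_cmeasure_def set_lebesgue_integral_def flip: integral_Re integral_Im)
  qed
  have [measurable]: "e \<in> borel_measurable Q" using e by (simp cong: measurable_cong_sets add: Q)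
  have key: "(\<integral>x. e x \<partial>density Q (\<lambda>x. ennreal (r x))) - (\<integral>x. e x \<partial>density Q (\<lambda>x. ennreal (- r x))) = (\<integral>x. e x * complex_of_real (r x) \<partial>Q)"
    if r: "integrable Q r" for r :: "'a \<Rightarrow> real"
  proof -
    have [measurable]: "r \<in> borel_measurable Q" using r by auto
    have d: "(\<integral>x. e x \<partial>density Q (\<lambda>x. ennreal (s x))) = (\<integral>x. max 0 (s x) *\<^sub>R e x \<partial>Q)"
      if [measurable]: "s \<in> borel_measurable Q" for s :: "'a \<Rightarrow> real"
    proof -
      have "density Q (\<lambda>x. ennreal (s x)) = density Q (\<lambda>x. ennreal (max 0 (s x)))"
        by (rule density_cong) (auto simp: ennreal_max_0)
      then show ?thesis by (simp add: integral_density)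
    qed
    have i: "integrable Q (\<lambda>x. max 0 (s x) *\<^sub>R e x)" if s: "integrable Q s" for s :: "'a \<Rightarrow> real"
    proof (rule Bochner_Integration.integrable_bound)
      show "integrable Q (\<lambda>x. s x * B)" using s by simp
      have "\<bar>max 0 (s x)\<bar> * norm (e x) \<le> \<bar>s x\<bar> * \<bar>B\<bar>" for x
        using bound[of x] by (intro mult_mono) auto
      then show "AE x in Q. norm (max 0 (s x) *\<^sub>R e x) \<le> norm (s x * B)" by (simp add: abs_mult)
    qed (use s in measurable)
    have "(\<integral>x. e x \<partial>density Q (\<lambda>x. ennreal (r x))) - (\<integral>x. e x \<partial>density Q (\<lambda>x. ennreal (- r x)))
        = (\<integral>x. max 0 (r x) *\<^sub>R e x - max 0 (- r x) *\<^sub>R e x \<partial>Q)"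
      using i[OF r] i[OF Bochner_Integration.integrable_minus[OF r]]
      by (simp add: d Bochner_Integration.integral_diff)
    also have "\<dots> = (\<integral>x. e x * complex_of_real (r x) \<partial>Q)"
      by (intro Bochner_Integration.integral_cong) (auto simp: max_def scaleR_conv_of_real)
    finally show ?thesis .
  qed
  have i: "integrable Q (\<lambda>x. e x * complex_of_real (r x))" if r: "integrable Q r" for r :: "'a \<Rightarrow> real"
  proof (rule Bochner_Integration.integrable_bound)
    show "integrable Q (\<lambda>x. r x * B)" using r by simp
    have "norm (e x) * \<bar>r x\<bar> \<le> \<bar>r x\<bar> * \<bar>B\<bar>" for x
      using bound[of x] by (subst mult.commute, intro mult_mono) auto
    then show "AE x in Q. norm (e x * complex_of_real (r x)) \<le> norm (r x * B)" by (simp add: abs_mult norm_mult)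
  qed (use r in measurable)
  have "complex_measure_integral (density_cmeasure Q G) e =
      (\<integral>x. e x * complex_of_real (Re (G x)) \<partial>Q) + \<i> * (\<integral>x. e x * complex_of_real (Im (G x)) \<partial>Q)"
    unfolding complex_measure_integral_def
    by (subst pos_variation_density[OF Q R(1) re], simp)
      (subst pos_variation_density[OF Q Bochner_Integration.integrable_minus[OF R(1)]], simp add: re set_lebesgue_integral_def,
       subst pos_variation_density[OF Q R(2) im], simp,
       subst pos_variation_density[OF Q Bochner_Integration.integrable_minus[OF R(2)]], simp add: im set_lebesgue_integral_def,
       simp add: key R)
  also have "\<dots> = (\<integral>x. e x * complex_of_real (Re (G x)) + \<i> * (e x * complex_of_real (Im (G x))) \<partial>Q)"
    using R by (subst Bochner_Integration.integral_add) (auto intro!: i)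
  also have "\<dots> = (\<integral>x. e x * G x \<partial>Q)"
    by (intro Bochner_Integration.integral_cong refl) (subst (3) complex_eq, simp add: algebra_simps)
  finally show ?thesis .
qed

section \<open>The annihilating density for large parameters\<close>

text \<open>A product is at most the sum of squares. As \<open>d\<close> bounds the vertical
  distance to both poles from below, one integrable majorant serves a whole strip of horizontal
  lines.\<close>

lemma norm_inverse_mult_le:
  fixes z p q :: complex
  assumes "d > 0" "d \<le> \<bar>Im z - Im p\<bar>" "d \<le> \<bar>Im z - Im q\<bar>"
  shows "norm (1 / ((z - p) * (z - q))) \<le> 1 / ((Re z - Re p)\<^sup>2 + d\<^sup>2) + 1 / ((Re z - Re q)\<^sup>2 + d\<^sup>2)"
proof -
  have nz: "1 / (norm (z - p))\<^sup>2 \<le> 1 / ((Re z - Re p)\<^sup>2 + d\<^sup>2)" if "d \<le> \<bar>Im z - Im p\<bar>" for p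
  proof (rule divide_left_mono)
    have "d\<^sup>2 \<le> (Im z - Im p)\<^sup>2" using that assms(1) by (metis abs_le_square_iff abs_of_pos)
    then show *: "(Re z - Re p)\<^sup>2 + d\<^sup>2 \<le> (norm (z - p))\<^sup>2" by (simp add: cmod_power2)
    have "0 < (Re z - Re p)\<^sup>2 + d\<^sup>2" using assms(1) by (intro add_nonneg_pos) auto
    then show "0 < (norm (z - p))\<^sup>2 * ((Re z - Re p)\<^sup>2 + d\<^sup>2)" using * by (intro mult_pos_pos) linarith+
  qed simp
  have amgm: "a * b \<le> a\<^sup>2 + b\<^sup>2" if "0 \<le> a" "0 \<le> b" for a b :: real
    using that sum_squares_bound[of a b] mult_nonneg_nonneg[OF that] by linarith
  have "norm (1 / ((z - p) * (z - q))) = (1 / norm (z - p)) * (1 / norm (z - q))"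
    by (simp add: norm_divide norm_mult)
  also have "\<dots> \<le> (1 / norm (z - p))\<^sup>2 + (1 / norm (z - q))\<^sup>2" by (rule amgm) auto
  also have "\<dots> \<le> 1 / ((Re z - Re p)\<^sup>2 + d\<^sup>2) + 1 / ((Re z - Re q)\<^sup>2 + d\<^sup>2)"
    using nz[OF assms(2)] nz[OF assms(3)] by (simp add: power_divide)
  finally show ?thesis .
qed

lemma norm_inverse_mult_decay:
  fixes z p q :: complex
  assumes "2 * norm p \<le> norm z" "2 * norm q \<le> norm z"
  shows "norm (1 / ((z - p) * (z - q))) \<le> 4 / (norm z)\<^sup>2"
proof (cases "z = 0")
  case False
  have "norm z / 2 \<le> norm (z - p)" "norm z / 2 \<le> norm (z - q)"
    using norm_triangle_ineq2[of z p] norm_triangle_ineq2[of z q] assms by linarith+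
  then have "norm z / 2 * (norm z / 2) \<le> norm (z - p) * norm (z - q)" by (intro mult_mono) auto
  then have le: "(norm z)\<^sup>2 / 4 \<le> norm ((z - p) * (z - q))" by (simp add: norm_mult power2_eq_square)
  have "1 / norm ((z - p) * (z - q)) \<le> 1 / ((norm z)\<^sup>2 / 4)"
    using le False by (intro divide_left_mono mult_pos_pos) (auto intro: order_less_le_trans[OF _ le])
  then show ?thesis by (simp add: norm_divide)
qed (use assms in simp)

text \<open>At real t \<noteq> 0 this is the character of frequency \<open>(a, b / c)\<close>,
  \<open>c = m^2/(4 pi^2)\<close>, at the point of the hyperbola with first coordinate t. It extends
  holomorphically off 0, where it has an essential singularity if \<open>b\<close> is
  nonzero.\<close>

definition wave :: "real \<Rightarrow> real \<Rightarrow> complex \<Rightarrow> complex" where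
  "wave a b z = exp (\<i> * complex_of_real pi * (complex_of_real a * z - complex_of_real b / z))"

lemma wave_uminus: "wave a b (- z) = wave (- a) (- b) z"
  by (simp add: wave_def)

lemma wave_0 [simp]: "wave 0 0 z = 1"
  by (simp add: wave_def)

lemma holomorphic_wave: "0 \<notin> S \<Longrightarrow> wave a b holomorphic_on S"
  unfolding wave_def[abs_def] by (intro holomorphic_intros) auto

lemma isCont_wave: "z \<noteq> 0 \<Longrightarrow> isCont (wave a b) z"
  unfolding wave_def[abs_def] by (intro continuous_intros) auto

text \<open>Both \<open>z\<close> and \<open>- 1 / z\<close> stay in the closed upper half-plane, so
  the exponent has nonpositive real part.\<close>

lemma norm_wave_le_1:
  assumes "a \<ge> 0" "b \<ge> 0" "Im z \<ge> 0"
  shows "norm (wave a b z) \<le> 1"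
proof -
  have "0 \<le> Im (complex_of_real a * z - complex_of_real b / z)"
    using assms by (simp add: Im_divide complex_is_Real_iff mult_nonneg_nonneg add_nonneg_nonneg divide_nonneg_nonneg)
  then show ?thesis by (simp add: wave_def mult.assoc)
qed

section \<open>Boundary values and integrals against the rational density\<close>

lemma tendsto_Complex_at_right_0: "((\<lambda>y. Complex x y) \<longlongrightarrow> complex_of_real x) (at_right 0)"
proof -
  have "((\<lambda>y. complex_of_real x + \<i> * complex_of_real y) \<longlongrightarrow> complex_of_real x + \<i> * complex_of_real 0) (at_right 0)"
    by (intro tendsto_intros)
  then show ?thesis by (simp add: Complex_eq)
qed

lemma measurable_wave [measurable]: "(\<lambda>x. wave a b (complex_of_real x)) \<in> borel_measurable borel"
  unfolding wave_def by measurable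

text \<open>The poles lie below the real line, so the integrand is holomorphic above it and decays
  quadratically there.\<close>

lemma wave_integral_upper_eq_0:
  assumes a: "a \<ge> 0" "b \<ge> 0" and p: "Im p < 0" "Im q < 0"
  shows "(\<integral>x. wave a b (complex_of_real x) / ((complex_of_real x - p) * (complex_of_real x - q)) \<partial>lborel) = 0"
proof (rule half_plane_boundary_integral_eq_0)
  let ?G = "\<lambda>z. wave a b z / ((z - p) * (z - q))"
  define d where "d = min (- Im p) (- Im q)"
  have d: "d > 0" using p by (simp add: d_def)
  show "?G holomorphic_on {z. 0 < Im z}"
    using p by (intro holomorphic_on_divide holomorphic_wave holomorphic_intros) auto
  have w: "norm (?G z) \<le> norm (1 / ((z - p) * (z - q)))" if "0 < Im z" for z
    using norm_wave_le_1[OF a, of z] that by (simp add: norm_divide divide_right_mono)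
  show "norm (?G z) \<le> 4 / (norm z)\<^sup>2" if "0 < Im z" "2 * max (norm p) (norm q) \<le> norm z" for z
    using w[of z] norm_inverse_mult_decay[of p z q] that max.cobounded1[of "norm p" "norm q"]
      max.cobounded2[of "norm q" "norm p"] by linarith
  show "norm (?G (Complex x y)) \<le> 1 / ((x - Re p)\<^sup>2 + d\<^sup>2) + 1 / ((x - Re q)\<^sup>2 + d\<^sup>2)" if "0 < y" "y < 1" for x y
  proof -
    have "d \<le> \<bar>y - Im p\<bar>" "d \<le> \<bar>y - Im q\<bar>" using that by (auto simp: d_def)
    then show ?thesis
      using w[of "Complex x y"] norm_inverse_mult_le[OF d, of "Complex x y" p q] that by simp
  qed
  show "integrable lborel (\<lambda>x. 1 / ((x - Re p)\<^sup>2 + d\<^sup>2) + 1 / ((x - Re q)\<^sup>2 + d\<^sup>2))"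
    by (intro Bochner_Integration.integrable_add integrable_inverse_shifted_square d)
  show "((\<lambda>y. ?G (Complex x y)) \<longlongrightarrow> ?G (complex_of_real x)) (at_right 0)" if "x \<noteq> 0" for x
  proof -
    have "complex_of_real x \<noteq> p" "complex_of_real x \<noteq> q" using p by auto
    then show ?thesis
      using that by (intro tendsto_intros tendsto_Complex_at_right_0 isCont_tendsto_compose[OF isCont_wave]) auto
  qed
qed auto

text \<open>The poles now lie in the half-plane of integration, and subtracting the common value at
  \<open>p\<close> and \<open>q\<close> cancels both.\<close>

lemma wave_integral_upper_removable_eq_0:
  assumes a: "a \<ge> 0" "b \<ge> 0" and p: "Im p > 0" "Im q > 0" "p \<noteq> q" and eq: "wave a b p = wave a b q"
  shows "(\<integral>x. (wave a b (complex_of_real x) - wave a b p) / ((complex_of_real x - p) * (complex_of_real x - q)) \<partial>lborel) = 0"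
proof (rule half_plane_boundary_integral_eq_0)
  let ?F = "\<lambda>z. (wave a b z - wave a b p) / ((z - p) * (z - q))"
  \<comment> \<open>both zeros of the denominator are removable because \<open>wave a b p = wave a b q\<close>\<close>
  define G1 where "G1 z = (if z = p then deriv (wave a b) p else (wave a b z - wave a b p) / (z - p))" for z
  define G where "G z = (if z = q then deriv G1 q else (G1 z - G1 q) / (z - q))" for z
  \<comment> \<open>Half the smaller height: lines with \<open>y < d\<close> stay at distance at
    least \<open>d\<close> from both poles, where \<open>G\<close> is the plain quotient.\<close>
  define d where "d = min (Im p) (Im q) / 2"
  have d: "d > 0" using p by (simp add: d_def)
  have o: "open {z. 0 < Im z}" by (rule open_halfspace_Im_gt)
  have "G1 holomorphic_on {z. 0 < Im z}"
    unfolding G1_def[abs_def] by (intro pole_lemma_open holomorphic_wave o) auto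
  then show "G holomorphic_on {z. 0 < Im z}"
    unfolding G_def[abs_def] by (rule pole_lemma_open[OF _ o])
  have "G1 q = 0" using p eq by (simp add: G1_def)
  then have GF: "G z = ?F z" if "z \<noteq> p" "z \<noteq> q" for z using that by (simp add: G_def G1_def)
  have w: "norm (?F z) \<le> 2 * norm (1 / ((z - p) * (z - q)))" if "0 < Im z" for z
  proof -
    have "norm (wave a b z - wave a b p) \<le> 2"
      using norm_triangle_ineq4[of "wave a b z" "wave a b p"] norm_wave_le_1[OF a, of z] norm_wave_le_1[OF a, of p] that p by simp
    then show ?thesis by (simp add: norm_divide divide_right_mono)
  qed
  show "norm (G z) \<le> 8 / (norm z)\<^sup>2" if "0 < Im z" "2 * max (norm p) (norm q) \<le> norm z" for z
  proof -
    have n: "norm p > 0" "norm q > 0" using p by auto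
    have le: "2 * norm p \<le> norm z" "2 * norm q \<le> norm z"
      using that(2) max.cobounded1[of "norm p" "norm q"] max.cobounded2[of "norm q" "norm p"] by linarith+
    then have "z \<noteq> p" "z \<noteq> q" using n by auto
    then show ?thesis using GF[of z] w[OF that(1)] norm_inverse_mult_decay[OF le] by simp
  qed
  show "norm (G (Complex x y)) \<le> 2 * (1 / ((x - Re p)\<^sup>2 + d\<^sup>2) + 1 / ((x - Re q)\<^sup>2 + d\<^sup>2))" if "0 < y" "y < d" for x y
  proof -
    have "2 * d \<le> Im p" "2 * d \<le> Im q" by (auto simp: d_def)
    then have b: "d \<le> \<bar>y - Im p\<bar>" "d \<le> \<bar>y - Im q\<bar>" using that by linarith+
    then have "Complex x y \<noteq> p" "Complex x y \<noteq> q" using d by auto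
    then show ?thesis using GF[of "Complex x y"] w[of "Complex x y"] norm_inverse_mult_le[OF d, of "Complex x y" p q] that b by simp
  qed
  show "integrable lborel (\<lambda>x. 2 * (1 / ((x - Re p)\<^sup>2 + d\<^sup>2) + 1 / ((x - Re q)\<^sup>2 + d\<^sup>2)))"
    by (intro integrable_mult_right Bochner_Integration.integrable_add integrable_inverse_shifted_square d)
  show "((\<lambda>y. G (Complex x y)) \<longlongrightarrow> ?F (complex_of_real x)) (at_right 0)" if "x \<noteq> 0" for x
  proof (rule Lim_transform_eventually)
    show "((\<lambda>y. ?F (Complex x y)) \<longlongrightarrow> ?F (complex_of_real x)) (at_right 0)"
    proof -
      have "complex_of_real x \<noteq> p" "complex_of_real x \<noteq> q" using p by auto
      then show ?thesis
        using that by (intro tendsto_intros tendsto_Complex_at_right_0 isCont_tendsto_compose[OF isCont_wave]) auto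
    qed
    show "\<forall>\<^sub>F y in at_right 0. ?F (Complex x y) = G (Complex x y)"
      unfolding eventually_at_right_field
    proof (intro exI[of _ d] conjI allI impI d)
      fix y assume "0 < y" "y < d"
      moreover have "2 * d \<le> Im p" "2 * d \<le> Im q" by (auto simp: d_def)
      ultimately show "?F (Complex x y) = G (Complex x y)" by (intro GF[symmetric]) auto
    qed
  qed
  show "0 < d" by (rule d)
qed auto

lemma integrable_inverse_mult:
  assumes "Im p > 0" "Im q > 0" and h: "h \<in> borel_measurable borel" "\<And>x. norm (h x) \<le> 1"
  shows "integrable lborel (\<lambda>x. h x / ((complex_of_real x - p) * (complex_of_real x - q)))"
proof (rule Bochner_Integration.integrable_bound)
  define d where "d = min (Im p) (Im q)"
  have d: "d > 0" using assms by (simp add: d_def)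
  show "integrable lborel (\<lambda>x. 1 / ((x - Re p)\<^sup>2 + d\<^sup>2) + 1 / ((x - Re q)\<^sup>2 + d\<^sup>2))"
    by (intro Bochner_Integration.integrable_add integrable_inverse_shifted_square d)
  have "norm (h x / ((complex_of_real x - p) * (complex_of_real x - q))) \<le>
      1 / ((x - Re p)\<^sup>2 + d\<^sup>2) + 1 / ((x - Re q)\<^sup>2 + d\<^sup>2)" for x
  proof -
    have "norm (h x / ((complex_of_real x - p) * (complex_of_real x - q))) \<le> norm (1 / ((complex_of_real x - p) * (complex_of_real x - q)))"
      using h(2)[of x] by (simp add: norm_divide divide_right_mono)
    also have "\<dots> \<le> 1 / ((x - Re p)\<^sup>2 + d\<^sup>2) + 1 / ((x - Re q)\<^sup>2 + d\<^sup>2)"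
      using norm_inverse_mult_le[OF d, of "complex_of_real x" p q] by (simp add: d_def)
    finally show ?thesis .
  qed
  then show "AE x in lborel. norm (h x / ((complex_of_real x - p) * (complex_of_real x - q)))
      \<le> norm (1 / ((x - Re p)\<^sup>2 + d\<^sup>2) + 1 / ((x - Re q)\<^sup>2 + d\<^sup>2))"
    by (auto intro: order_trans[OF _ abs_ge_self])
qed (use h in measurable)

lemma norm_wave_of_real: "norm (wave a b (complex_of_real x)) = 1"
  by (simp add: wave_def flip: of_real_mult of_real_divide of_real_diff)

text \<open>The reflection t -> -t reverses the signs of \<open>a\<close> and \<open>b\<close> and
  moves the poles to \<open>- p\<close> and \<open>- q\<close>, below the real line.\<close>

lemma wave_integral_lower_eq_0:
  assumes "a \<le> 0" "b \<le> 0" "Im p > 0" "Im q > 0"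
  shows "(\<integral>x. wave a b (complex_of_real x) / ((complex_of_real x - p) * (complex_of_real x - q)) \<partial>lborel) = 0"
proof -
  have "(\<integral>x. wave a b (complex_of_real x) / ((complex_of_real x - p) * (complex_of_real x - q)) \<partial>lborel) =
      \<bar>- 1\<bar> *\<^sub>R (\<integral>x. wave a b (complex_of_real (0 + (- 1) * x)) / ((complex_of_real (0 + (- 1) * x) - p) * (complex_of_real (0 + (- 1) * x) - q)) \<partial>lborel)"
    by (rule lborel_integral_real_affine) simp
  also have "\<dots> = (\<integral>x. wave (- a) (- b) (complex_of_real x) / ((complex_of_real x - (- p)) * (complex_of_real x - (- q))) \<partial>lborel)"
    by (simp add: wave_uminus, intro Bochner_Integration.integral_cong refl) (simp add: algebra_simps)
  also have "\<dots> = 0" by (rule wave_integral_upper_eq_0) (use assms in auto)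
  finally show ?thesis .
qed

text \<open>The subtracted constant is restored: it is the character of frequency 0, whose integral
  vanishes by the lower half-plane case.\<close>

lemma wave_integral_eq_0:
  assumes "a \<ge> 0" "b \<ge> 0" "Im p > 0" "Im q > 0" "p \<noteq> q" "wave a b p = wave a b q"
  shows "(\<integral>x. wave a b (complex_of_real x) / ((complex_of_real x - p) * (complex_of_real x - q)) \<partial>lborel) = 0"
proof -
  let ?k = "\<lambda>x. 1 / ((complex_of_real x - p) * (complex_of_real x - q))"
  have i1: "integrable lborel (\<lambda>x. wave a b (complex_of_real x) / ((complex_of_real x - p) * (complex_of_real x - q)))"
    using assms by (intro integrable_inverse_mult) (auto simp: norm_wave_of_real)
  have i2: "integrable lborel ?k" using assms by (intro integrable_inverse_mult) auto
  have k0: "(\<integral>x. ?k x \<partial>lborel) = 0" using wave_integral_lower_eq_0[of 0 0 p q] assms by simp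
  have "0 = (\<integral>x. wave a b (complex_of_real x) / ((complex_of_real x - p) * (complex_of_real x - q)) - wave a b p * ?k x \<partial>lborel)"
    using wave_integral_upper_removable_eq_0[OF assms] by (simp add: diff_divide_distrib)
  also have "\<dots> = (\<integral>x. wave a b (complex_of_real x) / ((complex_of_real x - p) * (complex_of_real x - q)) \<partial>lborel)
      - wave a b p * (\<integral>x. ?k x \<partial>lborel)"
    using i1 i2 by (subst Bochner_Integration.integral_diff) (auto simp del: times_divide_eq_right)
  finally show ?thesis using k0 by simp
qed

lemma measurable_hyperbola_param_lborel [measurable]: "hyperbola_param m \<in> borel_measurable borel"
  unfolding hyperbola_param_def[abs_def] by measurable

lemma exp_pi_int_shift:
  "exp (\<i> * complex_of_real pi * (of_int k * (z + 2))) = exp (\<i> * complex_of_real pi * (of_int k * z))"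
proof -
  have "exp (\<i> * complex_of_real pi * (of_int k * (z + 2))) =
      exp (\<i> * complex_of_real pi * (of_int k * z)) * exp ((2 * of_int k * complex_of_real pi) * \<i>)"
    by (simp add: algebra_simps flip: exp_add)
  then show ?thesis using exp_integer_2pi[of "of_int k"] by (simp add: mult.assoc)
qed

text \<open>Nonpositive frequencies are annihilated because the poles lie in the upper half-plane.
  For positive ones on the first axis, \<open>\<alpha> * p\<close> and \<open>\<alpha> * q\<close>
  differ by the period 2; on the second axis the inversion exchanges these two points, so the same
  period applies.\<close>

lemma not_fourier_uniqueness_set:
  assumes pos: "\<alpha> > 0" "\<beta> > 0" "m > 0" and E: "E \<subseteq> closed_quadrant_neg"
    and large: "\<alpha> * \<beta> * m\<^sup>2 > 4 * pi\<^sup>2"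
  shows "\<not> fourier_uniqueness_set (lattice_cross \<alpha> \<beta> \<union> E) (measures_on (hyperbola m))"
proof -
  define c where "c = m\<^sup>2 / (4 * pi\<^sup>2)"
  define \<gamma> where "\<gamma> = \<alpha> * \<beta> * c"
  define r where "r = sqrt (\<gamma> - 1)"
  \<comment> \<open>Scaled by \<alpha> these are -1 + ir and 1 + ir, with difference 2 and product
    -(1 + r^2), which \<open>r\<close> makes equal to -\<gamma>.\<close>
  define p q where "p = Complex (- 1 / \<alpha>) (r / \<alpha>)" and "q = Complex (1 / \<alpha>) (r / \<alpha>)"
  have c: "c > 0" using pos by (simp add: c_def)
  have \<gamma>: "\<gamma> > 1" using large by (simp add: \<gamma>_def c_def field_simps)
  have r: "r > 0" "r\<^sup>2 = \<gamma> - 1" using \<gamma> by (auto simp: r_def)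
  have pq: "Im p > 0" "Im q > 0" "p \<noteq> q" using pos r by (auto simp: p_def q_def)
  have \<alpha>q: "complex_of_real \<alpha> * q = complex_of_real \<alpha> * p + 2"
    using pos by (simp add: p_def q_def complex_eq_iff)
  have prod: "(complex_of_real \<alpha> * p) * (complex_of_real \<alpha> * q) = - complex_of_real \<gamma>"
    using pos r(2) by (simp add: p_def q_def complex_eq_iff power2_eq_square)
  have nz: "p \<noteq> 0" "q \<noteq> 0" using pq by auto
  define g where "g t = 1 / ((complex_of_real t - p) * (complex_of_real t - q))" for t
  define G where "G x = g (fst x)" for x :: "real \<times> real"
  \<comment> \<open>Lebesgue measure in the parameter rather than arc length turns the transform
    into a plain integral over the line.\<close>
  define Q where "Q = distr lborel borel (hyperbola_param m)"
  define \<mu> where "\<mu> = density_cmeasure Q G"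
  have Q: "sets Q = sets borel" by (simp add: Q_def)
  have g_meas [measurable]: "g \<in> borel_measurable borel" unfolding g_def by measurable
  have G_meas [measurable]: "G \<in> borel_measurable borel" unfolding G_def
    by (rule measurable_compose[OF _ g_meas], intro borel_measurable_continuous_onI continuous_intros)
  have Ghp: "G (hyperbola_param m t) = g t" for t by (simp add: G_def hyperbola_param_def)
  have g_int: "integrable lborel g"
    unfolding g_def using pq by (intro integrable_inverse_mult) auto
  have G_int: "integrable Q G"
    unfolding Q_def by (subst integrable_distr_eq) (auto simp: Ghp g_int)
  have ft: "fourier_transform \<mu> (a, b) = (\<integral>t. wave a (c * b) (complex_of_real t) / ((complex_of_real t - p) * (complex_of_real t - q)) \<partial>lborel)" for a b
  proof -
    let ?e = "\<lambda>x. exp (\<i> * complex_of_real (pi * (x \<bullet> (a, b))))"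
    have [measurable]: "?e \<in> borel_measurable borel" by measurable
    have "fourier_transform \<mu> (a, b) = (\<integral>x. ?e x * G x \<partial>Q)"
      unfolding fourier_transform_def \<mu>_def
      by (rule complex_measure_integral_density[OF Q G_int, of _ 1]) auto
    also have "\<dots> = (\<integral>t. ?e (hyperbola_param m t) * g t \<partial>lborel)"
      unfolding Q_def by (subst integral_distr) (auto simp: Ghp)
    also have "\<dots> = (\<integral>t. wave a (c * b) (complex_of_real t) / ((complex_of_real t - p) * (complex_of_real t - q)) \<partial>lborel)"
    proof (rule Bochner_Integration.integral_cong[OF refl])
      fix t
      have "hyperbola_param m t \<bullet> (a, b) = a * t - c * b / t" by (simp add: hyperbola_param_def c_def)
      then have "?e (hyperbola_param m t) = wave a (c * b) (complex_of_real t)"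
        by (simp add: wave_def mult.assoc)
      then show "?e (hyperbola_param m t) * g t = wave a (c * b) (complex_of_real t) / ((complex_of_real t - p) * (complex_of_real t - q))"
        by (simp add: g_def)
    qed
    finally show ?thesis .
  qed
  have quad: "fourier_transform \<mu> (a, b) = 0" if "a \<le> 0" "b \<le> 0" for a b
    unfolding ft by (rule wave_integral_lower_eq_0) (use that c pq in \<open>auto intro: mult_nonneg_nonpos\<close>)
  have axis1: "fourier_transform \<mu> (\<alpha> * of_int j, 0) = 0" for j
  proof (cases "j \<le> 0")
    case True
    then show ?thesis using pos by (intro quad) (auto intro: mult_nonneg_nonpos)
  next
    case False
    have w: "wave (\<alpha> * of_int j) 0 z = exp (\<i> * complex_of_real pi * (of_int j * (complex_of_real \<alpha> * z)))" for z
      by (simp add: wave_def mult_ac)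
    have "wave (\<alpha> * of_int j) 0 p = wave (\<alpha> * of_int j) 0 q"
      unfolding w \<alpha>q exp_pi_int_shift ..
    then show ?thesis
      unfolding ft using False pos pq by (intro wave_integral_eq_0) auto
  qed
  have axis2: "fourier_transform \<mu> (0, \<beta> * of_int k) = 0" for k
  proof (cases "k \<le> 0")
    case True
    then show ?thesis using pos by (intro quad) (auto intro: mult_nonneg_nonpos)
  next
    case False
    \<comment> \<open>A second-axis exponential at \<open>z\<close> equals a first-axis one at the
      partner \<open>z'\<close>; \<open>p\<close> and \<open>q\<close> are partners of each
      other.\<close>
    have w: "wave 0 (c * (\<beta> * of_int k)) z = exp (\<i> * complex_of_real pi * (of_int k * (complex_of_real \<alpha> * z')))"
      if z: "z \<noteq> 0" "(complex_of_real \<alpha> * z) * (complex_of_real \<alpha> * z') = - complex_of_real \<gamma>" for z z'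
    proof -
      have "complex_of_real \<alpha> * (complex_of_real \<alpha> * z * z') = complex_of_real \<alpha> * (- complex_of_real (\<beta> * c))"
        using z(2) by (simp add: \<gamma>_def mult_ac)
      then have "complex_of_real \<alpha> * z * z' = - complex_of_real (\<beta> * c)"
        using pos by (simp only: mult_cancel_left) simp
      then have "complex_of_real \<alpha> * z' * z = - complex_of_real (\<beta> * c)"
        by (simp add: mult_ac)
      then have "complex_of_real \<alpha> * z' = - complex_of_real (\<beta> * c) / z"
        using z(1) nonzero_mult_div_cancel_right[of z "complex_of_real \<alpha> * z'"] by simp
      then show ?thesis by (simp add: wave_def mult_ac)
    qed
    have "wave 0 (c * (\<beta> * of_int k)) p = wave 0 (c * (\<beta> * of_int k)) q"
      using w[OF nz(1) prod] w[of q p] nz prod \<alpha>q exp_pi_int_shift[of k "complex_of_real \<alpha> * p"]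
      by (simp add: mult.commute)
    then show ?thesis
      unfolding ft using False pos pq c by (intro wave_integral_eq_0) auto
  qed
  have "fourier_transform \<mu> \<xi> = 0" if "\<xi> \<in> lattice_cross \<alpha> \<beta> \<union> E" for \<xi>
    using that E axis1 axis2 quad by (auto simp: lattice_cross_def closed_quadrant_neg_def)
  moreover have "\<mu> \<in> measures_on (hyperbola m)"
    unfolding measures_on_def
  proof (intro CollectI conjI ballI impI)
    show "complex_borel_measure \<mu>" unfolding \<mu>_def by (rule complex_borel_measure_density[OF Q G_int])
    fix A :: "(real \<times> real) set" assume A: "A \<in> sets borel" "A \<inter> hyperbola m = {}"
    have [measurable]: "A \<in> sets borel" by fact
    have "\<mu> A = (\<integral>t. indicator A (hyperbola_param m t) *\<^sub>R g t \<partial>lborel)"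
      using A unfolding \<mu>_def density_cmeasure_def set_lebesgue_integral_def Q_def
      by (simp, subst integral_distr) (auto simp: Ghp)
    also have "\<dots> = (\<integral>t. 0 \<partial>(lborel :: real measure))"
    proof (rule integral_cong_AE)
      \<comment> \<open>The parameter 0 is sent to the origin, off the hyperbola, so it is discarded
        as a null point.\<close>
      show "AE t in lborel. indicator A (hyperbola_param m t) *\<^sub>R g t = 0"
        using AE_lborel_singleton[of "0::real"]
      proof eventually_elim
        case (elim t)
        then have "hyperbola_param m t \<in> hyperbola m" by (simp add: hyperbola_param_def hyperbola_def)
        then show ?case using A(2) by (auto simp: indicator_def)
      qed
    qed auto
    finally show "\<mu> A = 0" by simp
  qed
  moreover have "\<mu> \<noteq> (\<lambda>_. 0)"
  proof
    assume \<mu>0: "\<mu> = (\<lambda>_. 0)"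
    define A where "A = {x. Re (G x) > 0}"
    have [measurable]: "A \<in> sets borel" unfolding A_def by measurable
    have i: "integrable Q (\<lambda>x. indicator A x *\<^sub>R G x)"
      by (intro integrable_mult_indicator G_int) (simp add: Q)
    have "0 = Re (\<integral>x. indicator A x *\<^sub>R G x \<partial>Q)"
      using fun_cong[OF \<mu>0, of A] by (simp add: \<mu>_def density_cmeasure_def set_lebesgue_integral_def)
    also have "\<dots> = (\<integral>x. indicator A x * Re (G x) \<partial>Q)" using integral_Re[OF i] by simp
    finally have "(\<integral>x. indicator A x * Re (G x) \<partial>Q) = 0" by simp
    moreover have "integrable Q (\<lambda>x. indicator A x * Re (G x))" using i by (auto dest: integrable_Re)
    ultimately have "AE x in Q. indicator A x * Re (G x) = 0"
      by (subst (asm) integral_nonneg_eq_0_iff_AE) (auto simp: A_def indicator_def)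
    then have "AE t in lborel. indicator A (hyperbola_param m t) * Re (g t) = 0"
      unfolding Q_def by (subst (asm) AE_distr_iff) (auto simp: Ghp)
    \<comment> \<open>As p + q is imaginary and pq = -\<gamma>/\<alpha>^2, the real part of (t -
      p)(t - q) is t^2 - \<gamma>/\<alpha>^2, positive on a ray of positive measure.\<close>
    moreover have "Re (g t) > 0" if "t > sqrt \<gamma> / \<alpha>" for t
    proof -
      have "0 \<le> sqrt \<gamma> / \<alpha>" using \<gamma> pos by simp
      then have "(sqrt \<gamma> / \<alpha>)\<^sup>2 < t\<^sup>2" using that by (intro power_strict_mono) auto
      then have "0 < t\<^sup>2 - \<gamma> / \<alpha>\<^sup>2" using \<gamma> by (simp add: power_divide)
      moreover have "Re ((complex_of_real t - p) * (complex_of_real t - q)) = t\<^sup>2 - \<gamma> / \<alpha>\<^sup>2"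
      proof -
        have "\<gamma> / \<alpha>\<^sup>2 = 1 / \<alpha>\<^sup>2 + r\<^sup>2 / \<alpha>\<^sup>2" using r(2) by (simp add: diff_divide_distrib)
        then show ?thesis by (simp add: p_def q_def power2_eq_square algebra_simps)
      qed
      moreover have "Re (1 / w) > 0" if "Re w > 0" for w
        using that by (auto simp: Re_divide intro!: divide_pos_pos add_pos_nonneg)
      ultimately show ?thesis by (simp add: g_def)
    qed
    then have "\<not> t > sqrt \<gamma> / \<alpha>" if "indicator A (hyperbola_param m t) * Re (g t) = 0" for t
      using that by (fastforce simp: A_def Ghp indicator_def)
    ultimately have "AE t in lborel. \<not> t > sqrt \<gamma> / \<alpha>"
      by (auto elim: eventually_mono)
    then have "emeasure lborel {sqrt \<gamma> / \<alpha><..} = 0"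
      by (subst (asm) AE_iff_measurable[of "{sqrt \<gamma> / \<alpha><..}"]) auto
    moreover have "emeasure lborel {sqrt \<gamma> / \<alpha> + 1..sqrt \<gamma> / \<alpha> + 2} \<le> emeasure lborel {sqrt \<gamma> / \<alpha><..}"
      by (intro emeasure_mono) auto
    ultimately show False by simp
  qed
  ultimately show ?thesis unfolding fourier_uniqueness_set_def by blast
qed

theorem theorem3p3:
  fixes \<alpha> \<beta> m :: real and E :: "(real \<times> real) set"
  assumes "\<alpha> > 0" and "\<beta> > 0" and "m > 0"
    and "E \<subseteq> closed_quadrant_neg"
    and "riesz_set m E"
  shows "fourier_uniqueness_set (lattice_cross \<alpha> \<beta> \<union> E) (measures_on (hyperbola m))
           \<longleftrightarrow> \<alpha> * \<beta> * m\<^sup>2 \<le> 4 * pi\<^sup>2"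
proof
  assume "fourier_uniqueness_set (lattice_cross \<alpha> \<beta> \<union> E) (measures_on (hyperbola m))"
  then show "\<alpha> * \<beta> * m\<^sup>2 \<le> 4 * pi\<^sup>2"
    using not_fourier_uniqueness_set[OF assms(1-4)] by (meson not_le)
next
  assume small: "\<alpha> * \<beta> * m\<^sup>2 \<le> 4 * pi\<^sup>2"
  show "fourier_uniqueness_set (lattice_cross \<alpha> \<beta> \<union> E) (measures_on (hyperbola m))"
    unfolding fourier_uniqueness_set_def
  proof (intro ballI impI)
    fix \<mu> assume \<mu>: "\<mu> \<in> measures_on (hyperbola m)"
      and ft: "\<forall>\<xi>\<in>lattice_cross \<alpha> \<beta> \<union> E. fourier_transform \<mu> \<xi> = 0"
    then have "absolutely_continuous_wrt \<mu> (arc_length_measure m)"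
      using assms(5) by (auto simp: riesz_set_def)
    then show "\<mu> = (\<lambda>_. 0)"
      using ft by (intro fourier_uniqueness_set_absolutely_continuous[OF assms(1-3) small \<mu>]) auto
  qed
qed

end
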